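(* Let $m\le n$ be positive integers and let $A=(a_{ij})$ be an $m\times n$ matrix with entries from a semiring $S$. Define the permanent $$\operatorname{per}A=\sum_{\sigma} a_{1\sigma(1)}\,a_{2\sigma(2)}\cdots a_{m\sigma(m)},$$ where the sum ranges over all injections $\sigma:\{1,\dots,m\}\to\{1,\dots,n\}$ and each product is taken in the order written. Then $\operatorname{per}A$ can be computed (i) if $S$ is an arbitrary semiring, in time $O\big(m\langle n,m\rangle\big)$ and space $O\big(\langle n,m\rangle\big)$; (ii) if $S$ is a commutative semiring, in time $O\big(m(n-m+1)2^m\big)$ and space $O\big((n-m+1)2^m\big)$; (iii) if $S$ is a ring (not necessarily commutative), in time $O\big(m\langle n,m/2\rangle\big)$ and space $O\big(\langle n,m/2\rangle\big)$; (iv) if $S$ is a commutative ring, in time $O\big((mn-m^2+n)2^m\big)$ and space $O(n)$.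
   Context: A semiring is a set with an addition that is associative and commutative with identity $0$, and an associative multiplication with identity $1$ that distributes over addition and satisfies $0\cdot x=x\cdot 0=0$; multiplication need not be commutative and additive inverses need not exist. A ring is a semiring in which every element has an additive inverse (multiplication not necessarily commutative). Complexity model: the algorithm receives $m,n$ and the entries of $A$; its time requirement is the number of semiring additions and multiplications it performs, and its space requirement is the maximum number of semiring elements it keeps simultaneously in memory at any point of the computation. The constants in the $O(\cdot)$ bounds are absolute (independent of $m$, $n$, $A$ and $S$). Notation: for integers $q\ge 0$ and real $r\ge 0$, $\langle q,r\rangle$ denotes $\sum_{0\le k\le r}\binom{q}{k}=\binom q0+\binom q1+\cdots$ up to $k\le r$.
   Formalization: In (iii) for m=1 the time bound is O(n), since the printed bound is O(1), false for a sum of n entries. Algorithms are straight-line programs for each (m,n); constants and programs are chosen per carrier type (countable carriers suffice for all S). *)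

theory Defs
  imports Complex_Main "HOL-Algebra.Ring" "HOL-Library.FuncSet"
begin

text \<open>
  Matrices are functions on row and column indices counted from 1. Only the entries with
  row index in \<open>{1..m}\<close> and column index in \<open>{1..n}\<close> matter.
\<close>

definition matrix_over :: "'a ring \<Rightarrow> nat \<Rightarrow> nat \<Rightarrow> (nat \<Rightarrow> nat \<Rightarrow> 'a) \<Rightarrow> bool" where
  "matrix_over R m n A \<longleftrightarrow> (\<forall>i\<in>{1..m}. \<forall>j\<in>{1..n}. A i j \<in> carrier R)"

definition injections :: "nat \<Rightarrow> nat \<Rightarrow> (nat \<Rightarrow> nat) set" where
  "injections m n = {\<sigma> \<in> {1..m} \<rightarrow>\<^sub>E {1..n}. inj_on \<sigma> {1..m}}"

text \<open>The fold multiplies the factors in the order \<open>1, \<dots>, m\<close>.\<close>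

definition per :: "'a ring \<Rightarrow> nat \<Rightarrow> nat \<Rightarrow> (nat \<Rightarrow> nat \<Rightarrow> 'a) \<Rightarrow> 'a" where
  "per R m n A =
     (\<Oplus>\<^bsub>R\<^esub>\<sigma>\<in>injections m n. foldr (\<lambda>i x. A i (\<sigma> i) \<otimes>\<^bsub>R\<^esub> x) [1..<Suc m] \<one>\<^bsub>R\<^esub>)"

definition binomial_sum :: "nat \<Rightarrow> real \<Rightarrow> nat" where
  "binomial_sum q r = (\<Sum>k | real k \<le> r. q choose k)"

text \<open>
  An algorithm gives, for each \<open>m\<close> and \<open>n\<close>, a list of instructions acting on a memory that
  is initially empty and whose cells hold at most one semiring element each. The matrix is
  read-only input: its entries, like the constants 0 and 1, may be used as operands and occupy
  memory only when copied there. This is what allows a space bound below the size \<open>m * n\<close> of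
  the input. The instructions do not depend on the semiring or on the values of the entries.
\<close>

datatype operand = Const_zero | Const_one | Entry nat nat | Cell nat

datatype instruction =
    Copy nat operand
  | Add nat operand operand
  | Mult nat operand operand
  | Negate nat operand
  | Discard nat

type_synonym program = "instruction list"

type_synonym 'a memory = "nat \<rightharpoonup> 'a"

fun operand_value :: "'a ring \<Rightarrow> (nat \<Rightarrow> nat \<Rightarrow> 'a) \<Rightarrow> 'a memory \<Rightarrow> operand \<Rightarrow> 'a option" where
  "operand_value R A M Const_zero = Some \<zero>\<^bsub>R\<^esub>"
| "operand_value R A M Const_one = Some \<one>\<^bsub>R\<^esub>"
| "operand_value R A M (Entry i j) = Some (A i j)"
| "operand_value R A M (Cell r) = M r"

text \<open>Reading an empty cell makes the computation fail, with result \<open>None\<close>.\<close>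

fun step :: "'a ring \<Rightarrow> (nat \<Rightarrow> nat \<Rightarrow> 'a) \<Rightarrow> instruction \<Rightarrow> 'a memory \<Rightarrow> 'a memory option" where
  "step R A (Copy d x) M =
     (case operand_value R A M x of Some u \<Rightarrow> Some (M(d \<mapsto> u)) | None \<Rightarrow> None)"
| "step R A (Add d x y) M =
     (case (operand_value R A M x, operand_value R A M y) of
        (Some u, Some v) \<Rightarrow> Some (M(d \<mapsto> u \<oplus>\<^bsub>R\<^esub> v)) | _ \<Rightarrow> None)"
| "step R A (Mult d x y) M =
     (case (operand_value R A M x, operand_value R A M y) of
        (Some u, Some v) \<Rightarrow> Some (M(d \<mapsto> u \<otimes>\<^bsub>R\<^esub> v)) | _ \<Rightarrow> None)"
| "step R A (Negate d x) M =
     (case operand_value R A M x of Some u \<Rightarrow> Some (M(d \<mapsto> \<ominus>\<^bsub>R\<^esub> u)) | None \<Rightarrow> None)"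
| "step R A (Discard d) M = Some (M(d := None))"

text \<open>
  Forming an additive inverse, which only programs for rings may do, is charged like an addition.
\<close>

fun arithmetic_cost :: "instruction \<Rightarrow> nat" where
  "arithmetic_cost (Copy d x) = 0"
| "arithmetic_cost (Add d x y) = 1"
| "arithmetic_cost (Mult d x y) = 1"
| "arithmetic_cost (Negate d x) = 1"
| "arithmetic_cost (Discard d) = 0"

text \<open>
  A successful run returns the final memory, the number of arithmetic operations performed, and
  the maximal number of nonempty memory cells at any point of the computation.
\<close>

fun run :: "'a ring \<Rightarrow> (nat \<Rightarrow> nat \<Rightarrow> 'a) \<Rightarrow> program \<Rightarrow> 'a memory \<Rightarrow> ('a memory \<times> nat \<times> nat) option" where
  "run R A [] M = Some (M, 0, card (dom M))"
| "run R A (c # cs) M =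
     (case step R A c M of
        None \<Rightarrow> None
      | Some M' \<Rightarrow>
          (case run R A cs M' of
             None \<Rightarrow> None
           | Some (N, t, s) \<Rightarrow> Some (N, arithmetic_cost c + t, max (card (dom M)) s)))"

text \<open>The result of a program is what it leaves in cell 0.\<close>

definition computes_within ::
  "'a ring \<Rightarrow> (nat \<Rightarrow> nat \<Rightarrow> 'a) \<Rightarrow> program \<Rightarrow> 'a \<Rightarrow> nat \<Rightarrow> nat \<Rightarrow> bool" where
  "computes_within R A p v T S \<longleftrightarrow>
     (\<exists>N t s. run R A p Map.empty = Some (N, t, s) \<and> N 0 = Some v \<and> t \<le> T \<and> s \<le> S)"

definition semiring_program :: "program \<Rightarrow> bool" where
  "semiring_program p \<longleftrightarrow> (\<forall>d x. Negate d x \<notin> set p)"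

definition comm_semiring :: "'a ring \<Rightarrow> bool" where
  "comm_semiring R \<longleftrightarrow> semiring R \<and> comm_monoid R"

text \<open>
  In the next definition \<open>K\<close> is a class of structures, \<open>legal\<close> says which programs are admitted, and
  \<open>T\<close> and \<open>S\<close> are the bounds under the O-symbol. The constant \<open>c\<close> and the programs are chosen
  before the structure and the matrix; in particular they do not depend on the structure. Since a
  run involves only the countable substructure generated by the entries, the instance
  \<open>'a = nat\<close> already covers structures of arbitrary size.
\<close>

definition per_computable ::
  "('a ring \<Rightarrow> bool) \<Rightarrow> (program \<Rightarrow> bool) \<Rightarrow> (nat \<Rightarrow> nat \<Rightarrow> nat) \<Rightarrow> (nat \<Rightarrow> nat \<Rightarrow> nat) \<Rightarrow> bool" where
  "per_computable K legal T S \<longleftrightarrow>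
     (\<exists>(c :: nat) (P :: nat \<Rightarrow> nat \<Rightarrow> program). \<forall>m n. 1 \<le> m \<and> m \<le> n \<longrightarrow>
        legal (P m n) \<and>
        (\<forall>R A. K R \<and> matrix_over R m n A \<longrightarrow>
           computes_within R A (P m n) (per R m n A) (c * T m n) (c * S m n)))"

end

theory Submission
  imports Defs
begin

text \<open>
  Write \<open>V rows U\<close> for the permanent of the submatrix with the given list of rows and set \<open>U\<close> of
  columns. Over a semiring, \<open>V\<close> is tabulated for all column sets of size at most \<open>m\<close> by expansion along
  the first row. Over a commutative semiring one expands along columns instead: a set \<open>X\<close> of rows is
  matched into the first \<open>j\<close> columns, and only \<open>card X \<le> j \<le> card X + (n - m)\<close> matters.

  Over a ring the rows are split in the middle. The permanent becomes a sum over disjoint pairs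
  \<open>(X, Y)\<close> of sets of size \<open>m div 2\<close>; replacing the disjointness condition by the alternating sum over
  \<open>Z \<subseteq> X \<inter> Y\<close> turns this into a sum over \<open>Z\<close> of products of two sums over supersets of \<open>Z\<close>.

  Over a commutative ring the permanent is the iterated finite difference, in the directions of the
  \<open>m\<close> rows, of the elementary symmetric polynomial of degree \<open>m\<close> in \<open>n\<close> variables. The recursion that
  evaluates the difference only keeps the current sum of rows.
\<close>

section \<open>Accumulation programs\<close>

text \<open>Every recursion used is a sum of products, so one arithmetic instruction,
  \<open>d := d + x * y\<close> or \<open>d := d - x * y\<close>, suffices, and cells can be named
  by the objects they belong to, such as a tag with a set of columns. On the machine such an
  instruction takes at most three operations and one common scratch cell. Time and space thereby
  become the number of accumulations and the number of cell names, and both are bounded by injecting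
  index sets.

  Without commutativity the factors must stay in row order. This obstructs expansion along columns
  and finite differences of symmetric polynomials, and leaves splitting the rows into consecutive
  blocks.

  The band in the commutative cases arises as follows: once \<open>X\<close> is matched within the
  first \<open>j\<close> columns, the other \<open>m - card X\<close> rows need as many of the
  \<open>n - j\<close> remaining columns, that is \<open>j \<le> card X + (n - m)\<close>. The same
  count tells which degrees of the symmetric polynomials in the first \<open>j\<close> coordinates
  can still contribute to degree \<open>m\<close>. It replaces a factor \<open>n\<close> by
  \<open>n - m + 1\<close>.\<close>

datatype 'c arg = Zero | One | Inp nat nat | Var 'c

datatype 'c instr = Load 'c "'c arg" | Accum bool 'c "'c arg" "'c arg"

text \<open>The flag of \<open>Accum\<close> says whether the product is subtracted rather than added.\<close>

definition sg :: "'a ring \<Rightarrow> bool \<Rightarrow> 'a \<Rightarrow> 'a" where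
  "sg R b u = (if b then \<ominus>\<^bsub>R\<^esub> u else u)"

fun aval :: "'a ring \<Rightarrow> (nat \<Rightarrow> nat \<Rightarrow> 'a) \<Rightarrow> ('c \<Rightarrow> 'a) \<Rightarrow> 'c arg \<Rightarrow> 'a" where
  "aval R A f Zero = \<zero>\<^bsub>R\<^esub>"
| "aval R A f One = \<one>\<^bsub>R\<^esub>"
| "aval R A f (Inp i j) = A i j"
| "aval R A f (Var c) = f c"

fun exec1 :: "'a ring \<Rightarrow> (nat \<Rightarrow> nat \<Rightarrow> 'a) \<Rightarrow> 'c instr \<Rightarrow> ('c \<Rightarrow> 'a) \<Rightarrow> ('c \<Rightarrow> 'a)" where
  "exec1 R A (Load d x) f = f(d := aval R A f x)"
| "exec1 R A (Accum b d x y) f =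
     f(d := f d \<oplus>\<^bsub>R\<^esub> sg R b (aval R A f x \<otimes>\<^bsub>R\<^esub> aval R A f y))"

definition exec :: "'a ring \<Rightarrow> (nat \<Rightarrow> nat \<Rightarrow> 'a) \<Rightarrow> 'c instr list \<Rightarrow> ('c \<Rightarrow> 'a) \<Rightarrow> ('c \<Rightarrow> 'a)" where
  "exec R A p = fold (exec1 R A) p"

lemma exec_Nil [simp]: "exec R A [] f = f"
  and exec_Cons [simp]: "exec R A (i # p) f = exec R A p (exec1 R A i f)"
  and exec_append [simp]: "exec R A (p @ q) f = exec R A q (exec R A p f)"
  by (simp_all add: exec_def)

fun accums1 :: "'c instr \<Rightarrow> nat" where
  "accums1 (Load d x) = 0"
| "accums1 (Accum b d x y) = 1"

definition accums :: "'c instr list \<Rightarrow> nat" where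
  "accums p = sum_list (map accums1 p)"

lemma accums_simps [simp]: "accums [] = 0" "accums (i # p) = accums1 i + accums p"
    "accums (p @ q) = accums p + accums q"
  by (simp_all add: accums_def)

fun add_only1 :: "'c instr \<Rightarrow> bool" where
  "add_only1 (Load d x) = True"
| "add_only1 (Accum b d x y) = (\<not> b)"

definition add_only :: "'c instr list \<Rightarrow> bool" where
  "add_only p \<longleftrightarrow> (\<forall>i\<in>set p. add_only1 i)"

lemma add_only_simps [simp]: "add_only []" "add_only (i # p) \<longleftrightarrow> add_only1 i \<and> add_only p"
    "add_only (p @ q) \<longleftrightarrow> add_only p \<and> add_only q"
  by (auto simp: add_only_def)

fun arg_ok :: "nat \<Rightarrow> nat \<Rightarrow> 'c set \<Rightarrow> 'c arg \<Rightarrow> bool" where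
  "arg_ok m n D (Inp i j) \<longleftrightarrow> i \<in> {1..m} \<and> j \<in> {1..n}"
| "arg_ok m n D (Var c) \<longleftrightarrow> c \<in> D"
| "arg_ok m n D _ \<longleftrightarrow> True"

fun instr_ok :: "nat \<Rightarrow> nat \<Rightarrow> 'c set \<Rightarrow> 'c instr \<Rightarrow> bool" where
  "instr_ok m n D (Load d x) \<longleftrightarrow> d \<in> D \<and> arg_ok m n D x"
| "instr_ok m n D (Accum b d x y) \<longleftrightarrow> d \<in> D \<and> arg_ok m n D x \<and> arg_ok m n D y"

definition prog_ok :: "nat \<Rightarrow> nat \<Rightarrow> 'c set \<Rightarrow> 'c instr list \<Rightarrow> bool" where
  "prog_ok m n D p \<longleftrightarrow> (\<forall>i\<in>set p. instr_ok m n D i)"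

lemma prog_ok_simps [simp]: "prog_ok m n D []"
    "prog_ok m n D (i # p) \<longleftrightarrow> instr_ok m n D i \<and> prog_ok m n D p"
    "prog_ok m n D (p @ q) \<longleftrightarrow> prog_ok m n D p \<and> prog_ok m n D q"
  by (auto simp: prog_ok_def)

lemma concat_simps [simp]:
  "prog_ok m n D (concat ps) \<longleftrightarrow> (\<forall>p\<in>set ps. prog_ok m n D p)"
  "add_only (concat ps) \<longleftrightarrow> (\<forall>p\<in>set ps. add_only p)"
  "accums (concat ps) = sum_list (map accums ps)"
  by (induction ps) auto

text \<open>A program that reads only entries in range cannot see the others, which may therefore be
  redefined so that all entries lie in the carrier.\<close>

lemma exec_cong_input:
  assumes "prog_ok m n D p" "\<forall>i\<in>{1..m}. \<forall>j\<in>{1..n}. A i j = B i j"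
  shows "exec R A p f = exec R B p f"
  using assms(1)
proof (induction p arbitrary: f)
  case (Cons i p)
  have *: "aval R A f x = aval R B f x" if "arg_ok m n D x" for x
    using that assms(2) by (cases x) auto
  have "exec1 R A i f = exec1 R B i f"
    using Cons.prems * by (cases i) auto
  then show ?case using Cons by simp
qed simp

section \<open>Compilation to the machine model\<close>

fun compile_arg :: "('c \<Rightarrow> nat) \<Rightarrow> 'c arg \<Rightarrow> operand" where
  "compile_arg e Zero = Const_zero"
| "compile_arg e One = Const_one"
| "compile_arg e (Inp i j) = Entry i j"
| "compile_arg e (Var c) = Cell (e c)"

text \<open>The machine has no combined multiplication and addition, so the product is formed in the
  scratch cell \<open>t\<close>, which has to lie outside the image of \<open>e\<close>. At most
  three charged operations result; this is the factor 3 in all time bounds.\<close>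

fun compile_instr :: "nat \<Rightarrow> ('c \<Rightarrow> nat) \<Rightarrow> 'c instr \<Rightarrow> program" where
  "compile_instr t e (Load d x) = [Copy (e d) (compile_arg e x)]"
| "compile_instr t e (Accum b d x y) = Mult t (compile_arg e x) (compile_arg e y) #
     (if b then [Negate t (Cell t)] else []) @ [Add (e d) (Cell (e d)) (Cell t)]"

fun dest :: "instruction \<Rightarrow> nat" where
  "dest (Copy d x) = d" | "dest (Add d x y) = d" | "dest (Mult d x y) = d"
| "dest (Negate d x) = d" | "dest (Discard d) = d"

lemma step_dom: "step R A c M = Some M' \<Longrightarrow> dom M' \<subseteq> insert (dest c) (dom M)"
  by (cases c) (auto split: option.splits if_splits)

lemma run_append:
  "run R A (p @ q) M =
     (case run R A p M of None \<Rightarrow> None | Some (M', t, s) \<Rightarrow>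
       (case run R A q M' of None \<Rightarrow> None
        | Some (N, t', s') \<Rightarrow> Some (N, t + t', max s s')))"
proof (induction p arbitrary: M)
  case Nil
  show ?case
    \<comment> \<open>The empty run reports \<open>card (dom M)\<close>. Any run from
      \<open>M\<close> has already counted this value, so the maximum absorbs it; seeing this takes
      one look at \<open>q\<close>.\<close>
    by (cases q) (auto split: option.splits)
next
  case (Cons c p)
  then show ?case by (auto split: option.splits simp: max.assoc)
qed

text \<open>Only destinations of instructions can become nonempty, so the memory never leaves a
  fixed finite set of cells. Space can thus be bounded by counting cells, without following which of
  them are occupied at a given moment.\<close>

lemma run_space:
  "run R A p M = Some (N, t, s) \<Longrightarrow> finite (dom M) \<Longrightarrow> s \<le> card (dest ` set p \<union> dom M)"
proof (induction p arbitrary: M t s)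
  case (Cons c p)
  then obtain M' t' s' where 1: "step R A c M = Some M'" "run R A p M' = Some (N, t', s')"
      "s = max (card (dom M)) s'"
    by (auto split: option.splits)
  have d: "dom M' \<subseteq> insert (dest c) (dom M)" using step_dom[OF 1(1)] .
  then have "finite (dom M')" using Cons.prems(2) finite_subset by blast
  then have "s' \<le> card (dest ` set p \<union> dom M')" using Cons.IH 1(2) by blast
  also have "\<dots> \<le> card (dest ` set (c # p) \<union> dom M)"
    by (rule card_mono) (use d Cons.prems(2) in auto)
  finally have "s' \<le> card (dest ` set (c # p) \<union> dom M)" .
  moreover have "card (dom M) \<le> card (dest ` set (c # p) \<union> dom M)"
    by (rule card_mono) (use Cons.prems(2) in auto)
  ultimately show ?case using 1(3) by simp
qed simp

definition repr :: "'c set \<Rightarrow> ('c \<Rightarrow> nat) \<Rightarrow> ('c \<Rightarrow> 'a) \<Rightarrow> 'a memory \<Rightarrow> bool" where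
  "repr D e f M \<longleftrightarrow> (\<forall>c\<in>D. M (e c) = Some (f c))"

lemma repr_arg:
  assumes "repr D e f M" "arg_ok m n D x"
  shows "operand_value R A M (compile_arg e x) = Some (aval R A f x)"
  using assms by (cases x) (auto simp: repr_def)

lemma run_comp:
  assumes "repr D e f M" "instr_ok m n D i" "inj_on e D" "t \<notin> e ` D"
  shows "\<exists>N k s. run R A (compile_instr t e i) M = Some (N, k, s) \<and> k \<le> 3 * accums1 i \<and>
    repr D e (exec1 R A i f) N"
proof (cases i)
  case (Load d x)
  have "d \<in> D" "arg_ok m n D x" using assms(2) Load by auto
  moreover have "repr D e (f(d := u)) (M(e d \<mapsto> u))" for u
    using assms(1,3) \<open>d \<in> D\<close> by (auto simp: repr_def inj_on_def)
  ultimately show ?thesis using repr_arg[OF assms(1)] Load by simp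
next
  case (Accum b d x y)
  have *: "d \<in> D" "arg_ok m n D x" "arg_ok m n D y" using assms(2) Accum by auto
  have t: "t \<noteq> e c" if "c \<in> D" for c using that assms(4) by auto
  have r: "repr D e (f(d := u)) (M(t \<mapsto> v, e d \<mapsto> u))"
      "repr D e (f(d := u)) (M(t \<mapsto> w, t \<mapsto> v, e d \<mapsto> u))" for u v w
    using assms(1,3) *(1) t by (auto simp: repr_def inj_on_def)
  have "M (e d) = Some (f d)" using assms(1) *(1) by (simp add: repr_def)
  then show ?thesis
    using repr_arg[OF assms(1) *(2)] repr_arg[OF assms(1) *(3)] Accum t[OF *(1)] r(1)
    by (auto simp: sg_def)
qed

lemma run_comps:
  assumes "repr D e f M" "prog_ok m n D p" "inj_on e D" "t \<notin> e ` D"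
  shows "\<exists>N k s. run R A (concat (map (compile_instr t e) p)) M = Some (N, k, s) \<and> k \<le> 3 * accums p \<and>
    repr D e (exec R A p f) N"
  using assms(1,2)
proof (induction p arbitrary: f M)
  case (Cons i p)
  have ok: "instr_ok m n D i" "prog_ok m n D p" using Cons.prems by auto
  obtain N k s where 1: "run R A (compile_instr t e i) M = Some (N, k, s)" "k \<le> 3 * accums1 i"
      "repr D e (exec1 R A i f) N"
    using run_comp[OF Cons.prems(1) ok(1) assms(3,4), where R = R and A = A] by blast
  obtain N' k' s' where 2: "run R A (concat (map (compile_instr t e) p)) N = Some (N', k', s')"
      "k' \<le> 3 * accums p" "repr D e (exec R A p (exec1 R A i f)) N'"
    using Cons.IH[OF 1(3) ok(2)] by blast
  show ?case using 1 2 by (simp add: run_append)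
qed simp

lemma run_init:
  "\<exists>N s. run R A (map (\<lambda>c. Copy (e c) Const_zero) cs) M = Some (N, 0, s) \<and>
     (\<forall>c. c \<in> set cs \<or> M (e c) = Some \<zero>\<^bsub>R\<^esub> \<longrightarrow> N (e c) = Some \<zero>\<^bsub>R\<^esub>)"
proof (induction cs arbitrary: M)
  case (Cons c cs)
  obtain N s where "run R A (map (\<lambda>c. Copy (e c) Const_zero) cs) (M(e c \<mapsto> \<zero>\<^bsub>R\<^esub>)) = Some (N, 0, s)"
     "\<forall>c'. c' \<in> set cs \<or> (M(e c \<mapsto> \<zero>\<^bsub>R\<^esub>)) (e c') = Some \<zero>\<^bsub>R\<^esub> \<longrightarrow> N (e c') = Some \<zero>\<^bsub>R\<^esub>"
    using Cons.IH by blast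
  then show ?case by simp
qed simp

lemma dest_comp: "instr_ok m n D i \<Longrightarrow> x \<in> set (compile_instr t e i) \<Longrightarrow> dest x \<in> insert t (e ` D)"
  by (cases i) (auto split: if_splits)

text \<open>Zeroing every cell beforehand makes every later read defined and costs no arithmetic.\<close>

lemma compile:
  fixes p :: "'c instr list"
  assumes "finite D" "r \<in> D" "prog_ok m n D p"
  shows "\<exists>q. (add_only p \<longrightarrow> semiring_program q) \<and>
    (\<forall>(R :: 'a ring) A. computes_within R A q (exec R A p (\<lambda>_. \<zero>\<^bsub>R\<^esub>) r) (3 * accums p) (card D + 1))"
proof -
  obtain g :: "'c \<Rightarrow> nat" where g: "inj_on g D"
    using finite_imp_inj_to_nat_seg[OF assms(1)] by blast
  \<comment> \<open>Cell 0 has to hold the result and cell 1 serves as scratch, hence the shift by 2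
    for all other names.\<close>
  define e where "e = (\<lambda>c. if c = r then 0 else g c + 2)"
  have e: "inj_on e D" "1 \<notin> e ` D" "e r = 0"
    using g by (auto simp: e_def inj_on_def split: if_splits)
  obtain cs where cs: "set cs = D" using finite_list[OF assms(1)] by blast
  define q where "q = map (\<lambda>c. Copy (e c) Const_zero) cs @ concat (map (compile_instr 1 e) p)"
  have "semiring_program q" if "add_only p"
  proof -
    have "Negate d x \<notin> set (compile_instr 1 e i)" if "i \<in> set p" for d x i
      using \<open>add_only p\<close> that by (cases i) (auto simp: add_only_def)
    then show ?thesis by (auto simp: semiring_program_def q_def)
  qed
  moreover have "computes_within R A q (exec R A p (\<lambda>_. \<zero>\<^bsub>R\<^esub>) r) (3 * accums p) (card D + 1)"
    for R :: "'a ring" and A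
  proof -
    obtain M s where 1: "run R A (map (\<lambda>c. Copy (e c) Const_zero) cs) Map.empty = Some (M, 0, s)"
      "\<forall>c. c \<in> set cs \<longrightarrow> M (e c) = Some \<zero>\<^bsub>R\<^esub>"
      using run_init[of R A e cs Map.empty] by blast
    have "repr D e (\<lambda>_. \<zero>\<^bsub>R\<^esub>) M" using 1(2) cs by (simp add: repr_def)
    from run_comps[OF this assms(3) e(1,2), of R A] obtain N k s'
      where 2: "run R A (concat (map (compile_instr 1 e) p)) M = Some (N, k, s')" "k \<le> 3 * accums p"
        "repr D e (exec R A p (\<lambda>_. \<zero>\<^bsub>R\<^esub>)) N" by blast
    have run: "run R A q Map.empty = Some (N, k, max s s')"
      using 1 2 by (simp add: q_def run_append)
    have "dest ` set q \<subseteq> insert 1 (e ` D)"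
      using assms(3) cs by (auto simp: q_def prog_ok_def dest: dest_comp)
    then have "card (dest ` set q) \<le> card (insert 1 (e ` D))"
      by (rule card_mono[rotated]) (use assms(1) in auto)
    also have "\<dots> \<le> card D + 1"
      using card_image_le[OF assms(1), of e] by (auto intro: order_trans[OF card_insert_le_m1])
    finally have "max s s' \<le> card D + 1" using run_space[OF run] by simp
    moreover have "N 0 = Some (exec R A p (\<lambda>_. \<zero>\<^bsub>R\<^esub>) r)"
      using 2(3) assms(2) e(3) by (auto simp: repr_def)
    ultimately show ?thesis using run 2(2) by (auto simp: computes_within_def)
  qed
  ultimately show ?thesis by blast
qed

text \<open>No law is assumed of \<open>R\<close>, because the class of structures is still a
  parameter where this is used. The sum is therefore opened down to \<open>foldSetD\<close>, the
  inductive graph of the fold over a finite set, where pointwise equal summands admit the same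
  derivations.\<close>

lemma per_cong:
  assumes "\<forall>i\<in>{1..m}. \<forall>j\<in>{1..n}. A i j = B i j"
  shows "per R m n A = per R m n B"
proof -
  have *: "foldr (\<lambda>i x. A i (\<sigma> i) \<otimes>\<^bsub>R\<^esub> x) [1..<Suc m] \<one>\<^bsub>R\<^esub> =
        foldr (\<lambda>i x. B i (\<sigma> i) \<otimes>\<^bsub>R\<^esub> x) [1..<Suc m] \<one>\<^bsub>R\<^esub>" if "\<sigma> \<in> injections m n" for \<sigma>
  proof -
    have "\<sigma> i \<in> {1..n}" if "i \<in> {1..m}" for i
      using \<open>\<sigma> \<in> injections m n\<close> that unfolding injections_def by (blast intro: PiE_mem)
    then have "A i (\<sigma> i) = B i (\<sigma> i)" if "i \<in> {1..m}" for i using assms that by blast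
    then show ?thesis by (intro foldr_cong[OF refl refl]) (simp del: upt_Suc)
  qed
  have fold: "(X, y) \<in> foldSetD C (op \<circ> f) z \<Longrightarrow> X \<subseteq> I \<Longrightarrow> (\<And>x. x \<in> I \<Longrightarrow> f x = g x) \<Longrightarrow>
      (X, y) \<in> foldSetD C (op \<circ> g) z"
    for C :: "'a set" and op :: "'a \<Rightarrow> 'a \<Rightarrow> 'a" and f g :: "(nat \<Rightarrow> nat) \<Rightarrow> 'a" and z I X y
  proof (induction rule: foldSetD.induct)
    case (insertI x A y)
    then have "(insert x A, (op \<circ> g) x y) \<in> foldSetD C (op \<circ> g) z"
      by (intro foldSetD.insertI) auto
    then show ?case using insertI.prems by (simp add: o_def)
  qed (rule foldSetD.emptyI)
  have fp: "finprod G f I = finprod G g I" if eq: "\<And>x. x \<in> I \<Longrightarrow> f x = g x"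
    for G :: "'a monoid" and f g :: "(nat \<Rightarrow> nat) \<Rightarrow> 'a" and I
  proof -
    have "(I, y) \<in> foldSetD (carrier G) ((\<otimes>\<^bsub>G\<^esub>) \<circ> f) \<one>\<^bsub>G\<^esub> \<longleftrightarrow>
        (I, y) \<in> foldSetD (carrier G) ((\<otimes>\<^bsub>G\<^esub>) \<circ> g) \<one>\<^bsub>G\<^esub>" for y
      using fold[OF _ order_refl eq] fold[OF _ order_refl eq[symmetric]] by (rule iffI)
    then show ?thesis unfolding finprod_def foldD_def by (simp only:)
  qed
  show ?thesis unfolding per_def finsum_def by (rule fp, rule *)
qed

text \<open>Reduces each of the four bounds to one symbolic program for each \<open>m\<close> and
  \<open>n\<close>. It also allows all entries, in range or not, to be taken from the
  carrier.\<close>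

lemma per_computableI:
  fixes K :: "'a ring \<Rightarrow> bool"
  assumes zero: "\<And>R. K R \<Longrightarrow> \<zero>\<^bsub>R\<^esub> \<in> carrier R"
    and prog: "\<And>m n. 1 \<le> m \<Longrightarrow> m \<le> n \<Longrightarrow> \<exists>(p :: 'c instr list) D r. finite D \<and> r \<in> D \<and> prog_ok m n D p \<and>
      (add_only p \<or> legal = (\<lambda>_. True)) \<and> 3 * accums p \<le> c * T m n \<and> card D + 1 \<le> c * S m n \<and>
      (\<forall>R A. K R \<and> (\<forall>i j. A i j \<in> carrier R) \<longrightarrow> exec R A p (\<lambda>_. \<zero>\<^bsub>R\<^esub>) r = per R m n A)"
    and legal: "legal = semiring_program \<or> legal = (\<lambda>_. True)"
  shows "per_computable K legal T S"
proof -
  \<comment> \<open>The quantifiers over \<open>R\<close> and \<open>A\<close> are inside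
    \<open>Q\<close>, so the program chosen from it below depends on \<open>m\<close> and
    \<open>n\<close> only.\<close>
  define Q where "Q = (\<lambda>m n q. legal q \<and> (\<forall>R A. K R \<and> matrix_over R m n A \<longrightarrow>
      computes_within R A q (per R m n A) (c * T m n) (c * S m n)))"
  have Q: "\<exists>q. Q m n q"
    if "1 \<le> m" "m \<le> n" for m n
  proof -
    from prog[OF that] obtain p :: "'c instr list" and D r where "finite D \<and> r \<in> D \<and> prog_ok m n D p \<and>
      (add_only p \<or> legal = (\<lambda>_. True)) \<and> 3 * accums p \<le> c * T m n \<and> card D + 1 \<le> c * S m n \<and>
      (\<forall>R A. K R \<and> (\<forall>i j. A i j \<in> carrier R) \<longrightarrow> exec R A p (\<lambda>_. \<zero>\<^bsub>R\<^esub>) r = per R m n A)"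
      by (elim exE)
    then have p: "finite D" "r \<in> D" "prog_ok m n D p"
      "add_only p \<or> legal = (\<lambda>_. True)" "3 * accums p \<le> c * T m n" "card D + 1 \<le> c * S m n"
      "\<And>R A. K R \<Longrightarrow> \<forall>i j. A i j \<in> carrier R \<Longrightarrow> exec R A p (\<lambda>_. \<zero>\<^bsub>R\<^esub>) r = per R m n A"
      by auto
    obtain q where q: "add_only p \<longrightarrow> semiring_program q"
      "\<forall>(R :: 'a ring) A. computes_within R A q (exec R A p (\<lambda>_. \<zero>\<^bsub>R\<^esub>) r) (3 * accums p) (card D + 1)"
      using compile[OF p(1-3)] by blast
    have "computes_within R A q (per R m n A) (c * T m n) (c * S m n)"
      if "K R" "matrix_over R m n A" for R A
    proof -
      \<comment> \<open>\<open>matrix_over\<close> says nothing about entries out of range. Setting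
        them to zero changes neither the permanent nor the run of a well-formed program.\<close>
      define B where "B = (\<lambda>i j. if i \<in> {1..m} \<and> j \<in> {1..n} then A i j else \<zero>\<^bsub>R\<^esub>)"
      have B: "\<forall>i\<in>{1..m}. \<forall>j\<in>{1..n}. A i j = B i j" by (simp add: B_def)
      have "\<forall>i j. B i j \<in> carrier R" using that zero by (auto simp: B_def matrix_over_def)
      then have "exec R A p (\<lambda>_. \<zero>\<^bsub>R\<^esub>) r = per R m n A"
        using p(7)[OF that(1), of B] per_cong[OF B] exec_cong_input[OF p(3) B] by simp
      then have "computes_within R A q (per R m n A) (3 * accums p) (card D + 1)"
        using q(2)[rule_format, of R A] by simp
      then obtain N t s where "run R A q Map.empty = Some (N, t, s)" "N 0 = Some (per R m n A)"
        "t \<le> 3 * accums p" "s \<le> card D + 1"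
        unfolding computes_within_def by blast
      then show ?thesis using p(5,6) unfolding computes_within_def by auto
    qed
    moreover have "legal q" using q(1) p(4) legal by auto
    ultimately have "Q m n q" by (simp add: Q_def)
    then show ?thesis ..
  qed
  have "\<forall>m n. 1 \<le> m \<and> m \<le> n \<longrightarrow> Q m n (SOME q. Q m n q)"
    by (intro allI impI someI_ex[OF Q]) simp_all
  then have "\<exists>P. \<forall>m n. 1 \<le> m \<and> m \<le> n \<longrightarrow> Q m n (P m n)"
    by (rule exI[where x = "\<lambda>m n. SOME q. Q m n q"])
  then show ?thesis unfolding per_computable_def Q_def by (rule exI[where x = c])
qed

section \<open>Finite sums in a semiring\<close>

context semiring
begin

lemma fs_closed: "(\<And>x. x \<in> A \<Longrightarrow> f x \<in> carrier R) \<Longrightarrow> finsum R f A \<in> carrier R"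
  by (rule finsum_closed) auto

lemma fs_cong: "A = B \<Longrightarrow> (\<And>x. x \<in> B \<Longrightarrow> f x = g x) \<Longrightarrow> (\<And>x. x \<in> B \<Longrightarrow> g x \<in> carrier R) \<Longrightarrow>
    finsum R f A = finsum R g B"
  by (rule finsum_cong') auto

lemma fs_insert: "finite F \<Longrightarrow> a \<notin> F \<Longrightarrow> (\<And>x. x \<in> insert a F \<Longrightarrow> f x \<in> carrier R) \<Longrightarrow>
    finsum R f (insert a F) = f a \<oplus> finsum R f F"
  by (rule finsum_insert) auto

lemma fs_Un: "finite A \<Longrightarrow> finite B \<Longrightarrow> A \<inter> B = {} \<Longrightarrow>
    (\<And>x. x \<in> A \<union> B \<Longrightarrow> f x \<in> carrier R) \<Longrightarrow>
    finsum R f (A \<union> B) = finsum R f A \<oplus> finsum R f B"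
  by (rule finsum_Un_disjoint) auto

lemma fs_add: "(\<And>x. x \<in> A \<Longrightarrow> f x \<in> carrier R) \<Longrightarrow> (\<And>x. x \<in> A \<Longrightarrow> g x \<in> carrier R) \<Longrightarrow>
    (\<Oplus>x\<in>A. f x \<oplus> g x) = finsum R f A \<oplus> finsum R g A"
  by (rule finsum_addf) auto

lemma fs_zero: "(\<And>x. x \<in> A \<Longrightarrow> f x = \<zero>) \<Longrightarrow> finsum R f A = \<zero>"
  by (rule add.finprod_one_eqI)

lemma fs_single: "f a \<in> carrier R \<Longrightarrow> finsum R f {a} = f a"
  by (simp add: Pi_def)

lemma fs_ldistr: "finite A \<Longrightarrow> a \<in> carrier R \<Longrightarrow> (\<And>x. x \<in> A \<Longrightarrow> f x \<in> carrier R) \<Longrightarrow>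
    finsum R f A \<otimes> a = (\<Oplus>x\<in>A. f x \<otimes> a)"
  by (rule finsum_ldistr) auto

lemma fs_rdistr: "finite A \<Longrightarrow> a \<in> carrier R \<Longrightarrow> (\<And>x. x \<in> A \<Longrightarrow> f x \<in> carrier R) \<Longrightarrow>
    a \<otimes> finsum R f A = (\<Oplus>x\<in>A. a \<otimes> f x)"
  by (rule finsum_rdistr) auto

lemma fs_bij:
  assumes "bij_betw h A B" "\<And>x. x \<in> B \<Longrightarrow> f x \<in> carrier R"
  shows "finsum R f B = (\<Oplus>x\<in>A. f (h x))"
proof -
  have "h ` A = B" "inj_on h A" using assms(1) by (auto simp: bij_betw_def)
  then show ?thesis using finsum_reindex[of f h A] assms(2) by auto
qed

lemma fs_witness:
  assumes "\<And>a. a \<in> A \<Longrightarrow> i (j a) = a" "\<And>a. a \<in> A \<Longrightarrow> j a \<in> B"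
    "\<And>b. b \<in> B \<Longrightarrow> j (i b) = b" "\<And>b. b \<in> B \<Longrightarrow> i b \<in> A"
    "\<And>a. a \<in> A \<Longrightarrow> h (j a) = g a" "\<And>a. a \<in> A \<Longrightarrow> g a \<in> carrier R"
  shows "finsum R g A = finsum R h B"
proof -
  have b: "bij_betw i B A"
    by (rule bij_betw_byWitness[where f' = j]) (use assms in auto)
  have "finsum R g A = (\<Oplus>x\<in>B. g (i x))" by (rule fs_bij[OF b assms(6)])
  also have "\<dots> = finsum R h B"
    using assms(3-6) by (intro fs_cong) (metis)+
  finally show ?thesis .
qed

lemma fs_filter:
  assumes "finite A" "\<And>x. x \<in> A \<Longrightarrow> P x \<Longrightarrow> f x \<in> carrier R"
  shows "finsum R f {x \<in> A. P x} = (\<Oplus>x\<in>A. if P x then f x else \<zero>)"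
proof -
  have "A = {x \<in> A. P x} \<union> {x \<in> A. \<not> P x}" by auto
  then have "(\<Oplus>x\<in>A. if P x then f x else \<zero>) = (\<Oplus>x\<in>{x \<in> A. P x} \<union> {x \<in> A. \<not> P x}. if P x then f x else \<zero>)"
    by simp
  also have "\<dots> = (\<Oplus>x\<in>{x \<in> A. P x}. if P x then f x else \<zero>) \<oplus> (\<Oplus>x\<in>{x \<in> A. \<not> P x}. if P x then f x else \<zero>)"
    by (rule fs_Un) (use assms in auto)
  also have "(\<Oplus>x\<in>{x \<in> A. \<not> P x}. if P x then f x else \<zero>) = \<zero>" by (rule fs_zero) auto
  also have "(\<Oplus>x\<in>{x \<in> A. P x}. if P x then f x else \<zero>) = finsum R f {x \<in> A. P x}"
    by (rule fs_cong) (use assms in auto)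
  finally show ?thesis using assms by (simp add: fs_closed)
qed

lemma fs_Sigma:
  assumes "finite A" "\<And>x. x \<in> A \<Longrightarrow> finite (B x)"
    "\<And>x y. x \<in> A \<Longrightarrow> y \<in> B x \<Longrightarrow> f x y \<in> carrier R"
  shows "(\<Oplus>x\<in>A. \<Oplus>y\<in>B x. f x y) = (\<Oplus>z\<in>Sigma A B. f (fst z) (snd z))"
  using assms
proof (induction A rule: finite_induct)
  case (insert a A)
  have eq: "Sigma (insert a A) B = Pair a ` B a \<union> Sigma A B" by auto
  have "(\<Oplus>z\<in>Sigma (insert a A) B. f (fst z) (snd z)) =
      (\<Oplus>z\<in>Pair a ` B a. f (fst z) (snd z)) \<oplus> (\<Oplus>z\<in>Sigma A B. f (fst z) (snd z))"
    unfolding eq by (rule fs_Un) (use insert in auto)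
  also have "(\<Oplus>z\<in>Pair a ` B a. f (fst z) (snd z)) = (\<Oplus>y\<in>B a. f a y)"
    by (subst finsum_reindex) (use insert in \<open>auto simp: inj_on_def\<close>)
  finally show ?case using insert by (subst fs_insert) (auto intro: fs_closed)
qed simp

text \<open>Both iterated sums run over the same set of pairs, up to exchanging the
  components.\<close>

lemma fs_swap_dep:
  assumes "finite A" "finite C" "\<And>x. x \<in> A \<Longrightarrow> finite (B x)" "\<And>y. y \<in> C \<Longrightarrow> finite (D y)"
    "\<And>x y. x \<in> A \<Longrightarrow> y \<in> B x \<Longrightarrow> f x y \<in> carrier R"
    "\<And>x y. x \<in> A \<and> y \<in> B x \<longleftrightarrow> y \<in> C \<and> x \<in> D y"
  shows "(\<Oplus>x\<in>A. \<Oplus>y\<in>B x. f x y) = (\<Oplus>y\<in>C. \<Oplus>x\<in>D y. f x y)"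
proof -
  have c: "f x y \<in> carrier R" if "y \<in> C" "x \<in> D y" for x y using that assms(5,6) by blast
  have "prod.swap z \<in> Sigma C D" if "z \<in> Sigma A B" for z
    using assms(6)[of "fst z" "snd z"] that by (cases z) simp
  moreover have "prod.swap z \<in> Sigma A B" if "z \<in> Sigma C D" for z
    using assms(6)[of "snd z" "fst z"] that by (cases z) simp
  moreover have "f (fst z) (snd z) \<in> carrier R" if "z \<in> Sigma A B" for z
    using assms(5)[of "fst z" "snd z"] that by (cases z) simp
  ultimately have "(\<Oplus>z\<in>Sigma A B. f (fst z) (snd z)) = (\<Oplus>z\<in>Sigma C D. f (snd z) (fst z))"
    by (intro fs_witness[where i = prod.swap and j = prod.swap]) simp_all
  then show ?thesis
    using fs_Sigma[of A B f] fs_Sigma[of C D "\<lambda>y x. f x y"] assms(1-5) c by simp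
qed

lemma fs_swap:
  assumes "finite A" "finite B" "\<And>x y. x \<in> A \<Longrightarrow> y \<in> B \<Longrightarrow> f x y \<in> carrier R"
  shows "(\<Oplus>x\<in>A. \<Oplus>y\<in>B. f x y) = (\<Oplus>y\<in>B. \<Oplus>x\<in>A. f x y)"
  by (rule fs_swap_dep) (simp_all add: assms conj_commute)

end

section \<open>Expansion along rows\<close>

text \<open>Closedness is required for all indices, so that it can be used by the simplifier without
  side conditions; zero extension of the matrix justifies this.\<close>

locale semiring_matrix = semiring R for R :: "'a ring" (structure) +
  fixes A :: "nat \<Rightarrow> nat \<Rightarrow> 'a"
  assumes A_closed [simp]: "A i j \<in> carrier R"
begin

fun V :: "nat list \<Rightarrow> nat set \<Rightarrow> 'a" where
  "V [] U = \<one>"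
| "V (i # is) U = (\<Oplus>x\<in>U. A i x \<otimes> V is (U - {x}))"

lemma V_closed [simp]: "V is U \<in> carrier R"
  by (induction "is" arbitrary: U) (auto intro!: fs_closed)

lemma foldr_closed [simp]: "foldr (\<lambda>i x. A i (\<sigma> i) \<otimes> x) is \<one> \<in> carrier R"
  by (induction "is") auto

text \<open>An injection of the rows \<open>i # is\<close> into \<open>U\<close> is a value
  \<open>y\<close> for row \<open>i\<close> together with an injection of \<open>is\<close> into
  \<open>U - {y}\<close>. Row \<open>i\<close> stands leftmost in the product, so no factor has to
  be moved.\<close>

lemma V_injections:
  assumes "finite U" "distinct is"
  shows "(\<Oplus>\<sigma>\<in>{\<sigma> \<in> set is \<rightarrow>\<^sub>E U. inj_on \<sigma> (set is)}. foldr (\<lambda>i x. A i (\<sigma> i) \<otimes> x) is \<one>) = V is U"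
  using assms
proof (induction "is" arbitrary: U)
  case Nil
  have "{\<sigma> \<in> set [] \<rightarrow>\<^sub>E U. inj_on \<sigma> (set [])} = {\<lambda>_. undefined}" by auto
  then show ?case by (simp add: fs_single)
next
  case (Cons i "is")
  define S where "S = set is"
  have i: "i \<notin> S" "finite S" using Cons.prems by (auto simp: S_def)
  define G where "G y = {g \<in> S \<rightarrow>\<^sub>E (U - {y}). inj_on g S}" for y
  have fin: "finite (G y)" for y
    unfolding G_def using i(2) Cons.prems(1) by (auto intro!: finite_subset[OF _ finite_PiE[of S "\<lambda>_. U - {y}"]])
  let ?P = "{(y, g). y \<in> U \<and> g \<in> S \<rightarrow>\<^sub>E (U - {y}) \<and> inj_on g S}"
  have P: "?P = Sigma U G" by (auto simp: G_def)
  \<comment> \<open>Row \<open>i\<close> does not recur in \<open>is\<close>, so overriding the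
    function there leaves the tail of the product unchanged.\<close>
  have fold_eq: "foldr (\<lambda>i x. A i ((g(i0 := y)) i) \<otimes> x) js \<one> = foldr (\<lambda>i x. A i (g i) \<otimes> x) js \<one>"
    if "i0 \<notin> set js" for g i0 y js
    using that by (intro foldr_cong) auto
  have "(\<Oplus>\<sigma>\<in>{\<sigma> \<in> insert i S \<rightarrow>\<^sub>E U. inj_on \<sigma> (insert i S)}. foldr (\<lambda>i x. A i (\<sigma> i) \<otimes> x) (i # is) \<one>) =
      (\<Oplus>z\<in>Sigma U G. foldr (\<lambda>j x. A j (((snd z)(i := fst z)) j) \<otimes> x) (i # is) \<one>)"
    unfolding extensional_funcset_extend_domain_inj_on_eq[OF i(1)]
    using extensional_funcset_extend_domain_inj_onI[OF i(1), of U] unfolding P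
    by (subst finsum_reindex) (auto simp: case_prod_unfold)
  also have "\<dots> = (\<Oplus>z\<in>Sigma U G. A i (fst z) \<otimes> foldr (\<lambda>j x. A j (snd z j) \<otimes> x) is \<one>)"
    using i(1) fold_eq by (intro fs_cong) (auto simp: S_def)
  also have "\<dots> = (\<Oplus>y\<in>U. \<Oplus>g\<in>G y. A i y \<otimes> foldr (\<lambda>j x. A j (g j) \<otimes> x) is \<one>)"
    using Cons.prems(1) fin by (subst fs_Sigma) auto
  also have "\<dots> = (\<Oplus>y\<in>U. A i y \<otimes> V is (U - {y}))"
  proof (rule fs_cong)
    fix y assume "y \<in> U"
    have "(\<Oplus>g\<in>G y. foldr (\<lambda>j x. A j (g j) \<otimes> x) is \<one>) = V is (U - {y})"
      using Cons.IH[of "U - {y}"] Cons.prems by (simp add: G_def S_def)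
    then show "(\<Oplus>g\<in>G y. A i y \<otimes> foldr (\<lambda>j x. A j (g j) \<otimes> x) is \<one>) = A i y \<otimes> V is (U - {y})"
      using fs_rdistr[of "G y" "A i y" "\<lambda>g. foldr (\<lambda>j x. A j (g j) \<otimes> x) is \<one>"] fin by simp
  qed auto
  finally show ?case by (simp add: S_def)
qed

lemma per_eq_V: "per R m n A = V [1..<Suc m] {1..n}"
  using V_injections[of "{1..n}" "[1..<Suc m]"]
  by (simp add: per_def injections_def atLeastLessThanSuc_atLeastAtMost del: upt_Suc)

lemma V_eq_zero: "finite U \<Longrightarrow> card U < length is \<Longrightarrow> V is U = \<zero>"
proof (induction "is" arbitrary: U)
  case (Cons i "is")
  have "V is (U - {x}) = \<zero>" if "x \<in> U" for x
  proof (rule Cons.IH)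
    have "card U > 0" using Cons.prems(1) that by (auto simp: card_gt_0_iff)
    then show "card (U - {x}) < length is" using Cons.prems that by simp
  qed (use Cons.prems in simp)
  then show ?case by (auto intro!: fs_zero)
qed simp

text \<open>Laplace expansion by a block of rows, where \<open>X\<close> collects the columns used
  by the first block. In the induction a new column \<open>x\<close> with a set \<open>X\<close>
  avoiding it is the same as the set \<open>insert x X\<close> with the marked element
  \<open>x\<close>.\<close>

lemma V_append_left:
  assumes "finite U"
  shows "V (is @ js) U = (\<Oplus>X\<in>{X. X \<subseteq> U \<and> card X = length is}. V is X \<otimes> V js (U - X))"
  using assms
proof (induction "is" arbitrary: U)
  case Nil
  have "{X. X \<subseteq> U \<and> card X = length []} = {{}}"
    using Nil finite_subset[of _ U] by auto
  then show ?case by (simp add: fs_single)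
next
  case (Cons i "is")
  let ?S = "\<lambda>W. {X. X \<subseteq> W \<and> card X = length is}"
  let ?B = "{X. X \<subseteq> U \<and> card X = length (i # is)}"
  have fin: "finite (?S W)" if "W \<subseteq> U" for W
    using that Cons.prems finite_subset by (auto intro: finite_subset[of _ "Pow U"])
  have finX: "finite X" if "X \<subseteq> U" for X using that Cons.prems finite_subset by blast
  have "V ((i # is) @ js) U = (\<Oplus>x\<in>U. \<Oplus>X\<in>?S (U - {x}). A i x \<otimes> (V is X \<otimes> V js (U - {x} - X)))"
    using Cons by (auto intro!: fs_cong fs_closed simp: fs_rdistr fin)
  also have "\<dots> = (\<Oplus>z\<in>Sigma U (\<lambda>x. ?S (U - {x})). A i (fst z) \<otimes> (V is (snd z) \<otimes> V js (U - {fst z} - snd z)))"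
    by (rule fs_Sigma) (use Cons.prems fin in auto)
  also have "\<dots> = (\<Oplus>z\<in>Sigma ?B (\<lambda>X. X). A i (snd z) \<otimes> (V is (fst z - {snd z}) \<otimes> V js (U - fst z)))"
    by (rule fs_witness[where j = "\<lambda>(x, X). (insert x X, x)" and i = "\<lambda>(X, x). (x, X - {x})"])
      (use finX in \<open>auto simp: card_insert_if insert_absorb Diff_insert2[symmetric] subset_Diff_insert\<close>)
  also have "\<dots> = (\<Oplus>X\<in>?B. \<Oplus>x\<in>X. A i x \<otimes> (V is (X - {x}) \<otimes> V js (U - X)))"
    using Cons.prems finX by (subst fs_Sigma) auto
  also have "\<dots> = (\<Oplus>X\<in>?B. V (i # is) X \<otimes> V js (U - X))"
    using finX by (intro fs_cong) (auto simp: fs_ldistr m_assoc)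
  finally show ?case .
qed

lemma V_subsets:
  assumes "finite U"
  shows "V is U = (\<Oplus>X\<in>{X. X \<subseteq> U \<and> card X = length is}. V is X)"
  using V_append_left[OF assms, of "is" "[]"] by simp

text \<open>Here the last block is confined to a set \<open>Y\<close> of its own size and the first
  block sees all remaining columns. Together with the expansion from the left this isolates a middle
  block on the columns that neither outer block uses.\<close>

lemma V_append_right:
  assumes "finite U"
  shows "V (is @ js) U = (\<Oplus>Y\<in>{Y. Y \<subseteq> U \<and> card Y = length js}. V is (U - Y) \<otimes> V js Y)"
  using assms
proof (induction "is" arbitrary: U)
  case Nil
  then show ?case using V_subsets[of U js] by simp
next
  case (Cons i "is")
  let ?S = "\<lambda>W. {X. X \<subseteq> W \<and> card X = length js}"
  have fin: "finite (?S W)" if "W \<subseteq> U" for W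
    using that Cons.prems finite_subset by (auto intro: finite_subset[of _ "Pow U"])
  have "V ((i # is) @ js) U = (\<Oplus>x\<in>U. \<Oplus>Y\<in>?S (U - {x}). A i x \<otimes> (V is (U - {x} - Y) \<otimes> V js Y))"
    using Cons by (auto intro!: fs_cong fs_closed simp: fs_rdistr fin)
  also have "\<dots> = (\<Oplus>Y\<in>?S U. \<Oplus>x\<in>U - Y. A i x \<otimes> (V is (U - {x} - Y) \<otimes> V js Y))"
    by (rule fs_swap_dep) (use Cons.prems fin in auto)
  also have "\<dots> = (\<Oplus>Y\<in>?S U. V (i # is) (U - Y) \<otimes> V js Y)"
  proof (rule fs_cong)
    fix Y assume "Y \<in> ?S U"
    have "U - {x} - Y = U - Y - {x}" for x by auto
    then show "(\<Oplus>x\<in>U - Y. A i x \<otimes> (V is (U - {x} - Y) \<otimes> V js Y)) = V (i # is) (U - Y) \<otimes> V js Y"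
      using Cons.prems by (auto simp: fs_ldistr m_assoc)
  qed auto
  finally show ?case .
qed

lemma sorted_list_Diff: "finite X \<Longrightarrow> sorted_list_of_set (X - {i}) = remove1 i (sorted_list_of_set X)"
  by (simp add: sorted_list_of_set_remove)

end

locale comm_semiring_matrix = semiring_matrix + comm_monoid R
begin

text \<open>Either no row uses the new column \<open>c\<close>, or exactly one row \<open>i\<close>
  does. Commutativity is essential: it moves the factor \<open>A i c\<close> to the front, past the
  entries of earlier rows.\<close>

lemma V_insert_column:
  assumes "finite U" "c \<notin> U" "distinct is"
  shows "V is (insert c U) = V is U \<oplus> (\<Oplus>i\<in>set is. A i c \<otimes> V (remove1 i is) U)"
  using assms
proof (induction "is" arbitrary: U)
  case (Cons i "is")
  let ?S = "set is"
  have "V (i # is) (insert c U) = A i c \<otimes> V is U \<oplus> (\<Oplus>x\<in>U. A i x \<otimes> V is (insert c (U - {x})))"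
    using Cons.prems by (simp add: fs_insert insert_Diff_if)
      (intro arg_cong2[where f = "add R"] refl fs_cong; auto simp: insert_Diff_if)
  also have "(\<Oplus>x\<in>U. A i x \<otimes> V is (insert c (U - {x}))) =
     (\<Oplus>x\<in>U. A i x \<otimes> V is (U - {x}) \<oplus> (\<Oplus>i'\<in>?S. A i' c \<otimes> (A i x \<otimes> V (remove1 i' is) (U - {x}))))"
    using Cons by (intro fs_cong) (auto simp: r_distr fs_rdistr fs_closed m_lcomm intro!: fs_cong)
  also have "\<dots> = V (i # is) U \<oplus> (\<Oplus>x\<in>U. \<Oplus>i'\<in>?S. A i' c \<otimes> (A i x \<otimes> V (remove1 i' is) (U - {x})))"
    by (subst fs_add) (auto intro!: fs_closed)
  also have "(\<Oplus>x\<in>U. \<Oplus>i'\<in>?S. A i' c \<otimes> (A i x \<otimes> V (remove1 i' is) (U - {x}))) =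
      (\<Oplus>i'\<in>?S. \<Oplus>x\<in>U. A i' c \<otimes> (A i x \<otimes> V (remove1 i' is) (U - {x})))"
    using Cons.prems by (intro fs_swap) auto
  also have "\<dots> = (\<Oplus>i'\<in>?S. A i' c \<otimes> V (remove1 i' (i # is)) U)"
    using Cons.prems by (intro fs_cong) (auto simp: fs_rdistr)
  finally have "V (i # is) (insert c U) =
    A i c \<otimes> V is U \<oplus> (V (i # is) U \<oplus> (\<Oplus>i'\<in>?S. A i' c \<otimes> V (remove1 i' (i # is)) U))" .
  moreover have "(\<Oplus>j\<in>set (i # is). A j c \<otimes> V (remove1 j (i # is)) U) =
      A i c \<otimes> V is U \<oplus> (\<Oplus>i'\<in>?S. A i' c \<otimes> V (remove1 i' (i # is)) U)"
    using Cons.prems by (simp only: list.set fs_insert finite_set distinct.simps V_closed A_closed m_closed) simp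
  moreover have "V (i # is) U \<in> carrier R" "(\<Oplus>i'\<in>?S. A i' c \<otimes> V (remove1 i' (i # is)) U) \<in> carrier R"
    by (auto intro!: fs_closed simp del: V.simps)
  ultimately show ?case by (simp add: a_lcomm)
qed simp

end

section \<open>Batches of independent instructions\<close>

text \<open>Any enumeration will do: in the batches formed with it no operand is a cell that the
  batch writes, so the order of the instructions is immaterial.\<close>

definition list_of :: "'b set \<Rightarrow> 'b list" where
  "list_of I = (SOME xs. set xs = I \<and> distinct xs)"

lemma list_of: "finite I \<Longrightarrow> set (list_of I) = I \<and> distinct (list_of I)"
  unfolding list_of_def by (rule someI_ex) (rule finite_distinct_list)

lemmas set_list_of [simp] = list_of[THEN conjunct1]
lemmas distinct_list_of [simp] = list_of[THEN conjunct2]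

definition accum_all ::
  "('i \<Rightarrow> bool) \<Rightarrow> ('i \<Rightarrow> 'c) \<Rightarrow> ('i \<Rightarrow> 'c arg) \<Rightarrow> ('i \<Rightarrow> 'c arg) \<Rightarrow> 'i set \<Rightarrow> 'c instr list" where
  "accum_all b d x y I = map (\<lambda>i. Accum (b i) (d i) (x i) (y i)) (list_of I)"

definition load_all :: "('i \<Rightarrow> 'c) \<Rightarrow> ('i \<Rightarrow> 'c arg) \<Rightarrow> 'i set \<Rightarrow> 'c instr list" where
  "load_all d x I = map (\<lambda>i. Load (d i) (x i)) (list_of I)"

lemma batch_simps [simp]:
  assumes "finite I"
  shows "accums (accum_all b d x y I) = card I" "accums (load_all d x I) = 0"
    "add_only (accum_all b d x y I) \<longleftrightarrow> (\<forall>i\<in>I. \<not> b i)" "add_only (load_all d x I)"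
    "prog_ok m n D (accum_all b d x y I) \<longleftrightarrow>
      (\<forall>i\<in>I. d i \<in> D \<and> arg_ok m n D (x i) \<and> arg_ok m n D (y i))"
    "prog_ok m n D (load_all d x I) \<longleftrightarrow> (\<forall>i\<in>I. d i \<in> D \<and> arg_ok m n D (x i))"
proof -
  have "sum_list (map (\<lambda>_. 1) xs) = length xs" for xs :: "'a list" by (induction xs) auto
  then show "accums (accum_all b d x y I) = card I"
    using assms by (simp add: accums_def accum_all_def o_def distinct_card[symmetric])
qed (use assms in \<open>auto simp: accums_def accum_all_def load_all_def add_only_def prog_ok_def o_def\<close>)

context semiring_matrix
begin

lemma sg_False [simp]: "sg R False u = u"
  by (simp add: sg_def)

lemma sg_closed: "u \<in> carrier R \<Longrightarrow> (b \<Longrightarrow> ring R) \<Longrightarrow> sg R b u \<in> carrier R"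
  using ring.is_abelian_group abelian_group.a_inv_closed by (fastforce simp: sg_def)

lemma aval_closed: "(\<And>c. f c \<in> carrier R) \<Longrightarrow> aval R A f x \<in> carrier R"
  by (cases x) auto

lemma exec_closed:
  "(\<And>c. f c \<in> carrier R) \<Longrightarrow> (\<not> add_only p \<Longrightarrow> ring R) \<Longrightarrow> exec R A p f c \<in> carrier R"
proof (induction p arbitrary: f)
  case (Cons i p)
  have "exec1 R A i f c \<in> carrier R" for c
    using Cons.prems by (cases i) (auto intro!: sg_closed aval_closed a_closed m_closed)
  then show ?case using Cons by simp
qed simp

text \<open>Since no operand is a destination, all products are evaluated in the initial memory.
  Several instructions may share a destination, hence the sum over all \<open>i\<close> with
  \<open>d i = c\<close>.\<close>

lemma exec_accums:
  assumes "distinct xs" "\<And>c. f c \<in> carrier R" "\<And>i. i \<in> set xs \<Longrightarrow> b i \<Longrightarrow> ring R"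
    "\<And>i j. i \<in> set xs \<Longrightarrow> j \<in> set xs \<Longrightarrow> x i \<noteq> Var (d j) \<and> y i \<noteq> Var (d j)"
  shows "exec R A (map (\<lambda>i. Accum (b i) (d i) (x i) (y i)) xs) f c =
    f c \<oplus> (\<Oplus>i\<in>{i \<in> set xs. d i = c}. sg R (b i) (aval R A f (x i) \<otimes> aval R A f (y i)))"
  using assms
proof (induction xs arbitrary: f)
  case (Cons a xs)
  let ?t = "\<lambda>i. sg R (b i) (aval R A f (x i) \<otimes> aval R A f (y i))"
  let ?f1 = "f(d a := f (d a) \<oplus> ?t a)"
  have t: "?t i \<in> carrier R" if "i \<in> set (a # xs)" for i
    using Cons.prems that by (intro sg_closed m_closed aval_closed) auto
  have "?f1 c \<in> carrier R" for c using Cons.prems(2) t[of a] by simp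
  then have "exec R A (map (\<lambda>i. Accum (b i) (d i) (x i) (y i)) xs) ?f1 c = ?f1 c \<oplus>
      (\<Oplus>i\<in>{i \<in> set xs. d i = c}. sg R (b i) (aval R A ?f1 (x i) \<otimes> aval R A ?f1 (y i)))"
    using Cons.prems by (intro Cons.IH) auto
  also have "(\<Oplus>i\<in>{i \<in> set xs. d i = c}. sg R (b i) (aval R A ?f1 (x i) \<otimes> aval R A ?f1 (y i))) =
      (\<Oplus>i\<in>{i \<in> set xs. d i = c}. ?t i)"
  proof (rule fs_cong)
    fix i assume i: "i \<in> {i \<in> set xs. d i = c}"
    have "aval R A ?f1 z = aval R A f z" if "z \<noteq> Var (d a)" for z
      using that by (cases z) auto
    then show "sg R (b i) (aval R A ?f1 (x i) \<otimes> aval R A ?f1 (y i)) = ?t i"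
      using i Cons.prems(4)[of i a] by simp
  qed (use t in auto)
  also have "?f1 c \<oplus> \<dots> = f c \<oplus> (\<Oplus>i\<in>{i \<in> set (a # xs). d i = c}. ?t i)"
  proof (cases "d a = c")
    case True
    have "{i \<in> set (a # xs). d i = c} = insert a {i \<in> set xs. d i = c}" using True by auto
    moreover have "(\<Oplus>i\<in>insert a {i \<in> set xs. d i = c}. ?t i) = ?t a \<oplus> (\<Oplus>i\<in>{i \<in> set xs. d i = c}. ?t i)"
      using Cons.prems(1) t by (intro fs_insert) auto
    moreover have "(\<Oplus>i\<in>{i \<in> set xs. d i = c}. ?t i) \<in> carrier R" using t by (intro fs_closed) auto
    ultimately show ?thesis using True Cons.prems(2) t by (simp add: a_assoc)
  next
    case False
    then have "{i \<in> set (a # xs). d i = c} = {i \<in> set xs. d i = c}" by auto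
    then show ?thesis using False by simp
  qed
  finally show ?case by (simp only: list.map exec_Cons exec1.simps)
qed simp

lemma exec_accum_all:
  assumes "finite I" "\<And>c. f c \<in> carrier R" "\<And>i. i \<in> I \<Longrightarrow> b i \<Longrightarrow> ring R"
    "\<And>i j. i \<in> I \<Longrightarrow> j \<in> I \<Longrightarrow> x i \<noteq> Var (d j) \<and> y i \<noteq> Var (d j)"
  shows "exec R A (accum_all b d x y I) f c =
    f c \<oplus> (\<Oplus>i\<in>{i \<in> I. d i = c}. sg R (b i) (aval R A f (x i) \<otimes> aval R A f (y i)))"
  using exec_accums[of "list_of I" f b x d y c] assms by (simp add: accum_all_def)

lemma exec_accum_all_inj:
  assumes "finite I" "\<And>c. f c \<in> carrier R" "\<And>i. i \<in> I \<Longrightarrow> b i \<Longrightarrow> ring R"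
    "\<And>i j. i \<in> I \<Longrightarrow> j \<in> I \<Longrightarrow> x i \<noteq> Var (d j) \<and> y i \<noteq> Var (d j)" "inj_on d I"
  shows "i \<in> I \<Longrightarrow> exec R A (accum_all b d x y I) f (d i) =
      f (d i) \<oplus> sg R (b i) (aval R A f (x i) \<otimes> aval R A f (y i))"
    and "c \<notin> d ` I \<Longrightarrow> exec R A (accum_all b d x y I) f c = f c"
proof -
  assume i: "i \<in> I"
  then have "{j \<in> I. d j = d i} = {i}" using assms(5) by (auto simp: inj_on_def)
  moreover have "sg R (b i) (aval R A f (x i) \<otimes> aval R A f (y i)) \<in> carrier R"
    using assms(2,3) i by (intro sg_closed m_closed aval_closed) auto
  ultimately show "exec R A (accum_all b d x y I) f (d i) =
      f (d i) \<oplus> sg R (b i) (aval R A f (x i) \<otimes> aval R A f (y i))"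
    using exec_accum_all[of I f b x d y "d i", OF assms(1-4)] by (simp add: fs_single)
next
  assume "c \<notin> d ` I"
  then have empty: "{j \<in> I. d j = c} = {}" by auto
  have "exec R A (accum_all b d x y I) f c = f c \<oplus> (\<Oplus>i\<in>{i \<in> I. d i = c}. sg R (b i) (aval R A f (x i) \<otimes> aval R A f (y i)))"
    by (rule exec_accum_all) (use assms(1-4) in auto)
  then show "exec R A (accum_all b d x y I) f c = f c"
    using assms(2) by (simp only: empty finsum_empty r_zero)
qed

lemma exec_loads:
  assumes "distinct xs" "inj_on d (set xs)" "\<And>i j. i \<in> set xs \<Longrightarrow> j \<in> set xs \<Longrightarrow> x i \<noteq> Var (d j)"
  shows "(\<forall>i\<in>set xs. exec R A (map (\<lambda>i. Load (d i) (x i)) xs) f (d i) = aval R A f (x i)) \<and>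
    (\<forall>c. c \<notin> d ` set xs \<longrightarrow> exec R A (map (\<lambda>i. Load (d i) (x i)) xs) f c = f c)"
  using assms
proof (induction xs arbitrary: f)
  case (Cons a xs)
  let ?f1 = "f(d a := aval R A f (x a))"
  have *: "aval R A ?f1 (x i) = aval R A f (x i)" if "i \<in> set xs" for i
    using Cons.prems(3)[of i a] that by (cases "x i") auto
  have "(\<forall>i\<in>set xs. exec R A (map (\<lambda>i. Load (d i) (x i)) xs) ?f1 (d i) = aval R A ?f1 (x i)) \<and>
    (\<forall>c. c \<notin> d ` set xs \<longrightarrow> exec R A (map (\<lambda>i. Load (d i) (x i)) xs) ?f1 c = ?f1 c)"
    using Cons.prems by (intro Cons.IH) auto
  moreover have "d a \<notin> d ` set xs" using Cons.prems(1,2) by auto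
  ultimately show ?case using * by auto
qed simp

lemma exec_load_all:
  assumes "finite I" "inj_on d I" "\<And>i j. i \<in> I \<Longrightarrow> j \<in> I \<Longrightarrow> x i \<noteq> Var (d j)"
  shows "i \<in> I \<Longrightarrow> exec R A (load_all d x I) f (d i) = aval R A f (x i)"
    and "c \<notin> d ` I \<Longrightarrow> exec R A (load_all d x I) f c = f c"
  using exec_loads[of "list_of I" d x f] assms by (auto simp: load_all_def)

end

section \<open>Arbitrary semirings\<close>

definition subsets_upto :: "nat \<Rightarrow> nat \<Rightarrow> nat set set" where
  "subsets_upto n p = {X. X \<subseteq> {1..n} \<and> card X \<le> p}"

lemma finite_subsets_upto [simp]: "finite (subsets_upto n p)"
  by (rule finite_subset[of _ "Pow {1..n}"]) (auto simp: subsets_upto_def)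

lemma card_subsets_upto: "card (subsets_upto n p) = (\<Sum>k\<le>p. n choose k)"
proof -
  have "subsets_upto n p = (\<Union>k\<in>{..p}. {X. X \<subseteq> {1..n} \<and> card X = k})"
    by (auto simp: subsets_upto_def)
  then have "card (subsets_upto n p) = (\<Sum>k\<le>p. card {X. X \<subseteq> {1..n} \<and> card X = k})"
    by (simp only:) (rule card_UN_disjoint; auto)
  then show ?thesis by (simp add: n_subsets)
qed

lemma binomial_sum_nat: "binomial_sum n (real p) = card (subsets_upto n p)"
  unfolding card_subsets_upto binomial_sum_def by (rule sum.cong) auto

text \<open>For a natural number \<open>k\<close>, being at most \<open>m / 2\<close> and being at
  most \<open>m div 2\<close> are the same.\<close>

lemma binomial_sum_half: "binomial_sum n (real m / 2) = card (subsets_upto n (m div 2))"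
  unfolding card_subsets_upto binomial_sum_def by (rule sum.cong) auto

text \<open>The pairs \<open>(X, x)\<close> index the products that occur when the permanents on all
  column sets of size \<open>k\<close> are expanded along a row.\<close>

lemma card_marked_layer:
  "card {(X, x). X \<subseteq> {1..n} \<and> card X = k \<and> x \<in> X} = k * (n choose k)"
proof -
  have "{(X, x). X \<subseteq> {1..n} \<and> card X = k \<and> x \<in> X} = Sigma {X. X \<subseteq> {1..n} \<and> card X = k} (\<lambda>X. X)"
    by auto
  then have "card {(X, x). X \<subseteq> {1..n} \<and> card X = k \<and> x \<in> X} = (\<Sum>X | X \<subseteq> {1..n} \<and> card X = k. card X)"
    by (simp only:) (rule card_SigmaI; auto intro: finite_subset)
  also have "\<dots> = k * (n choose k)" by (simp add: n_subsets)
  finally show ?thesis .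
qed

lemma finite_layer [simp]: "finite U \<Longrightarrow> finite {X. X \<subseteq> U \<and> card X = k}"
  by (rule finite_subset[of _ "Pow U"]) auto

lemma finite_marked_layer [simp]: "finite U \<Longrightarrow> finite {(X, x). X \<subseteq> U \<and> card X = k \<and> x \<in> X}"
  by (rule finite_subset[of _ "Pow U \<times> U"]) auto

text \<open>Fills \<open>(t, X)\<close> with the permanent of the \<open>card X\<close> rows ending at row \<open>e\<close> and the columns \<open>X\<close>.\<close>

definition dp_layer :: "nat \<Rightarrow> nat \<Rightarrow> nat \<Rightarrow> nat \<Rightarrow> (nat \<times> nat set) instr list" where
  "dp_layer t e n k = accum_all (\<lambda>_. False) (\<lambda>(X, x). (t, X)) (\<lambda>(X, x). Inp (Suc e - k) x)
     (\<lambda>(X, x). Var (t, X - {x})) {(X, x). X \<subseteq> {1..n} \<and> card X = k \<and> x \<in> X}"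

text \<open>A layer reads only sets smaller by one. The table starts from the empty permanent 1, and
  all other cells are expected to contain zero.\<close>

definition dp :: "nat \<Rightarrow> nat \<Rightarrow> nat \<Rightarrow> nat \<Rightarrow> (nat \<times> nat set) instr list" where
  "dp t e n p = Load (t, {}) One # concat (map (dp_layer t e n) [1..<Suc p])"

lemma dp_Suc: "dp t e n (Suc p) = dp t e n p @ dp_layer t e n (Suc p)"
  by (simp add: dp_def)

lemma add_only_dp [simp]: "add_only (dp t e n p)"
  by (auto simp: dp_def dp_layer_def simp del: upt_Suc)

lemma accums_dp: "accums (dp t e n p) \<le> p * card (subsets_upto n p)"
proof -
  have "accums (dp t e n p) = (\<Sum>k\<in>{1..<Suc p}. k * (n choose k))"
    by (simp add: dp_def dp_layer_def card_marked_layer o_def interv_sum_list_conv_sum_set_nat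
          del: upt_Suc One_nat_def)
  also have "\<dots> \<le> (\<Sum>k\<in>{1..<Suc p}. p * (n choose k))" by (rule sum_mono) auto
  also have "\<dots> \<le> (\<Sum>k\<le>p. p * (n choose k))" by (rule sum_mono2) auto
  finally show ?thesis by (simp add: card_subsets_upto sum_distrib_left)
qed

lemma prog_ok_dp:
  assumes "p \<le> e" "e \<le> m" "{t} \<times> subsets_upto n p \<subseteq> D"
  shows "prog_ok m n D (dp t e n p)"
proof -
  have *: "(t, X) \<in> D" if "X \<subseteq> {1..n}" "card X \<le> p" for X
    using assms(3) that by (auto simp: subsets_upto_def)
  have "prog_ok m n D (dp_layer t e n k)" if "1 \<le> k" "k \<le> p" for k
  proof -
    have "card (X - {x}) \<le> p" if "card X = k" for X and x :: nat
      using card_Diff1_le[of X x] that \<open>k \<le> p\<close> by linarith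
    then show ?thesis using assms(1,2) that
      by (auto simp: dp_layer_def intro!: *)
  qed
  then show ?thesis using *[of "{}"] by (auto simp: dp_def simp del: upt_Suc)
qed

context semiring_matrix
begin

lemma exec_dp:
  assumes "p \<le> e" "\<And>c. f c \<in> carrier R" "\<And>X. f (t, X) = \<zero>"
  shows "exec R A (dp t e n p) f c =
    (if fst c = t \<and> snd c \<in> subsets_upto n p then V [Suc e - card (snd c)..<Suc e] (snd c) else f c)"
  using assms(1)
proof (induction p arbitrary: c)
  case 0
  have "X \<subseteq> {1..n} \<Longrightarrow> card X = 0 \<longleftrightarrow> X = {}" for X using finite_subset[of X "{1..n}"] by auto
  then show ?case by (cases c) (auto simp: dp_def subsets_upto_def)
next
  case (Suc p)
  define g where "g = exec R A (dp t e n p) f"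
  have g: "g c = (if fst c = t \<and> snd c \<in> subsets_upto n p
      then V [Suc e - card (snd c)..<Suc e] (snd c) else f c)" for c
    using Suc by (simp add: g_def)
  have gc: "g c \<in> carrier R" for c using g assms(2) by simp
  let ?I = "{(X, x). X \<subseteq> {1..n} \<and> card X = Suc p \<and> x \<in> X}"
  obtain t' X where c: "c = (t', X)" by fastforce
  have "exec R A (dp t e n (Suc p)) f c = exec R A (dp_layer t e n (Suc p)) g c"
    by (simp add: dp_Suc g_def)
  also have "\<dots> = g c \<oplus> (\<Oplus>i\<in>{i \<in> ?I. (case i of (X, x) \<Rightarrow> (t, X)) = c}.
      sg R False (aval R A g (case i of (X, x) \<Rightarrow> Inp (Suc e - Suc p) x) \<otimes>
      aval R A g (case i of (X, x) \<Rightarrow> Var (t, X - {x}))))"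
    unfolding dp_layer_def
  proof (rule exec_accum_all)
    fix i j assume "i \<in> ?I" "j \<in> ?I"
    then obtain X x Y y where ij: "i = (X, x)" "j = (Y, y)" "card X = Suc p" "x \<in> X" "card Y = Suc p"
      by auto
    then have "finite X" by (auto intro: card_ge_0_finite)
    \<comment> \<open>Operands have size \<open>p\<close> and destinations size
      \<open>Suc p\<close>, so the batch is independent.\<close>
    then have "card (X - {x}) = p" using ij by simp
    then have "X - {x} \<noteq> Y" using ij(5) by auto
    then show "(case i of (X, x) \<Rightarrow> Inp (Suc e - Suc p) x) \<noteq> Var (case j of (X, x) \<Rightarrow> (t, X)) \<and>
        (case i of (X, x) \<Rightarrow> Var (t, X - {x})) \<noteq> Var (case j of (X, x) \<Rightarrow> (t, X))"
      using ij by simp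
  qed (use gc in auto)
  also have "\<dots> = (if fst c = t \<and> snd c \<in> subsets_upto n (Suc p)
      then V [Suc e - card (snd c)..<Suc e] (snd c) else f c)"
  proof (cases "t' = t \<and> X \<subseteq> {1..n} \<and> card X = Suc p")
    case True
    then have fin: "finite X" using finite_subset by blast
    have "{i \<in> ?I. (case i of (X, x) \<Rightarrow> (t, X)) = c} = Pair X ` X" using True c by auto
    then have "(\<Oplus>i\<in>{i \<in> ?I. (case i of (X, x) \<Rightarrow> (t, X)) = c}.
        sg R False (aval R A g (case i of (X, x) \<Rightarrow> Inp (Suc e - Suc p) x) \<otimes>
        aval R A g (case i of (X, x) \<Rightarrow> Var (t, X - {x})))) =
        (\<Oplus>x\<in>X. A (e - p) x \<otimes> g (t, X - {x}))"
      using gc by (simp only:) (subst finsum_reindex; auto simp: inj_on_def)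
    also have "\<dots> = (\<Oplus>x\<in>X. A (e - p) x \<otimes> V [Suc e - p..<Suc e] (X - {x}))"
      using True fin by (intro fs_cong) (auto simp: g subsets_upto_def simp del: upt_Suc)
    also have "\<dots> = V ((e - p) # [Suc e - p..<Suc e]) X" by simp
    \<comment> \<open>Row \<open>e - p\<close> comes right before the rows of the previous layer;
      \<open>Suc p \<le> e\<close> keeps the subtractions from truncating.\<close>
    also have "(e - p) # [Suc e - p..<Suc e] = [Suc e - Suc p..<Suc e]"
      using Suc.prems by (subst (2) upt_conv_Cons) (auto simp: Suc_diff_le simp del: upt_Suc)
    finally show ?thesis using True c g[of c] assms(3) by (simp add: subsets_upto_def del: upt_Suc)
  next
    case False
    then have "{i \<in> ?I. (case i of (X, x) \<Rightarrow> (t, X)) = c} = {}" using c by auto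
    moreover have "fst c = t \<and> snd c \<in> subsets_upto n (Suc p) \<longleftrightarrow> fst c = t \<and> snd c \<in> subsets_upto n p"
      using False c by (auto simp: subsets_upto_def)
    ultimately show ?thesis using gc[of c] g[of c] by (simp only: finsum_empty r_zero)
  qed
  finally show ?case .
qed

end

definition semiring_prog :: "nat \<Rightarrow> nat \<Rightarrow> (nat \<times> nat set) instr list" where
  "semiring_prog m n = dp 0 m n m @
     accum_all (\<lambda>_. False) (\<lambda>_. (1, {})) (\<lambda>X. Var (0, X)) (\<lambda>_. One) {X. X \<subseteq> {1..n} \<and> card X = m}"

text \<open>The table stops at sets of size \<open>m\<close>, while \<open>per\<close> uses all
  \<open>n\<close> columns. By \<open>V_subsets\<close> the permanents on the
  \<open>m\<close>-element column sets add up to it.\<close>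

lemma (in semiring_matrix) exec_semiring_prog:
  "exec R A (semiring_prog m n) (\<lambda>_. \<zero>) (1, {}) = per R m n A"
proof -
  define g where "g = exec R A (dp 0 m n m) (\<lambda>_. \<zero>)"
  let ?I = "{X. X \<subseteq> {1..n} \<and> card X = m}"
  have g: "g c = (if fst c = 0 \<and> snd c \<in> subsets_upto n m
      then V [Suc m - card (snd c)..<Suc m] (snd c) else \<zero>)" for c
    unfolding g_def by (subst exec_dp) auto
  have "exec R A (semiring_prog m n) (\<lambda>_. \<zero>) (1, {}) = g (1, {}) \<oplus>
     (\<Oplus>X\<in>{X \<in> ?I. (1, {}) = (1 :: nat, {} :: nat set)}. sg R False (aval R A g (Var (0, X)) \<otimes> aval R A g One))"
    unfolding semiring_prog_def exec_append g_def[symmetric]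
    by (rule exec_accum_all) (auto simp: g)
  also have "\<dots> = (\<Oplus>X\<in>?I. V [1..<Suc m] X)"
    by (simp add: g del: upt_Suc) (rule fs_cong; auto simp: subsets_upto_def simp del: upt_Suc)
  also have "\<dots> = per R m n A"
    using V_subsets[of "{1..n}" "[1..<Suc m]"] by (simp add: per_eq_V del: upt_Suc)
  finally show ?thesis .
qed

lemma per_computable_semiring:
  "per_computable (semiring :: 'a ring \<Rightarrow> bool) semiring_program
    (\<lambda>m n. m * binomial_sum n (real m)) (\<lambda>m n. binomial_sum n (real m))"
\<comment> \<open>The constant 6 is 3 operations per accumulation times 2, since the table and the
  final summation each take at most \<open>m * ?b\<close> accumulations.\<close>
proof (rule per_computableI[where c = 6 and 'c = "nat \<times> nat set"])
  fix m n :: nat assume mn: "1 \<le> m" "m \<le> n"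
  let ?D = "insert (1, {}) ({0 :: nat} \<times> subsets_upto n m)"
  let ?b = "card (subsets_upto n m)"
  have "{} \<in> subsets_upto n m" by (simp add: subsets_upto_def)
  then have b: "?b \<ge> 1" by (metis One_nat_def Suc_leI card_gt_0_iff empty_iff finite_subsets_upto)
  have I: "card {X. X \<subseteq> {1..n} \<and> card X = m} \<le> ?b"
    by (rule card_mono) (auto simp: subsets_upto_def)
  have "accums (semiring_prog m n) \<le> 2 * (m * ?b)"
    using accums_dp[of 0 m n m] I mn(1) by (auto simp: semiring_prog_def intro: order_trans[OF add_mono] intro!: le_trans[OF I])
  moreover have "card ?D \<le> Suc ?b" by (rule order_trans[OF card_insert_le_m1]) (auto simp: card_cartesian_product)
  moreover have "prog_ok m n ?D (dp 0 m n m)" by (rule prog_ok_dp) auto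
  then have "prog_ok m n ?D (semiring_prog m n)"
    unfolding semiring_prog_def by (auto simp: subsets_upto_def)
  moreover have "exec R A (semiring_prog m n) (\<lambda>_. \<zero>\<^bsub>R\<^esub>) (1, {}) = per R m n A"
    if "semiring R" "\<forall>i j. A i j \<in> carrier R" for R :: "'a ring" and A
    using that by (intro semiring_matrix.exec_semiring_prog)
      (simp add: semiring_matrix_def semiring_matrix_axioms_def)
  ultimately show "\<exists>(p :: (nat \<times> nat set) instr list) D r. finite D \<and> r \<in> D \<and> prog_ok m n D p \<and>
      (add_only p \<or> semiring_program = (\<lambda>_. True)) \<and> 3 * accums p \<le> 6 * (m * binomial_sum n (real m)) \<and>
      card D + 1 \<le> 6 * binomial_sum n (real m) \<and>
      (\<forall>(R :: 'a ring) A. semiring R \<and> (\<forall>i j. A i j \<in> carrier R) \<longrightarrow>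
        exec R A p (\<lambda>_. \<zero>\<^bsub>R\<^esub>) r = per R m n A)"
    using b by (intro exI[of _ "semiring_prog m n"] exI[of _ ?D] exI[of _ "(1, {})"])
      (auto simp: binomial_sum_nat semiring_prog_def)
qed (auto simp: semiring_def abelian_monoid.zero_closed)

section \<open>Commutative semirings\<close>

text \<open>The index \<open>(X, 0)\<close> stands for leaving column \<open>j\<close> unmatched; rows are counted from 1.\<close>

definition column_layer :: "nat \<Rightarrow> nat \<Rightarrow> nat \<Rightarrow> (nat \<times> nat set) instr list" where
  "column_layer m n j = accum_all (\<lambda>_. False) (\<lambda>(X, i). (j, X))
     (\<lambda>(X, i). if i = 0 then One else Inp i j)
     (\<lambda>(X, i). if i = 0 then Var (j - 1, X) else Var (j - 1, X - {i}))
     {(X, i). X \<subseteq> {1..m} \<and> card X \<le> j \<and> j \<le> card X + (n - m) \<and> (i = 0 \<or> i \<in> X)}"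

definition column_prog :: "nat \<Rightarrow> nat \<Rightarrow> (nat \<times> nat set) instr list" where
  "column_prog m n = Load (0, {}) One # concat (map (column_layer m n) [1..<Suc n])"

lemma finite_column_index [simp]:
  "finite U \<Longrightarrow> finite {(X, i). X \<subseteq> U \<and> card X \<le> j \<and> j \<le> card X + d \<and> (i = 0 \<or> i \<in> X)}"
  by (rule finite_subset[of _ "Pow U \<times> insert 0 U"]) auto

lemma add_only_column_prog: "add_only (column_prog m n)"
  by (auto simp: column_prog_def column_layer_def simp del: upt_Suc)

text \<open>The bound \<open>Suc j\<close> instead of \<open>j\<close> admits the cells read when
  \<open>X\<close> has as many rows as there are columns including the current one. Such a cell is
  not yet written, and its zero is the right value.\<close>

definition column_cells :: "nat \<Rightarrow> nat \<Rightarrow> (nat \<times> nat set) set" where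
  "column_cells m n = {(j, X). X \<subseteq> {1..m} \<and> card X \<le> Suc j \<and> j \<le> card X + (n - m)}"

lemma finite_column_cells [simp]: "finite (column_cells m n)"
proof (rule finite_subset)
  show "column_cells m n \<subseteq> {..m + (n - m)} \<times> Pow {1..m}"
  proof
    fix z assume "z \<in> column_cells m n"
    then obtain j X where z: "z = (j, X)" "X \<subseteq> {1..m}" "j \<le> card X + (n - m)"
      unfolding column_cells_def by blast
    have "card X \<le> card {1..m}" using z(2) by (intro card_mono) simp_all
    then show "z \<in> {..m + (n - m)} \<times> Pow {1..m}" using z by simp
  qed
qed simp

lemma card_column_cells: "card (column_cells m n) \<le> (n - m + 2) * 2 ^ m"
proof -
  have "card (column_cells m n) \<le> card ({..n - m + 1} \<times> Pow {1..m})"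
    \<comment> \<open>By \<open>card X \<le> Suc j\<close> the difference does not truncate, so it
      determines \<open>j\<close> from \<open>X\<close>, and the band confines it to
      \<open>0, ..., n - m + 1\<close>.\<close>
    by (rule card_inj_on_le[where f = "\<lambda>(j, X). (Suc j - card X, X)"])
      (auto simp: inj_on_def column_cells_def)
  then show ?thesis by (simp add: card_cartesian_product card_Pow)
qed

lemma prog_ok_column_prog: "prog_ok m n (column_cells m n) (column_prog m n)"
proof -
  have "prog_ok m n (column_cells m n) (column_layer m n j)" if "1 \<le> j" "j \<le> n" for j
  proof -
    have "(j - 1, X - {i}) \<in> column_cells m n"
      if X: "X \<subseteq> {1..m}" "card X \<le> j" "j \<le> card X + (n - m)" "i \<in> X" for X i
    proof -
      have "finite X" using X(1) finite_subset by blast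
      then have "card X = Suc (card (X - {i}))" using X(4) by (rule card.remove)
      then show ?thesis using X \<open>1 \<le> j\<close> by (auto simp: column_cells_def)
    qed
    then show ?thesis using that unfolding column_layer_def
      by (auto simp: column_cells_def)
  qed
  then show ?thesis by (auto simp: column_prog_def column_cells_def simp del: upt_Suc)
qed

lemma accums_column_prog: "accums (column_prog m n) \<le> (m + 1) * ((n - m + 1) * 2 ^ m)"
proof -
  let ?I = "\<lambda>j. {(X, i). X \<subseteq> {1..m} \<and> card X \<le> j \<and> j \<le> card X + (n - m) \<and> (i = 0 \<or> i \<in> X)}"
  have "accums (column_prog m n) = (\<Sum>j\<in>{1..<Suc n}. card (?I j))"
    by (simp add: column_prog_def column_layer_def o_def interv_sum_list_conv_sum_set_nat
        del: upt_Suc One_nat_def)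
  also have "\<dots> = card (Sigma {1..<Suc n} ?I)"
    by (rule card_SigmaI[symmetric]) simp_all
  also have "\<dots> \<le> card ({..m} \<times> ({..n - m} \<times> Pow {1..m}))"
    by (rule card_inj_on_le[where f = "\<lambda>(j, (X, i)). (i, (j - card X, X))"])
      (auto simp: inj_on_def)
  finally show ?thesis by (simp add: card_cartesian_product card_Pow)
qed

context comm_semiring_matrix
begin

text \<open>Column \<open>Suc j\<close> is left unmatched or goes to one row of \<open>X\<close>;
  this is \<open>V_insert_column\<close> read as a recursion on the number of columns. The rows are
  listed in increasing order so that \<open>{1..m}\<close> ends up as the list in
  \<open>per_eq_V\<close>.\<close>

lemma exec_column_prog_aux:
  assumes "j \<le> n"
  shows "exec R A (Load (0, {}) One # concat (map (column_layer m n) [1..<Suc j])) (\<lambda>_. \<zero>) c =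
    (if fst c \<le> j \<and> snd c \<subseteq> {1..m} \<and> card (snd c) \<le> fst c \<and> fst c \<le> card (snd c) + (n - m)
     then V (sorted_list_of_set (snd c)) {1..fst c} else \<zero>)"
  using assms
proof (induction j arbitrary: c)
  case 0
  have "X \<subseteq> {1..m} \<Longrightarrow> card X = 0 \<longleftrightarrow> X = {}" for X using finite_subset[of X "{1..m}"] by auto
  then show ?case by (cases c) auto
next
  case (Suc j)
  define g where "g = exec R A (Load (0, {}) One # concat (map (column_layer m n) [1..<Suc j])) (\<lambda>_. \<zero>)"
  have g: "g c =
    (if fst c \<le> j \<and> snd c \<subseteq> {1..m} \<and> card (snd c) \<le> fst c \<and> fst c \<le> card (snd c) + (n - m)
     then V (sorted_list_of_set (snd c)) {1..fst c} else \<zero>)" for c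
    using Suc unfolding g_def by simp
  have gc: "g c \<in> carrier R" for c using g by simp
  let ?I = "{(X, i). X \<subseteq> {1..m} \<and> card X \<le> Suc j \<and> Suc j \<le> card X + (n - m) \<and> (i = 0 \<or> i \<in> X)}"
  let ?d = "\<lambda>(X, i :: nat). (Suc j, X)"
  let ?x = "\<lambda>(X :: nat set, i). if i = 0 then One else Inp i (Suc j)"
  let ?y = "\<lambda>(X, i). if i = 0 then Var (Suc j - 1, X) else Var (Suc j - 1, X - {i})"
  obtain j' X where c: "c = (j', X)" by fastforce
  have "exec R A (Load (0, {}) One # concat (map (column_layer m n) [1..<Suc (Suc j)])) (\<lambda>_. \<zero>) c =
      exec R A (column_layer m n (Suc j)) g c"
    by (simp add: g_def)
  also have "\<dots> = g c \<oplus> (\<Oplus>z\<in>{z \<in> ?I. ?d z = c}. sg R False (aval R A g (?x z) \<otimes> aval R A g (?y z)))"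
    unfolding column_layer_def
    by (rule exec_accum_all) (use gc in \<open>auto split: if_splits\<close>)
  also have "\<dots> = (if fst c \<le> Suc j \<and> snd c \<subseteq> {1..m} \<and> card (snd c) \<le> fst c \<and> fst c \<le> card (snd c) + (n - m)
     then V (sorted_list_of_set (snd c)) {1..fst c} else \<zero>)"
  proof (cases "j' = Suc j \<and> X \<subseteq> {1..m} \<and> card X \<le> Suc j \<and> Suc j \<le> card X + (n - m)")
    case True
    then have fin: "finite X" and X0: "0 \<notin> X" using finite_subset by auto
    have I: "{z \<in> ?I. ?d z = c} = Pair X ` insert 0 X" using True c by auto
    \<comment> \<open>If \<open>card X = Suc j\<close>, the cell still contains zero, and so does
      the right-hand side: there are more rows than columns.\<close>
    have gX: "g (j, X) = V (sorted_list_of_set X) {1..j}"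
      using True fin by (auto simp: g V_eq_zero)
    have gXi: "g (j, X - {i}) = V (remove1 i (sorted_list_of_set X)) {1..j}" if "i \<in> X" for i
    proof -
      have "card X = Suc (card (X - {i}))" using fin that by (rule card.remove)
      then show ?thesis using True fin by (auto simp: g sorted_list_Diff)
    qed
    have "(\<Oplus>z\<in>{z \<in> ?I. ?d z = c}. sg R False (aval R A g (?x z) \<otimes> aval R A g (?y z))) =
       (\<Oplus>i\<in>insert 0 X. aval R A g (?x (X, i)) \<otimes> aval R A g (?y (X, i)))"
      using gc unfolding I by (subst finsum_reindex) (auto simp: inj_on_def)
    also have "\<dots> = g (j, X) \<oplus> (\<Oplus>i\<in>X. aval R A g (?x (X, i)) \<otimes> aval R A g (?y (X, i)))"
      using fin X0 gc by (subst fs_insert) auto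
    also have "(\<Oplus>i\<in>X. aval R A g (?x (X, i)) \<otimes> aval R A g (?y (X, i))) =
        (\<Oplus>i\<in>X. A i (Suc j) \<otimes> V (remove1 i (sorted_list_of_set X)) {1..j})"
      using X0 gXi by (intro fs_cong) auto
    also have "g (j, X) \<oplus> \<dots> = V (sorted_list_of_set X) (insert (Suc j) {1..j})"
      using fin by (subst V_insert_column) (auto simp: gX)
    also have "insert (Suc j) {1..j} = {1..Suc j}" by auto
    finally show ?thesis using True c g[of c] by simp
  next
    case False
    then have I: "{z \<in> ?I. ?d z = c} = {}" using c by auto
    have "fst c \<le> Suc j \<and> snd c \<subseteq> {1..m} \<and> card (snd c) \<le> fst c \<and> fst c \<le> card (snd c) + (n - m) \<longleftrightarrow>
       fst c \<le> j \<and> snd c \<subseteq> {1..m} \<and> card (snd c) \<le> fst c \<and> fst c \<le> card (snd c) + (n - m)"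
      using False c by (auto simp: le_Suc_eq)
    then show ?thesis using gc[of c] g[of c] by (simp only: I finsum_empty r_zero)
  qed
  finally show ?case .
qed

lemma exec_column_prog:
  assumes "m \<le> n"
  shows "exec R A (column_prog m n) (\<lambda>_. \<zero>) (n, {1..m}) = per R m n A"
proof -
  have "sorted_list_of_set {1..m} = [1..<Suc m]"
    unfolding atLeastLessThanSuc_atLeastAtMost[symmetric] by (rule sorted_list_of_set_range)
  then show ?thesis
    unfolding column_prog_def using assms
    by (subst exec_column_prog_aux) (auto simp: per_eq_V simp del: upt_Suc)
qed

end

lemma per_computable_comm_semiring:
  "per_computable (comm_semiring :: 'a ring \<Rightarrow> bool) semiring_program
    (\<lambda>m n. m * (n - m + 1) * 2 ^ m) (\<lambda>m n. (n - m + 1) * 2 ^ m)"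
\<comment> \<open>The constant 6 is 3 operations per accumulation times the 2 from
  \<open>m + 1 \<le> 2 * m\<close>.\<close>
proof (rule per_computableI[where c = 6 and 'c = "nat \<times> nat set"])
  fix m n :: nat assume mn: "1 \<le> m" "m \<le> n"
  let ?e = "(n - m + 1) * 2 ^ m"
  have "accums (column_prog m n) \<le> (m + 1) * ?e" by (rule accums_column_prog)
  also have "\<dots> \<le> (2 * m) * ?e" by (rule mult_right_mono) (use mn in auto)
  finally have "3 * accums (column_prog m n) \<le> 6 * (m * (n - m + 1) * 2 ^ m)"
    by (simp only: mult.assoc)
  moreover have "card (column_cells m n) + 1 \<le> 6 * ?e"
  proof -
    have "(n - m + 2) * 2 ^ m \<le> 2 * ?e" by simp
    moreover have "1 * 1 \<le> ?e" by (rule mult_le_mono) simp_all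
    moreover note card_column_cells[of m n]
    ultimately show ?thesis by linarith
  qed
  moreover have "(n, {1..m}) \<in> column_cells m n" using mn by (auto simp: column_cells_def)
  moreover have "exec R A (column_prog m n) (\<lambda>_. \<zero>\<^bsub>R\<^esub>) (n, {1..m}) = per R m n A"
    if "comm_semiring R" "\<forall>i j. A i j \<in> carrier R" for R :: "'a ring" and A
    using that mn(2) by (intro comm_semiring_matrix.exec_column_prog)
      (simp_all add: comm_semiring_def comm_semiring_matrix_def semiring_matrix_def semiring_matrix_axioms_def)
  ultimately show "\<exists>(p :: (nat \<times> nat set) instr list) D r. finite D \<and> r \<in> D \<and> prog_ok m n D p \<and>
      (add_only p \<or> semiring_program = (\<lambda>_. True)) \<and> 3 * accums p \<le> 6 * (m * (n - m + 1) * 2 ^ m) \<and>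
      card D + 1 \<le> 6 * ((n - m + 1) * 2 ^ m) \<and>
      (\<forall>(R :: 'a ring) A. comm_semiring R \<and> (\<forall>i j. A i j \<in> carrier R) \<longrightarrow>
        exec R A p (\<lambda>_. \<zero>\<^bsub>R\<^esub>) r = per R m n A)"
    using prog_ok_column_prog[of m n] add_only_column_prog[of m n] finite_column_cells[of m n]
    by (intro exI[of _ "column_prog m n"] exI[of _ "column_cells m n"] exI[of _ "(n, {1..m})"]) blast
next
  show "\<zero>\<^bsub>R\<^esub> \<in> carrier R" if "comm_semiring R" for R :: "'a ring"
    using that by (simp add: comm_semiring_def semiring.axioms(1) abelian_monoid.zero_closed)
qed simp

section \<open>Noncommutative rings\<close>

locale ring_matrix = semiring_matrix R A + ring R
  for R :: "'a ring" (structure) and A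
begin

lemma sg_closed_ring [simp]: "u \<in> carrier R \<Longrightarrow> sg R b u \<in> carrier R"
  by (simp add: sg_def)

lemma sg_add: "u \<in> carrier R \<Longrightarrow> v \<in> carrier R \<Longrightarrow> sg R b (u \<oplus> v) = sg R b u \<oplus> sg R b v"
  by (simp add: sg_def minus_add)

lemma sg_finsum:
  "finite I \<Longrightarrow> (\<And>i. i \<in> I \<Longrightarrow> f i \<in> carrier R) \<Longrightarrow> sg R b (finsum R f I) = (\<Oplus>i\<in>I. sg R b (f i))"
proof (induction I rule: finite_induct)
  case (insert i I)
  then show ?case by (simp add: fs_insert sg_add fs_closed)
qed (simp add: sg_def)

text \<open>For a fixed \<open>w\<close> in \<open>W\<close> the sets \<open>Z\<close> and
  \<open>insert w Z\<close> carry opposite signs and cancel.\<close>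

lemma alternating_sum:
  assumes "finite W" "u \<in> carrier R"
  shows "(\<Oplus>Z\<in>Pow W. sg R (odd (card Z)) u) = (if W = {} then u else \<zero>)"
proof (cases "W = {}")
  case True
  then show ?thesis using assms(2) by (simp add: fs_single)
next
  case False
  then obtain w where w: "w \<in> W" by auto
  define W' where "W' = W - {w}"
  have W': "finite W'" "w \<notin> W'" "W = insert w W'" using assms(1) w by (auto simp: W'_def)
  have "(\<Oplus>Z\<in>insert w ` Pow W'. sg R (odd (card Z)) u) = (\<Oplus>Z\<in>Pow W'. sg R (odd (card (insert w Z))) u)"
    using W'(2) assms(2) by (intro finsum_reindex) (auto simp: inj_on_def)
  also have "\<dots> = (\<Oplus>Z\<in>Pow W'. sg R (even (card Z)) u)"
  proof (rule fs_cong)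
    fix Z assume "Z \<in> Pow W'"
    then have "finite Z" "w \<notin> Z" using W' finite_subset by auto
    then show "sg R (odd (card (insert w Z))) u = sg R (even (card Z)) u" by simp
  qed (use assms(2) in auto)
  finally have 1: "(\<Oplus>Z\<in>insert w ` Pow W'. sg R (odd (card Z)) u) = (\<Oplus>Z\<in>Pow W'. sg R (even (card Z)) u)" .
  have "(\<Oplus>Z\<in>Pow W. sg R (odd (card Z)) u) =
      (\<Oplus>Z\<in>Pow W'. sg R (odd (card Z)) u) \<oplus> (\<Oplus>Z\<in>insert w ` Pow W'. sg R (odd (card Z)) u)"
    unfolding W'(3) Pow_insert by (rule fs_Un) (use W' assms(2) in auto)
  also have "\<dots> = (\<Oplus>Z\<in>Pow W'. sg R (odd (card Z)) u \<oplus> sg R (even (card Z)) u)"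
    unfolding 1 by (rule fs_add[symmetric]) (use assms(2) in auto)
  also have "\<dots> = \<zero>"
    using assms(2) by (intro fs_zero) (simp add: sg_def r_neg l_neg)
  finally show ?thesis using False by simp
qed

text \<open>Distributing the product gives a triple sum in which \<open>Z \<subseteq> X\<close> and
  \<open>Z \<subseteq> Y\<close> combine to \<open>Z \<subseteq> X \<inter> Y\<close>; summing over
  \<open>Z\<close> first leaves the disjoint pairs. \<open>Q\<close> has to contain all subsets of
  members of \<open>P\<close>, and any further \<open>Z\<close> in it contributes only empty sums.
  The factors are never interchanged.\<close>

lemma inclusion_exclusion:
  assumes fin: "finite P" "finite Q" and sub: "\<And>X Z. X \<in> P \<Longrightarrow> Z \<subseteq> X \<Longrightarrow> Z \<in> Q"
    and finP: "\<And>X. X \<in> P \<Longrightarrow> finite X"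
    and F: "\<And>X. X \<in> P \<Longrightarrow> F X \<in> carrier R" and G: "\<And>X. X \<in> P \<Longrightarrow> G X \<in> carrier R"
  shows "(\<Oplus>Z\<in>Q. sg R (odd (card Z)) ((\<Oplus>X\<in>{X \<in> P. Z \<subseteq> X}. F X) \<otimes> (\<Oplus>Y\<in>{Y \<in> P. Z \<subseteq> Y}. G Y))) =
    (\<Oplus>X\<in>P. \<Oplus>Y\<in>P. if X \<inter> Y = {} then F X \<otimes> G Y else \<zero>)"
proof -
  let ?s = "\<lambda>Z X Y. sg R (odd (card Z)) (F X \<otimes> G Y)"
  let ?t = "\<lambda>Z X Y. if Z \<subseteq> X \<inter> Y then ?s Z X Y else \<zero>"
  have s: "?s Z X Y \<in> carrier R" if "X \<in> P" "Y \<in> P" for Z X Y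
    using that F G by simp
  have t: "?t Z X Y \<in> carrier R" if "X \<in> P" "Y \<in> P" for Z X Y
    using s[OF that, of Z] by auto
  have "sg R (odd (card Z)) ((\<Oplus>X\<in>{X \<in> P. Z \<subseteq> X}. F X) \<otimes> (\<Oplus>Y\<in>{Y \<in> P. Z \<subseteq> Y}. G Y)) =
      (\<Oplus>X\<in>P. \<Oplus>Y\<in>P. ?t Z X Y)" for Z
  proof -
    let ?P = "{X \<in> P. Z \<subseteq> X}"
    have finZ: "finite ?P" using fin(1) by simp
    have "(\<Oplus>X\<in>?P. F X) \<otimes> (\<Oplus>Y\<in>?P. G Y) = (\<Oplus>X\<in>?P. F X \<otimes> (\<Oplus>Y\<in>?P. G Y))"
      by (rule fs_ldistr[OF finZ]) (use F G in \<open>auto intro: fs_closed\<close>)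
    also have "\<dots> = (\<Oplus>X\<in>?P. \<Oplus>Y\<in>?P. F X \<otimes> G Y)"
      by (intro fs_cong fs_rdistr[OF finZ] fs_closed) (use F G in auto)
    finally have "sg R (odd (card Z)) ((\<Oplus>X\<in>?P. F X) \<otimes> (\<Oplus>Y\<in>?P. G Y)) =
        sg R (odd (card Z)) (\<Oplus>X\<in>?P. \<Oplus>Y\<in>?P. F X \<otimes> G Y)" by simp
    also have "\<dots> = (\<Oplus>X\<in>?P. sg R (odd (card Z)) (\<Oplus>Y\<in>?P. F X \<otimes> G Y))"
      by (rule sg_finsum[OF finZ]) (use F G in \<open>auto intro!: fs_closed\<close>)
    also have "\<dots> = (\<Oplus>X\<in>?P. \<Oplus>Y\<in>?P. ?s Z X Y)"
      by (intro fs_cong sg_finsum[OF finZ] fs_closed) (use F G in auto)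
    also have "\<dots> = (\<Oplus>X\<in>P. if Z \<subseteq> X then (\<Oplus>Y\<in>?P. ?s Z X Y) else \<zero>)"
      by (rule fs_filter[OF fin(1)]) (use s in \<open>auto intro!: fs_closed\<close>)
    also have "\<dots> = (\<Oplus>X\<in>P. \<Oplus>Y\<in>P. ?t Z X Y)"
    proof (rule fs_cong[OF refl])
      fix X assume X: "X \<in> P"
      show "(if Z \<subseteq> X then (\<Oplus>Y\<in>?P. ?s Z X Y) else \<zero>) = (\<Oplus>Y\<in>P. ?t Z X Y)"
      proof (cases "Z \<subseteq> X")
        case True
        have "(\<Oplus>Y\<in>?P. ?s Z X Y) = (\<Oplus>Y\<in>P. if Z \<subseteq> Y then ?s Z X Y else \<zero>)"
          by (rule fs_filter[OF fin(1)]) (use s X in auto)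
        then show ?thesis using True by simp
      next
        case False
        then show ?thesis by (simp add: fs_zero)
      qed
    qed (use t in \<open>auto intro!: fs_closed\<close>)
    finally show ?thesis .
  qed
  then have "(\<Oplus>Z\<in>Q. sg R (odd (card Z)) ((\<Oplus>X\<in>{X \<in> P. Z \<subseteq> X}. F X) \<otimes> (\<Oplus>Y\<in>{Y \<in> P. Z \<subseteq> Y}. G Y))) =
      (\<Oplus>Z\<in>Q. \<Oplus>X\<in>P. \<Oplus>Y\<in>P. ?t Z X Y)" by simp
  also have "\<dots> = (\<Oplus>X\<in>P. \<Oplus>Z\<in>Q. \<Oplus>Y\<in>P. ?t Z X Y)"
    by (rule fs_swap[OF fin(2,1)]) (intro fs_closed t)
  also have "\<dots> = (\<Oplus>X\<in>P. \<Oplus>Y\<in>P. \<Oplus>Z\<in>Q. ?t Z X Y)"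
    by (intro fs_cong fs_swap[OF fin(2,1)] fs_closed t refl)
  also have "\<dots> = (\<Oplus>X\<in>P. \<Oplus>Y\<in>P. if X \<inter> Y = {} then F X \<otimes> G Y else \<zero>)"
  proof (intro fs_cong refl)
    fix X Y assume XY: "X \<in> P" "Y \<in> P"
    have "(\<Oplus>Z\<in>Q. ?t Z X Y) = (\<Oplus>Z\<in>{Z \<in> Q. Z \<subseteq> X \<inter> Y}. ?s Z X Y)"
      by (rule fs_filter[symmetric, OF fin(2)]) (use s XY in auto)
    also have "{Z \<in> Q. Z \<subseteq> X \<inter> Y} = Pow (X \<inter> Y)" using sub[OF XY(1)] by auto
    also have "(\<Oplus>Z\<in>Pow (X \<inter> Y). ?s Z X Y) = (if X \<inter> Y = {} then F X \<otimes> G Y else \<zero>)"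
      by (rule alternating_sum) (use finP F G XY in auto)
    finally show "(\<Oplus>Z\<in>Q. ?t Z X Y) = (if X \<inter> Y = {} then F X \<otimes> G Y else \<zero>)" .
  qed (use F G in \<open>auto intro!: fs_closed\<close>)
  finally show ?thesis .
qed

end

section \<open>The permanent as a signed sum of products of superset sums\<close>

abbreviation layer :: "nat \<Rightarrow> nat \<Rightarrow> nat set set" where
  "layer n p \<equiv> {X. X \<subseteq> {1..n} \<and> card X = p}"

context ring_matrix
begin

text \<open>For odd \<open>m\<close> the middle row contributes the sum of its entries outside \<open>X \<union> Y\<close>,
  which separates into \<open>mid_all - mid_sum X - mid_sum Y\<close> for disjoint \<open>X\<close> and \<open>Y\<close>.\<close>

definition mid_sum :: "nat \<Rightarrow> nat set \<Rightarrow> 'a" where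
  "mid_sum m X = (if even m then \<zero> else (\<Oplus>x\<in>X. A (Suc (m div 2)) x))"

text \<open>For even \<open>m\<close> there is no middle row, and the values 1 and 0 make
  \<open>mid_all - mid_sum X - mid_sum Y\<close> the empty product.\<close>

definition mid_all :: "nat \<Rightarrow> nat \<Rightarrow> 'a" where
  "mid_all m n = (if even m then \<one> else (\<Oplus>x\<in>{1..n}. A (Suc (m div 2)) x))"

definition top_part :: "nat \<Rightarrow> nat set \<Rightarrow> 'a" where
  "top_part m X = V [1..<Suc (m div 2)] X"

definition bottom_part :: "nat \<Rightarrow> nat set \<Rightarrow> 'a" where
  "bottom_part m X = V [Suc m - m div 2..<Suc m] X"

lemma parts_closed [simp]: "mid_sum m X \<in> carrier R" "mid_all m n \<in> carrier R"
    "top_part m X \<in> carrier R" "bottom_part m X \<in> carrier R"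
  by (auto simp: mid_sum_def mid_all_def top_part_def bottom_part_def intro!: fs_closed)

text \<open>The middle factor is distributed so that each summand is a function of \<open>X\<close>
  times a function of \<open>Y\<close>: what depends on \<open>Y\<close>, and the constant, joins
  the bottom part from the left, while \<open>mid_sum X\<close> joins the top part from the right in
  \<open>top_mid\<close>. This respects the order of the rows.\<close>

definition mid_bottom :: "nat \<Rightarrow> nat \<Rightarrow> nat set \<Rightarrow> 'a" where
  "mid_bottom m n Y = mid_all m n \<otimes> bottom_part m Y \<ominus> mid_sum m Y \<otimes> bottom_part m Y"

definition top_mid :: "nat \<Rightarrow> nat set \<Rightarrow> 'a" where
  "top_mid m X = \<ominus> (top_part m X \<otimes> mid_sum m X)"

lemma products_closed [simp]: "mid_bottom m n Y \<in> carrier R" "top_mid m X \<in> carrier R"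
  by (simp_all add: mid_bottom_def top_mid_def)

text \<open>Expanding the first \<open>m div 2\<close> rows from the left and the last
  \<open>m div 2\<close> rows from the right leaves the middle row, if any, on the columns outside
  \<open>X\<close> and \<open>Y\<close>. Choosing \<open>Y\<close> within the complement of
  \<open>X\<close> is then rewritten as a condition on pairs from full layers, as needed for
  inclusion-exclusion.\<close>

lemma per_disjoint_pairs:
  "per R m n A = (\<Oplus>X\<in>layer n (m div 2). \<Oplus>Y\<in>layer n (m div 2).
     if X \<inter> Y = {} then top_part m X \<otimes> mid_bottom m n Y \<oplus> top_mid m X \<otimes> bottom_part m Y else \<zero>)"
proof -
  define p where "p = m div 2"
  define cs where "cs = (if even m then [] else [Suc p])"
  define js where "js = [Suc m - p..<Suc m]"
  have rows: "[1..<Suc m] = [1..<Suc p] @ cs @ js"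
  proof (cases "even m")
    case True
    then have "Suc m - p = Suc p" by (auto simp: p_def)
    moreover have "[1..<Suc m] = [1..<Suc p] @ [Suc p..<Suc m]"
      using upt_add_eq_append[of 1 "Suc p" "m - p"] by (simp add: p_def del: upt_Suc)
    ultimately show ?thesis using True by (simp add: cs_def js_def del: upt_Suc)
  next
    case False
    then have "Suc m - p = Suc (Suc p)" by (auto simp: p_def elim!: oddE)
    moreover have "[1..<Suc m] = [1..<Suc p] @ [Suc p..<Suc m]"
      using upt_add_eq_append[of 1 "Suc p" "m - p"] by (simp add: p_def del: upt_Suc)
    moreover have "[Suc p..<Suc m] = Suc p # [Suc (Suc p)..<Suc m]"
      using False by (intro upt_conv_Cons) (auto simp: p_def elim!: oddE)
    ultimately show ?thesis using False by (simp add: cs_def js_def del: upt_Suc)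
  qed
  have len: "length [1..<Suc p] = p" "length js = p" by (auto simp: js_def p_def simp del: upt_Suc)
  have mid: "V cs ({1..n} - X - Y) = mid_all m n \<ominus> mid_sum m X \<ominus> mid_sum m Y"
    if "X \<subseteq> {1..n}" "Y \<subseteq> {1..n}" "X \<inter> Y = {}" for X Y
  proof (cases "even m")
    case True
    then show ?thesis by (simp add: cs_def mid_all_def mid_sum_def minus_eq)
  next
    case False
    let ?a = "A (Suc p)"
    have fin: "finite X" "finite Y"
      using finite_subset[OF that(1)] finite_subset[OF that(2)] by simp_all
    have U: "{1..n} = ({1..n} - X - Y) \<union> (X \<union> Y)" using that by auto
    have "finsum R ?a {1..n} = finsum R ?a (({1..n} - X - Y) \<union> (X \<union> Y))" using U by simp
    also have "\<dots> = finsum R ?a ({1..n} - X - Y) \<oplus> finsum R ?a (X \<union> Y)"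
      by (rule fs_Un) (use fin in auto)
    also have "finsum R ?a (X \<union> Y) = finsum R ?a X \<oplus> finsum R ?a Y"
      by (rule fs_Un) (use fin that in auto)
    finally have eq: "finsum R ?a {1..n} = finsum R ?a ({1..n} - X - Y) \<oplus> (finsum R ?a X \<oplus> finsum R ?a Y)" .
    have cl: "finsum R ?a Z \<in> carrier R" for Z by (rule fs_closed) simp
    have "w = (w \<oplus> (x \<oplus> y)) \<ominus> x \<ominus> y" if "w \<in> carrier R" "x \<in> carrier R" "y \<in> carrier R" for w x y
      using that by algebra
    from this[OF cl cl cl] show ?thesis
      using False eq by (simp add: cs_def mid_all_def mid_sum_def p_def)
  qed
  have term_eq: "top_part m X \<otimes> (V cs ({1..n} - X - Y) \<otimes> V js Y) =
      top_part m X \<otimes> mid_bottom m n Y \<oplus> top_mid m X \<otimes> bottom_part m Y"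
    if "X \<subseteq> {1..n}" "Y \<subseteq> {1..n}" "X \<inter> Y = {}" for X Y
  proof -
    have "f \<otimes> ((a \<ominus> b \<ominus> c) \<otimes> g) = f \<otimes> (a \<otimes> g \<ominus> c \<otimes> g) \<oplus> (\<ominus> (f \<otimes> b)) \<otimes> g"
      if "f \<in> carrier R" "a \<in> carrier R" "b \<in> carrier R" "c \<in> carrier R" "g \<in> carrier R" for f a b c g
      using that by (simp add: minus_eq l_distr r_distr l_minus r_minus m_assoc a_ac)
    then show ?thesis
      unfolding mid[OF that] by (simp add: mid_bottom_def top_mid_def bottom_part_def js_def p_def del: upt_Suc)
  qed
  have "per R m n A = (\<Oplus>X\<in>layer n p. top_part m X \<otimes> V (cs @ js) ({1..n} - X))"
    unfolding per_eq_V rows by (subst V_append_left) (simp_all add: len top_part_def p_def del: upt_Suc)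
  also have "\<dots> = (\<Oplus>X\<in>layer n p. \<Oplus>Y\<in>layer n p.
      if X \<inter> Y = {} then top_part m X \<otimes> mid_bottom m n Y \<oplus> top_mid m X \<otimes> bottom_part m Y else \<zero>)"
  proof (rule fs_cong[OF refl])
    fix X assume X: "X \<in> layer n p"
    let ?S = "{Y. Y \<subseteq> {1..n} - X \<and> card Y = p}"
    have S: "?S = {Y \<in> layer n p. X \<inter> Y = {}}" by auto
    have "top_part m X \<otimes> V (cs @ js) ({1..n} - X) =
        top_part m X \<otimes> (\<Oplus>Y\<in>?S. V cs ({1..n} - X - Y) \<otimes> V js Y)"
      by (subst V_append_right) (simp_all add: len)
    also have "\<dots> = (\<Oplus>Y\<in>?S. top_part m X \<otimes> (V cs ({1..n} - X - Y) \<otimes> V js Y))"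
      by (rule fs_rdistr) auto
    also have "\<dots> = (\<Oplus>Y\<in>?S. top_part m X \<otimes> mid_bottom m n Y \<oplus> top_mid m X \<otimes> bottom_part m Y)"
      by (intro fs_cong refl term_eq) (use X in auto)
    also have "\<dots> = (\<Oplus>Y\<in>layer n p.
      if X \<inter> Y = {} then top_part m X \<otimes> mid_bottom m n Y \<oplus> top_mid m X \<otimes> bottom_part m Y else \<zero>)"
      unfolding S by (rule fs_filter) auto
    finally show "top_part m X \<otimes> V (cs @ js) ({1..n} - X) = \<dots>" .
  qed (auto intro!: fs_closed)
  finally show ?thesis by (simp add: p_def)
qed

text \<open>The two separated summands are transformed independently, which is why four superset
  sums are needed.\<close>

lemma per_inclusion_exclusion:
  fixes m n :: nat
  defines "up \<equiv> \<lambda>h Z. \<Oplus>X\<in>{X \<in> layer n (m div 2). Z \<subseteq> X}. h X"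
  defines "Q \<equiv> subsets_upto n (m div 2)"
  shows "per R m n A =
    (\<Oplus>Z\<in>Q. sg R (odd (card Z)) (up (top_part m) Z \<otimes> up (mid_bottom m n) Z)) \<oplus>
    (\<Oplus>Z\<in>Q. sg R (odd (card Z)) (up (top_mid m) Z \<otimes> up (bottom_part m) Z))"
proof -
  let ?L = "layer n (m div 2)"
  have IE: "(\<Oplus>Z\<in>Q. sg R (odd (card Z)) (up F Z \<otimes> up G Z)) =
      (\<Oplus>X\<in>?L. \<Oplus>Y\<in>?L. if X \<inter> Y = {} then F X \<otimes> G Y else \<zero>)"
    if "\<And>X. F X \<in> carrier R" "\<And>X. G X \<in> carrier R" for F G
    unfolding up_def
  proof (rule inclusion_exclusion)
    fix X Z assume X: "X \<in> ?L" "Z \<subseteq> X"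
    then have "card Z \<le> card X" by (intro card_mono) (auto intro: finite_subset)
    then show "Z \<in> Q" using X by (auto simp: Q_def subsets_upto_def)
  qed (use that finite_subset in \<open>auto simp: Q_def\<close>)
  have "per R m n A = (\<Oplus>X\<in>?L. \<Oplus>Y\<in>?L.
      (if X \<inter> Y = {} then top_part m X \<otimes> mid_bottom m n Y else \<zero>) \<oplus>
      (if X \<inter> Y = {} then top_mid m X \<otimes> bottom_part m Y else \<zero>))"
    unfolding per_disjoint_pairs by (intro fs_cong refl fs_closed) auto
  also have "\<dots> = (\<Oplus>X\<in>?L. (\<Oplus>Y\<in>?L. if X \<inter> Y = {} then top_part m X \<otimes> mid_bottom m n Y else \<zero>) \<oplus>
      (\<Oplus>Y\<in>?L. if X \<inter> Y = {} then top_mid m X \<otimes> bottom_part m Y else \<zero>))"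
    by (intro fs_cong refl fs_add a_closed fs_closed) auto
  also have "\<dots> = (\<Oplus>X\<in>?L. \<Oplus>Y\<in>?L. if X \<inter> Y = {} then top_part m X \<otimes> mid_bottom m n Y else \<zero>) \<oplus>
      (\<Oplus>X\<in>?L. \<Oplus>Y\<in>?L. if X \<inter> Y = {} then top_mid m X \<otimes> bottom_part m Y else \<zero>)"
    by (rule fs_add) (auto intro!: fs_closed)
  finally show ?thesis by (simp add: IE)
qed

end

text \<open>In-place summation over supersets: step \<open>j\<close> adds the entry at \<open>insert j Z\<close> to the one at \<open>Z\<close>.
  The pairs \<open>(insert j Z, j)\<close> are marked sets, so there are at most \<open>p * card (subsets_upto n p)\<close>
  additions rather than \<open>n * card (subsets_upto n p)\<close>.\<close>

definition zeta_step :: "nat \<Rightarrow> nat \<Rightarrow> nat \<Rightarrow> nat \<Rightarrow> (nat \<times> nat set) instr list" where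
  "zeta_step t n p j = accum_all (\<lambda>_. False) (\<lambda>Z. (t, Z)) (\<lambda>Z. Var (t, insert j Z)) (\<lambda>_. One)
     {Z. Z \<subseteq> {1..n} \<and> card Z < p \<and> j \<notin> Z}"

definition zeta :: "nat \<Rightarrow> nat \<Rightarrow> nat \<Rightarrow> (nat \<times> nat set) instr list" where
  "zeta t n p = concat (map (zeta_step t n p) [1..<Suc n])"

lemma finite_zeta_index [simp]: "finite U \<Longrightarrow> finite {Z. Z \<subseteq> U \<and> card Z < p \<and> j \<notin> Z}"
  by (rule finite_subset[of _ "Pow U"]) auto

lemma accums_zeta: "accums (zeta t n p) \<le> p * card (subsets_upto n p)"
proof -
  let ?I = "\<lambda>j. {Z. Z \<subseteq> {1..n} \<and> card Z < p \<and> j \<notin> Z}"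
  have fin: "finite Z" if "Z \<subseteq> {1..n}" for Z using finite_subset[OF that] by simp
  have "accums (zeta t n p) = (\<Sum>j\<in>{1..<Suc n}. card (?I j))"
    by (simp add: zeta_def zeta_step_def o_def interv_sum_list_conv_sum_set_nat
        del: upt_Suc One_nat_def)
  also have "\<dots> = card (Sigma {1..<Suc n} ?I)"
    by (rule card_SigmaI[symmetric]) simp_all
  also have "\<dots> \<le> card (Sigma (subsets_upto n p) (\<lambda>Z. Z))"
  proof (rule card_inj_on_le[where f = "\<lambda>(j, Z). (insert j Z, j)"])
    show "inj_on (\<lambda>(j, Z). (insert j Z, j)) (Sigma {1..<Suc n} ?I)"
      by (rule inj_onI) (clarsimp simp: insert_ident)
    show "(\<lambda>(j, Z). (insert j Z, j)) ` Sigma {1..<Suc n} ?I \<subseteq> Sigma (subsets_upto n p) (\<lambda>Z. Z)"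
      using fin by (auto simp: subsets_upto_def)
    show "finite (Sigma (subsets_upto n p) (\<lambda>Z. Z))"
      by (rule finite_SigmaI) (auto simp: subsets_upto_def fin)
  qed
  also have "\<dots> = (\<Sum>Z\<in>subsets_upto n p. card Z)"
    by (rule card_SigmaI) (auto simp: subsets_upto_def fin)
  also have "\<dots> \<le> (\<Sum>Z\<in>subsets_upto n p. p)"
    by (rule sum_mono) (simp add: subsets_upto_def)
  finally show ?thesis by (simp add: mult.commute)
qed

lemma prog_ok_zeta:
  assumes "{t} \<times> subsets_upto n p \<subseteq> D"
  shows "prog_ok m n D (zeta t n p)"
proof -
  have *: "(t, X) \<in> D" if "X \<subseteq> {1..n}" "card X \<le> p" for X
    using assms that by (auto simp: subsets_upto_def)
  have "(t, insert j Z) \<in> D" if "Z \<subseteq> {1..n}" "card Z < p" "j \<in> {1..n}" for Z j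
    by (rule *) (use that card_insert_le_m1[of p Z j] in auto)
  then have "prog_ok m n D (zeta_step t n p j)" if "j \<in> {1..n}" for j
    using that unfolding zeta_step_def by (auto intro!: *)
  then show ?thesis by (auto simp: zeta_def simp del: upt_Suc)
qed

section \<open>Correctness of the in-place summation over supersets\<close>

context ring_matrix
begin

text \<open>After step \<open>j\<close> the cell at \<open>Z\<close> has collected the sets
  \<open>X\<close> of size \<open>p\<close> that arise from \<open>Z\<close> by adding elements of
  \<open>{1..j}\<close>; the next step also admits those containing \<open>Suc j\<close>. For
  \<open>j = 0\<close> only \<open>X = Z\<close> remains, so the table must vanish off size
  \<open>p\<close> at the start.\<close>

lemma exec_zeta_aux:
  assumes f: "\<And>c. f c \<in> carrier R" and zero: "\<And>X. card X \<noteq> p \<Longrightarrow> f (t, X) = \<zero>" and "j \<le> n"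
  shows "exec R A (concat (map (zeta_step t n p) [1..<Suc j])) f c =
    (if fst c = t \<and> snd c \<in> subsets_upto n p
     then (\<Oplus>X\<in>{X \<in> layer n p. snd c \<subseteq> X \<and> X - snd c \<subseteq> {1..j}}. f (t, X)) else f c)"
  using assms(3)
proof (induction j arbitrary: c)
  case 0
  show ?case
  proof (cases "fst c = t \<and> snd c \<in> subsets_upto n p")
    case True
    then have c: "c = (t, snd c)" by (cases c) auto
    have "{X \<in> layer n p. snd c \<subseteq> X \<and> X - snd c \<subseteq> {1..0}} = (if card (snd c) = p then {snd c} else {})"
      using True by (auto simp: subsets_upto_def)
    then show ?thesis using True zero[of "snd c"] f[of c] c by (auto simp: fs_single)
  qed auto
next
  case (Suc j)
  define g where "g = exec R A (concat (map (zeta_step t n p) [1..<Suc j])) f"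
  let ?S = "\<lambda>j Z. {X \<in> layer n p. Z \<subseteq> X \<and> X - Z \<subseteq> {1..j}}"
  have g: "g c = (if fst c = t \<and> snd c \<in> subsets_upto n p then (\<Oplus>X\<in>?S j (snd c). f (t, X)) else f c)" for c
    using Suc by (simp add: g_def)
  have gc: "g c \<in> carrier R" for c unfolding g using f by (auto intro!: fs_closed)
  let ?I = "{Z. Z \<subseteq> {1..n} \<and> card Z < p \<and> Suc j \<notin> Z}"
  let ?h = "exec R A (zeta_step t n p (Suc j)) g"
  have "exec R A (concat (map (zeta_step t n p) [1..<Suc (Suc j)])) f c = ?h c"
    by (simp add: g_def)
  also have "\<dots> = (if fst c = t \<and> snd c \<in> subsets_upto n p then (\<Oplus>X\<in>?S (Suc j) (snd c). f (t, X)) else f c)"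
  proof (cases "fst c = t \<and> snd c \<in> ?I")
    case True
    then obtain Z where c: "c = (t, Z)" "Z \<in> ?I" by (cases c) auto
    \<comment> \<open>Every cell read belongs to a set containing \<open>Suc j\<close>, every cell
      written to a set without it; this makes the update in place safe.\<close>
    have indep: "Var (t, insert (Suc j) i) \<noteq> Var (t, j')" "One \<noteq> Var (t, j')" if "j' \<in> ?I" for i j'
      using that by auto
    have "?h (t, Z) = g (t, Z) \<oplus> sg R False (aval R A g (Var (t, insert (Suc j) Z)) \<otimes> aval R A g One)"
      unfolding zeta_step_def
      by (rule exec_accum_all_inj(1)) (use c gc indep ring_axioms in \<open>auto simp: inj_on_def\<close>)
    then have h: "?h c = g (t, Z) \<oplus> g (t, insert (Suc j) Z)" using gc c by simp
    have Z: "Z \<subseteq> {1..n}" "card Z < p" "Suc j \<notin> Z" "Z \<in> subsets_upto n p"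
      using c(2) by (auto simp: subsets_upto_def)
    have fin: "finite (?S i Y)" for i Y by (rule finite_subset[of _ "layer n p"]) auto
    have iZ: "insert (Suc j) Z \<in> subsets_upto n p"
      using Z finite_subset[OF Z(1)] Suc.prems by (simp add: subsets_upto_def)
    have "?S (Suc j) Z = ?S j Z \<union> ?S j (insert (Suc j) Z)"
    proof (intro equalityI subsetI)
      fix X assume X: "X \<in> ?S (Suc j) Z"
      show "X \<in> ?S j Z \<union> ?S j (insert (Suc j) Z)"
      proof (cases "Suc j \<in> X")
        case True
        then show ?thesis using X by (auto simp: le_Suc_eq)
      next
        case False
        have "x \<le> j" if "x \<in> X - Z" for x
        proof -
          have "x \<le> Suc j" using X that by auto
          moreover have "x \<noteq> Suc j" using False that by auto
          ultimately show ?thesis by simp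
        qed
        then show ?thesis using X by auto
      qed
    next
      fix X assume "X \<in> ?S j Z \<union> ?S j (insert (Suc j) Z)"
      then show "X \<in> ?S (Suc j) Z"
      proof
        assume X: "X \<in> ?S j Z"
        then have "X - Z \<subseteq> {1..Suc j}" by fastforce
        then show ?thesis using X by blast
      next
        assume X: "X \<in> ?S j (insert (Suc j) Z)"
        then have "X - Z \<subseteq> {1..Suc j}" by fastforce
        then show ?thesis using X by blast
      qed
    qed
    moreover have "?S j Z \<inter> ?S j (insert (Suc j) Z) = {}" using Z(3) by fastforce
    ultimately have "(\<Oplus>X\<in>?S (Suc j) Z. f (t, X)) =
        (\<Oplus>X\<in>?S j Z. f (t, X)) \<oplus> (\<Oplus>X\<in>?S j (insert (Suc j) Z). f (t, X))"
      by (simp only:) (rule fs_Un[OF fin fin], use f in auto)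
    then show ?thesis using h Z(4) iZ c by (simp add: g)
  next
    case False
    have "?h c = g c"
      unfolding zeta_step_def
      by (rule exec_accum_all_inj(2)) (use False gc ring_axioms in \<open>auto simp: inj_on_def\<close>)
    moreover have "?S (Suc j) (snd c) = ?S j (snd c)" if c: "fst c = t" "snd c \<in> subsets_upto n p"
    proof (cases "Suc j \<in> snd c")
      case True
      then show ?thesis by (auto simp: le_Suc_eq)
    next
      case Sj: False
      \<comment> \<open>A set of full size has no other superset of size \<open>p\<close>, so the
        step may skip it.\<close>
      then have "card (snd c) = p" using False c by (auto simp: subsets_upto_def)
      then have "X = snd c" if "X \<in> layer n p" "snd c \<subseteq> X" for X
        using that card_subset_eq[of X "snd c"] finite_subset[of X "{1..n}"] by auto
      then show ?thesis by auto
    qed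
    ultimately show ?thesis by (simp add: g)
  qed
  finally show ?case .
qed

lemma exec_zeta:
  assumes "\<And>c. f c \<in> carrier R" "\<And>X. card X \<noteq> p \<Longrightarrow> f (t, X) = \<zero>"
  shows "exec R A (zeta t n p) f c = (if fst c = t \<and> snd c \<in> subsets_upto n p
     then (\<Oplus>X\<in>{X \<in> layer n p. snd c \<subseteq> X}. f (t, X)) else f c)"
proof -
  have "{X \<in> layer n p. snd c \<subseteq> X \<and> X - snd c \<subseteq> {1..n}} = {X \<in> layer n p. snd c \<subseteq> X}"
    by auto
  then show ?thesis unfolding zeta_def using exec_zeta_aux[of f p t n n c] assms by simp
qed

end

text \<open>Tags of the cells: 0 and 1 for the top and bottom parts, 2 for \<open>mid_sum\<close>, 3 to 6 for \<open>top_mid\<close>,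
  \<open>mid_bottom\<close>, \<open>top_part\<close>, \<open>bottom_part\<close> and their sums over supersets, 7 for \<open>mid_all\<close>, 8 for the result.\<close>

definition fill :: "nat \<Rightarrow> nat \<Rightarrow> nat \<Rightarrow> bool \<Rightarrow> (nat set \<Rightarrow> (nat \<times> nat set) arg) \<Rightarrow>
    (nat set \<Rightarrow> (nat \<times> nat set) arg) \<Rightarrow> (nat \<times> nat set) instr list" where
  "fill n p t b x y = accum_all (\<lambda>_. b) (\<lambda>X. (t, X)) x y (layer n p)"

definition mid_prog :: "nat \<Rightarrow> nat \<Rightarrow> (nat \<times> nat set) instr list" where
  "mid_prog m n = (if even m then [Load (7, {}) One] else
     accum_all (\<lambda>_. False) (\<lambda>_. (7, {})) (\<lambda>x. Inp (Suc (m div 2)) x) (\<lambda>_. One) {1..n} @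
     accum_all (\<lambda>_. False) (\<lambda>(X, x). (2, X)) (\<lambda>(X, x). Inp (Suc (m div 2)) x) (\<lambda>_. One)
       {(X, x). X \<subseteq> {1..n} \<and> card X = m div 2 \<and> x \<in> X})"

text \<open>The tables with tags 0 and 1 also hold the permanents on smaller sets. Summation over
  supersets must start from values supported on size \<open>p\<close>, hence the copies of the top
  layer under tags 5 and 6.\<close>

definition parts_prog :: "nat \<Rightarrow> nat \<Rightarrow> (nat \<times> nat set) instr list" where
  "parts_prog m n = dp 0 (m div 2) n (m div 2) @ dp 1 m n (m div 2) @ mid_prog m n @
     fill n (m div 2) 3 True (\<lambda>X. Var (0, X)) (\<lambda>X. Var (2, X)) @
     fill n (m div 2) 4 False (\<lambda>X. Var (7, {})) (\<lambda>X. Var (1, X)) @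
     fill n (m div 2) 4 True (\<lambda>X. Var (2, X)) (\<lambda>X. Var (1, X)) @
     fill n (m div 2) 5 False (\<lambda>X. Var (0, X)) (\<lambda>_. One) @
     fill n (m div 2) 6 False (\<lambda>X. Var (1, X)) (\<lambda>_. One)"

definition combine :: "nat \<Rightarrow> nat \<Rightarrow> nat \<Rightarrow> nat \<Rightarrow> (nat \<times> nat set) instr list" where
  "combine n p t u = accum_all (\<lambda>Z. odd (card Z)) (\<lambda>_. (8, {})) (\<lambda>Z. Var (t, Z)) (\<lambda>Z. Var (u, Z))
     (subsets_upto n p)"

definition ring_prog :: "nat \<Rightarrow> nat \<Rightarrow> (nat \<times> nat set) instr list" where
  "ring_prog m n = parts_prog m n @
     zeta 3 n (m div 2) @ zeta 4 n (m div 2) @ zeta 5 n (m div 2) @ zeta 6 n (m div 2) @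
     combine n (m div 2) 5 4 @ combine n (m div 2) 3 6"

section \<open>The values computed by the program for rings\<close>

context ring_matrix
begin

lemma exec_closed_ring: "(\<And>c. f c \<in> carrier R) \<Longrightarrow> exec R A p f c \<in> carrier R"
  by (rule exec_closed) (use ring_axioms in auto)

lemma exec_fill:
  assumes "\<And>c. f c \<in> carrier R" "\<And>X Y. x X \<noteq> Var (t, Y)" "\<And>X Y. y X \<noteq> Var (t, Y)"
  shows "exec R A (fill n p t b x y) f c = (if fst c = t \<and> snd c \<in> layer n p
     then f c \<oplus> sg R b (aval R A f (x (snd c)) \<otimes> aval R A f (y (snd c))) else f c)"
proof (cases "fst c = t \<and> snd c \<in> layer n p")
  case True
  then have c: "c = (t, snd c)" by (cases c) auto
  have "exec R A (fill n p t b x y) f (t, snd c) =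
      f (t, snd c) \<oplus> sg R b (aval R A f (x (snd c)) \<otimes> aval R A f (y (snd c)))"
    unfolding fill_def
    by (rule exec_accum_all_inj(1)) (use True assms ring_axioms in \<open>auto simp: inj_on_def\<close>)
  then show ?thesis using True c by simp
next
  case False
  then have "c \<notin> (\<lambda>X. (t, X)) ` layer n p" by auto
  then have "exec R A (fill n p t b x y) f c = f c"
    unfolding fill_def
    by (rule exec_accum_all_inj(2)[rotated -1]) (use assms ring_axioms in \<open>auto simp: inj_on_def\<close>)
  then show ?thesis by (simp only: if_not_P[OF False])
qed

lemma exec_mid_prog:
  assumes f: "\<And>c. f c \<in> carrier R" and zero: "\<And>X. f (2, X) = \<zero>" "f (7, {}) = \<zero>"
  shows "exec R A (mid_prog m n) f (7, {}) = mid_all m n"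
    and "X \<in> layer n (m div 2) \<Longrightarrow> exec R A (mid_prog m n) f (2, X) = mid_sum m X"
    and "fst c \<noteq> 2 \<Longrightarrow> fst c \<noteq> 7 \<Longrightarrow> exec R A (mid_prog m n) f c = f c"
proof -
  let ?a = "A (Suc (m div 2))" and ?L = "layer n (m div 2)"
  let ?I = "{(X, x). X \<subseteq> {1..n} \<and> card X = m div 2 \<and> x \<in> X}"
  define f1 where "f1 = exec R A (accum_all (\<lambda>_. False) (\<lambda>_. (7 :: nat, {} :: nat set))
      (\<lambda>x. Inp (Suc (m div 2)) x) (\<lambda>_. One) {1..n}) f"
  have f1c: "f1 c \<in> carrier R" for c unfolding f1_def by (rule exec_closed_ring[OF f])
  have f1: "f1 c = f c \<oplus> (\<Oplus>x\<in>{x \<in> {1..n}. (7, {}) = c}. ?a x)" for c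
    unfolding f1_def by (subst exec_accum_all) (use f in auto)
  have f1_other: "f1 c = f c" if "c \<noteq> (7, {})" for c
  proof -
    have "{x \<in> {1..n}. (7, {}) = c} = {}" using that by auto
    then show ?thesis using f by (simp only: f1 finsum_empty r_zero)
  qed
  define f2 where "f2 = exec R A (accum_all (\<lambda>_. False) (\<lambda>(X, x). (2, X)) (\<lambda>(X, x). Inp (Suc (m div 2)) x)
      (\<lambda>_. One) ?I) f1"
  have finI: "finite ?I" by simp
  have f2: "f2 c = f1 c \<oplus> (\<Oplus>z\<in>{z \<in> ?I. (case z of (X, x) \<Rightarrow> (2, X)) = c}. ?a (snd z))" for c
    unfolding f2_def by (subst exec_accum_all[OF finI f1c]) (auto simp: case_prod_unfold)
  have f2_other: "f2 c = f1 c" if "\<not> (fst c = 2 \<and> snd c \<in> ?L)" for c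
  proof -
    have "{z \<in> ?I. (case z of (X, x) \<Rightarrow> (2, X)) = c} = {}" using that by auto
    then show ?thesis using f1c by (simp only: f2 finsum_empty r_zero)
  qed
  have f2_mid: "f2 (2, X) = finsum R ?a X" if X: "X \<in> ?L" for X
  proof -
    have "{z \<in> ?I. (case z of (X, x) \<Rightarrow> (2 :: nat, X)) = (2, X)} = Pair X ` X" using X by auto
    then have "f2 (2, X) = f1 (2, X) \<oplus> (\<Oplus>z\<in>Pair X ` X. ?a (snd z))" by (simp only: f2)
    also have "(\<Oplus>z\<in>Pair X ` X. ?a (snd z)) = finsum R ?a X"
      by (subst finsum_reindex) (auto simp: inj_on_def)
    finally show ?thesis using f1_other[of "(2, X)"] zero(1) by (simp add: fs_closed)
  qed
  have odd: "exec R A (mid_prog m n) f = f2" if "odd m"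
    using that by (simp add: mid_prog_def f1_def f2_def)
  show "exec R A (mid_prog m n) f (7, {}) = mid_all m n"
  proof (cases "even m")
    case False
    have "f2 (7, {}) = f1 (7, {})" by (rule f2_other) simp
    also have "\<dots> = finsum R ?a {1..n}"
      using zero(2) by (simp add: f1 fs_closed flip: atLeastAtMost_iff)
    finally show ?thesis using False odd by (simp add: mid_all_def)
  qed (simp add: mid_prog_def mid_all_def)
  show "exec R A (mid_prog m n) f (2, X) = mid_sum m X" if "X \<in> ?L"
  proof (cases "even m")
    case False
    then show ?thesis using odd f2_mid[OF that] by (simp add: mid_sum_def)
  qed (simp add: mid_prog_def mid_sum_def zero)
  show "exec R A (mid_prog m n) f c = f c" if "fst c \<noteq> 2" "fst c \<noteq> 7"
  proof (cases "even m")
    case False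
    have "f2 c = f1 c" by (rule f2_other) (use that in simp)
    moreover have "f1 c = f c" by (rule f1_other) (use that in auto)
    ultimately show ?thesis using False odd by simp
  next
    case True
    then show ?thesis using that by (cases c) (simp add: mid_prog_def)
  qed
qed

lemma exec_parts_prog:
  fixes m n :: nat
  defines "N \<equiv> exec R A (parts_prog m n) (\<lambda>_. \<zero>)"
  shows "X \<in> layer n (m div 2) \<Longrightarrow> N (3, X) = top_mid m X"
    and "X \<in> layer n (m div 2) \<Longrightarrow> N (4, X) = mid_bottom m n X"
    and "X \<in> layer n (m div 2) \<Longrightarrow> N (5, X) = top_part m X"
    and "X \<in> layer n (m div 2) \<Longrightarrow> N (6, X) = bottom_part m X"
    and "X \<notin> layer n (m div 2) \<Longrightarrow> t \<in> {3, 4, 5, 6} \<Longrightarrow> N (t, X) = \<zero>"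
    and "N (8, {}) = \<zero>"
proof -
  let ?p = "m div 2" and ?L = "layer n (m div 2)"
  define f1 where "f1 = exec R A (dp 0 ?p n ?p) (\<lambda>_. \<zero>)"
  define f2 where "f2 = exec R A (dp 1 m n ?p) f1"
  define f3 where "f3 = exec R A (mid_prog m n) f2"
  define g1 where "g1 = exec R A (fill n ?p 3 True (\<lambda>X. Var (0, X)) (\<lambda>X. Var (2, X))) f3"
  define g2 where "g2 = exec R A (fill n ?p 4 False (\<lambda>X. Var (7, {})) (\<lambda>X. Var (1, X))) g1"
  define g3 where "g3 = exec R A (fill n ?p 4 True (\<lambda>X. Var (2, X)) (\<lambda>X. Var (1, X))) g2"
  define g4 where "g4 = exec R A (fill n ?p 5 False (\<lambda>X. Var (0, X)) (\<lambda>_. One)) g3"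
  define g5 where "g5 = exec R A (fill n ?p 6 False (\<lambda>X. Var (1, X)) (\<lambda>_. One)) g4"
  have N: "N = g5"
    by (simp add: N_def parts_prog_def f1_def f2_def f3_def g1_def g2_def g3_def g4_def g5_def)
  have c1: "f1 c \<in> carrier R" for c unfolding f1_def by (rule exec_closed_ring) simp
  have c2: "f2 c \<in> carrier R" for c unfolding f2_def by (rule exec_closed_ring[OF c1])
  have c3: "f3 c \<in> carrier R" for c unfolding f3_def by (rule exec_closed_ring[OF c2])
  have d1: "g1 c \<in> carrier R" for c unfolding g1_def by (rule exec_closed_ring[OF c3])
  have d2: "g2 c \<in> carrier R" for c unfolding g2_def by (rule exec_closed_ring[OF d1])
  have d3: "g3 c \<in> carrier R" for c unfolding g3_def by (rule exec_closed_ring[OF d2])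
  have d4: "g4 c \<in> carrier R" for c unfolding g4_def by (rule exec_closed_ring[OF d3])
  have f1: "f1 c = (if fst c = 0 \<and> snd c \<in> subsets_upto n ?p
      then V [Suc ?p - card (snd c)..<Suc ?p] (snd c) else \<zero>)" for c
    unfolding f1_def by (subst exec_dp) auto
  have f2: "f2 c = (if fst c = 1 \<and> snd c \<in> subsets_upto n ?p
      then V [Suc m - card (snd c)..<Suc m] (snd c) else f1 c)" for c
    unfolding f2_def by (subst exec_dp[OF _ c1]) (simp_all add: f1)
  have L: "X \<in> ?L \<Longrightarrow> X \<in> subsets_upto n ?p \<and> card X = ?p" for X by (simp add: subsets_upto_def)
  have f2_zero: "f2 c = \<zero>" if "fst c \<ge> 2" for c using that by (simp add: f2 f1)
  have f3_mid: "f3 (7, {}) = mid_all m n" "X \<in> ?L \<Longrightarrow> f3 (2, X) = mid_sum m X" for X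
    unfolding f3_def using exec_mid_prog(1,2)[where f = f2 and m = m and n = n, OF c2] f2_zero by auto
  have f3_other: "f3 c = f2 c" if "fst c \<noteq> 2" "fst c \<noteq> 7" for c
    unfolding f3_def using that f2_zero by (intro exec_mid_prog(3) c2) auto
  have f3_parts: "f3 (0, X) = top_part m X" "f3 (1, X) = bottom_part m X" if "X \<in> ?L" for X
    using L[OF that] by (simp_all add: f3_other f2 f1 top_part_def bottom_part_def del: upt_Suc)
  have f3_zero: "f3 c = \<zero>" if "fst c \<in> {3, 4, 5, 6, 8}" for c
    using that f3_other[of c] f2_zero[of c] by auto
  have g1: "g1 c = (if fst c = 3 \<and> snd c \<in> ?L
      then f3 c \<oplus> sg R True (f3 (0, snd c) \<otimes> f3 (2, snd c)) else f3 c)" for c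
    unfolding g1_def by (subst exec_fill[OF c3]) auto
  have g2: "g2 c = (if fst c = 4 \<and> snd c \<in> ?L
      then g1 c \<oplus> sg R False (g1 (7, {}) \<otimes> g1 (1, snd c)) else g1 c)" for c
    unfolding g2_def by (subst exec_fill[OF d1]) auto
  have g3: "g3 c = (if fst c = 4 \<and> snd c \<in> ?L
      then g2 c \<oplus> sg R True (g2 (2, snd c) \<otimes> g2 (1, snd c)) else g2 c)" for c
    unfolding g3_def by (subst exec_fill[OF d2]) auto
  have g4: "g4 c = (if fst c = 5 \<and> snd c \<in> ?L
      then g3 c \<oplus> sg R False (g3 (0, snd c) \<otimes> \<one>) else g3 c)" for c
    unfolding g4_def by (subst exec_fill[OF d3]) auto
  have g5: "g5 c = (if fst c = 6 \<and> snd c \<in> ?L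
      then g4 c \<oplus> sg R False (g4 (1, snd c) \<otimes> \<one>) else g4 c)" for c
    unfolding g5_def by (subst exec_fill[OF d4]) auto
  note g = N g5 g4 g3 g2 g1
  show "N (3, X) = top_mid m X" if "X \<in> ?L"
    using that f3_parts[OF that] f3_mid(2)[OF that]
    by (simp add: g f3_zero top_mid_def sg_def)
  show "N (4, X) = mid_bottom m n X" if "X \<in> ?L"
    using that f3_parts[OF that] f3_mid(1) f3_mid(2)[OF that]
    by (simp add: g f3_zero mid_bottom_def sg_def minus_eq)
  show "N (5, X) = top_part m X" if "X \<in> ?L"
    using that f3_parts[OF that] by (simp add: g f3_zero)
  show "N (6, X) = bottom_part m X" if "X \<in> ?L"
    using that f3_parts[OF that] by (simp add: g f3_zero)
  show "N (t, X) = \<zero>" if "X \<notin> ?L" "t \<in> {3, 4, 5, 6}"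
  proof -
    have "N (t, X) = f3 (t, X)" unfolding g using that(1) by (simp del: mem_Collect_eq)
    then show ?thesis using f3_zero[of "(t, X)"] that(2) by auto
  qed
  show "N (8, {}) = \<zero>" by (simp add: g f3_zero)
qed

lemma exec_combine:
  assumes "\<And>c. f c \<in> carrier R" "t \<noteq> 8" "u \<noteq> 8"
  shows "exec R A (combine n p t u) f c = (if c = (8, {})
    then f c \<oplus> (\<Oplus>Z\<in>subsets_upto n p. sg R (odd (card Z)) (f (t, Z) \<otimes> f (u, Z))) else f c)"
proof -
  have eq: "exec R A (combine n p t u) f c = f c \<oplus>
      (\<Oplus>Z\<in>{Z \<in> subsets_upto n p. (8, {}) = c}. sg R (odd (card Z)) (f (t, Z) \<otimes> f (u, Z)))"
    unfolding combine_def by (subst exec_accum_all) (use assms ring_axioms in auto)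
  show ?thesis
  proof (cases "c = (8, {})")
    case False
    then have "{Z \<in> subsets_upto n p. (8, {}) = c} = {}" by auto
    then show ?thesis using False eq assms(1) by (simp only: finsum_empty r_zero if_False)
  qed (use eq in simp)
qed

text \<open>Each superset summation changes only its own tag, so the four do not interfere. Tags 5
  and 4 then give the products of \<open>top_part\<close> with \<open>mid_bottom\<close>, tags 3 and
  6 those of \<open>top_mid\<close> with \<open>bottom_part\<close>.\<close>

lemma exec_ring_prog: "exec R A (ring_prog m n) (\<lambda>_. \<zero>) (8, {}) = per R m n A"
proof -
  let ?p = "m div 2"
  define N where "N = exec R A (parts_prog m n) (\<lambda>_. \<zero>)"
  note N = exec_parts_prog[where m = m and n = n, folded N_def]
  define z3 where "z3 = exec R A (zeta 3 n ?p) N"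
  define z4 where "z4 = exec R A (zeta 4 n ?p) z3"
  define z5 where "z5 = exec R A (zeta 5 n ?p) z4"
  define z6 where "z6 = exec R A (zeta 6 n ?p) z5"
  define r where "r = exec R A (combine n ?p 5 4) z6"
  have c: "N c \<in> carrier R" for c unfolding N_def by (rule exec_closed_ring) simp
  have c3: "z3 c \<in> carrier R" for c unfolding z3_def by (rule exec_closed_ring[OF c])
  have c4: "z4 c \<in> carrier R" for c unfolding z4_def by (rule exec_closed_ring[OF c3])
  have c5: "z5 c \<in> carrier R" for c unfolding z5_def by (rule exec_closed_ring[OF c4])
  have c6: "z6 c \<in> carrier R" for c unfolding z6_def by (rule exec_closed_ring[OF c5])
  have cr: "r c \<in> carrier R" for c unfolding r_def by (rule exec_closed_ring[OF c6])
  let ?up = "\<lambda>t Z. \<Oplus>X\<in>{X \<in> layer n ?p. Z \<subseteq> X}. N (t, X)"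
  have zero: "N (t, X) = \<zero>" if "card X \<noteq> ?p" "t \<in> {3, 4, 5, 6}" for t X
    using that by (intro N(5)) auto
  have z3: "z3 c = (if fst c = 3 \<and> snd c \<in> subsets_upto n ?p then ?up 3 (snd c) else N c)" for c
    unfolding z3_def by (rule exec_zeta[OF c]) (simp add: zero)
  have z4: "z4 c = (if fst c = 4 \<and> snd c \<in> subsets_upto n ?p then ?up 4 (snd c) else z3 c)" for c
    unfolding z4_def by (subst exec_zeta[OF c3]) (simp_all add: zero z3)
  have z5: "z5 c = (if fst c = 5 \<and> snd c \<in> subsets_upto n ?p then ?up 5 (snd c) else z4 c)" for c
    unfolding z5_def by (subst exec_zeta[OF c4]) (simp_all add: zero z3 z4)
  have z6: "z6 c = (if fst c = 6 \<and> snd c \<in> subsets_upto n ?p then ?up 6 (snd c) else z5 c)" for c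
    unfolding z6_def by (subst exec_zeta[OF c5]) (simp_all add: zero z3 z4 z5)
  have up: "z6 (t, Z) = ?up t Z" if "Z \<in> subsets_upto n ?p" "t \<in> {3, 4, 5, 6}" for t Z
    using that by (auto simp: z6 z5 z4 z3)
  have r: "r c = (if c = (8, {}) then z6 c \<oplus> (\<Oplus>Z\<in>subsets_upto n ?p. sg R (odd (card Z)) (z6 (5, Z) \<otimes> z6 (4, Z)))
      else z6 c)" for c
    unfolding r_def by (rule exec_combine[OF c6]) simp_all
  have "exec R A (ring_prog m n) (\<lambda>_. \<zero>) (8, {}) = exec R A (combine n ?p 3 6) r (8, {})"
    by (simp add: ring_prog_def N_def z3_def z4_def z5_def z6_def r_def)
  also have "\<dots> = r (8, {}) \<oplus> (\<Oplus>Z\<in>subsets_upto n ?p. sg R (odd (card Z)) (r (3, Z) \<otimes> r (6, Z)))"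
    by (subst exec_combine[OF cr]) simp_all
  also have "r (8, {}) = (\<Oplus>Z\<in>subsets_upto n ?p. sg R (odd (card Z)) (z6 (5, Z) \<otimes> z6 (4, Z)))"
  proof -
    have "z6 (8, {}) = \<zero>" using N(6) by (simp add: z6 z5 z4 z3)
    moreover have "(\<Oplus>Z\<in>subsets_upto n ?p. sg R (odd (card Z)) (z6 (5, Z) \<otimes> z6 (4, Z))) \<in> carrier R"
      by (intro fs_closed sg_closed_ring m_closed c6)
    ultimately show ?thesis by (simp add: r)
  qed
  also have "\<dots> = (\<Oplus>Z\<in>subsets_upto n ?p. sg R (odd (card Z))
      ((\<Oplus>X\<in>{X \<in> layer n ?p. Z \<subseteq> X}. top_part m X) \<otimes> (\<Oplus>X\<in>{X \<in> layer n ?p. Z \<subseteq> X}. mid_bottom m n X)))"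
  proof (rule fs_cong[OF refl])
    fix Z assume Z: "Z \<in> subsets_upto n ?p"
    have "?up 5 Z = (\<Oplus>X\<in>{X \<in> layer n ?p. Z \<subseteq> X}. top_part m X)"
      "?up 4 Z = (\<Oplus>X\<in>{X \<in> layer n ?p. Z \<subseteq> X}. mid_bottom m n X)"
      by (auto intro!: fs_cong simp: N)
    then show "sg R (odd (card Z)) (z6 (5, Z) \<otimes> z6 (4, Z)) = sg R (odd (card Z))
      ((\<Oplus>X\<in>{X \<in> layer n ?p. Z \<subseteq> X}. top_part m X) \<otimes> (\<Oplus>X\<in>{X \<in> layer n ?p. Z \<subseteq> X}. mid_bottom m n X))"
      using up[OF Z] by simp
  qed (auto intro!: fs_closed sg_closed_ring)
  also have "(\<Oplus>Z\<in>subsets_upto n ?p. sg R (odd (card Z)) (r (3, Z) \<otimes> r (6, Z))) =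
      (\<Oplus>Z\<in>subsets_upto n ?p. sg R (odd (card Z))
      ((\<Oplus>X\<in>{X \<in> layer n ?p. Z \<subseteq> X}. top_mid m X) \<otimes> (\<Oplus>X\<in>{X \<in> layer n ?p. Z \<subseteq> X}. bottom_part m X)))"
  proof (rule fs_cong[OF refl])
    fix Z assume Z: "Z \<in> subsets_upto n ?p"
    have "?up 3 Z = (\<Oplus>X\<in>{X \<in> layer n ?p. Z \<subseteq> X}. top_mid m X)"
      "?up 6 Z = (\<Oplus>X\<in>{X \<in> layer n ?p. Z \<subseteq> X}. bottom_part m X)"
      by (auto intro!: fs_cong simp: N)
    then show "sg R (odd (card Z)) (r (3, Z) \<otimes> r (6, Z)) = sg R (odd (card Z))
      ((\<Oplus>X\<in>{X \<in> layer n ?p. Z \<subseteq> X}. top_mid m X) \<otimes> (\<Oplus>X\<in>{X \<in> layer n ?p. Z \<subseteq> X}. bottom_part m X))"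
      using up[OF Z] by (simp add: r)
  qed (auto intro!: fs_closed sg_closed_ring)
  finally show ?thesis unfolding per_inclusion_exclusion .
qed

end

definition ring_cells :: "nat \<Rightarrow> nat \<Rightarrow> (nat \<times> nat set) set" where
  "ring_cells m n = {0..6} \<times> subsets_upto n (m div 2) \<union> {(7, {}), (8, {})}"

lemma finite_ring_cells: "finite (ring_cells m n)"
  by (simp add: ring_cells_def)

lemma card_ring_cells: "card (ring_cells m n) \<le> 7 * card (subsets_upto n (m div 2)) + 2"
proof -
  have "card {(7 :: nat, {} :: nat set), (8, {})} = 2" by simp
  then show ?thesis
    unfolding ring_cells_def
    using card_Un_le[of "{0..6} \<times> subsets_upto n (m div 2)" "{(7, {}), (8, {})}"]
    by (simp add: card_cartesian_product)
qed

lemma prog_ok_ring_prog: "prog_ok m n (ring_cells m n) (ring_prog m n)"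
proof -
  let ?D = "ring_cells m n" and ?p = "m div 2"
  have cell: "{t} \<times> subsets_upto n ?p \<subseteq> ?D" if "t \<le> 6" for t
    using that by (auto simp: ring_cells_def)
  have cell': "(t, X) \<in> ?D" if "t \<le> 6" "X \<subseteq> {1..n}" "card X \<le> ?p" for t X
    using that by (auto simp: ring_cells_def subsets_upto_def)
  have cell7: "(7, {}) \<in> ?D" "(8, {}) \<in> ?D" by (auto simp: ring_cells_def)
  have "prog_ok m n ?D (dp 0 ?p n ?p)" "prog_ok m n ?D (dp 1 m n ?p)"
    by (rule prog_ok_dp; simp add: cell)+
  moreover have "prog_ok m n ?D (mid_prog m n)"
  proof -
    have "Suc ?p \<le> m" if "odd m" using that by (auto elim!: oddE)
    then show ?thesis by (auto simp: mid_prog_def cell7 intro!: cell')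
  qed
  moreover have "prog_ok m n ?D (zeta t n ?p)" if "t \<le> 6" for t
    by (rule prog_ok_zeta[OF cell[OF that]])
  moreover have "prog_ok m n ?D (fill n ?p t b x y)"
    if "t \<le> 6" "\<And>X. X \<in> layer n ?p \<Longrightarrow> arg_ok m n ?D (x X)" "\<And>X. X \<in> layer n ?p \<Longrightarrow> arg_ok m n ?D (y X)"
    for t b x y
    using that unfolding fill_def by (auto intro!: cell')
  moreover have "prog_ok m n ?D (combine n ?p t u)" if "t \<le> 6" "u \<le> 6" for t u
    using that unfolding combine_def by (auto simp: cell7 subsets_upto_def intro!: cell')
  ultimately show ?thesis
    unfolding ring_prog_def parts_prog_def by (simp add: cell' cell7)
qed

text \<open>The term \<open>n\<close> adds up the middle row. Of the seven terms with
  \<open>m div 2\<close>, two are the tables, one is \<open>mid_sum\<close> and four are the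
  superset sums; the remaining seven are five uses of \<open>fill\<close> and two of
  \<open>combine\<close>.\<close>

lemma accums_ring_prog:
  defines "b \<equiv> \<lambda>m n. card (subsets_upto n (m div 2))"
  shows "accums (ring_prog m n) \<le> n + 7 * (m div 2 * b m n) + 7 * b m n"
proof -
  let ?p = "m div 2"
  have L: "card (layer n ?p) \<le> b m n"
    unfolding b_def by (rule card_mono) (auto simp: subsets_upto_def)
  have "accums (mid_prog m n) \<le> n + ?p * (n choose ?p)"
    by (simp add: mid_prog_def card_marked_layer del: One_nat_def)
  also have "n choose ?p = card (layer n ?p)" by (simp add: n_subsets)
  finally have "accums (mid_prog m n) \<le> n + ?p * b m n"
    using mult_le_mono2[OF L, of ?p] by linarith
  moreover have "accums (fill n ?p t s x y) \<le> b m n" for t s x y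
    using L by (simp add: fill_def)
  moreover have "accums (combine n ?p t u) = b m n" for t u
    by (simp add: combine_def b_def)
  moreover have "accums (zeta t n ?p) \<le> ?p * b m n" for t
    using accums_zeta unfolding b_def .
  moreover have "accums (dp t e n ?p) \<le> ?p * b m n" for t e
    using accums_dp unfolding b_def .
  ultimately have *: "accums (mid_prog m n) \<le> n + ?p * b m n"
     "\<And>t s x y. accums (fill n ?p t s x y) \<le> b m n"
     "\<And>t u. accums (combine n ?p t u) = b m n" "\<And>t. accums (zeta t n ?p) \<le> ?p * b m n"
     "\<And>t e. accums (dp t e n ?p) \<le> ?p * b m n" by blast+
  show ?thesis
    unfolding ring_prog_def parts_prog_def accums_simps *(3)
    using *(1) *(2)[of 3 True "\<lambda>X. Var (0, X)" "\<lambda>X. Var (2, X)"]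
      *(2)[of 4 False "\<lambda>X. Var (7, {})" "\<lambda>X. Var (1, X)"]
      *(2)[of 4 True "\<lambda>X. Var (2, X)" "\<lambda>X. Var (1, X)"]
      *(2)[of 5 False "\<lambda>X. Var (0, X)" "\<lambda>_. One"] *(2)[of 6 False "\<lambda>X. Var (1, X)" "\<lambda>_. One"]
      *(4)[of 3] *(4)[of 4] *(4)[of 5] *(4)[of 6] *(5)[of 0 ?p] *(5)[of 1 m]
    by linarith
qed

text \<open>For \<open>m = 1\<close> the binomial sum is 1, whereas adding up \<open>n\<close>
  entries takes \<open>n - 1\<close> additions, so this case carries \<open>n\<close> as its time
  bound. For \<open>m \<ge> 2\<close> the binomial sum is at least \<open>n\<close> and absorbs the
  middle row.\<close>

lemma per_computable_ring:
  "per_computable (ring :: 'a ring \<Rightarrow> bool) (\<lambda>p. True)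
    (\<lambda>m n. if m = 1 then n else m * binomial_sum n (real m / 2))
    (\<lambda>m n. binomial_sum n (real m / 2))"
\<comment> \<open>With \<open>p = m div 2 \<ge> 1\<close> and \<open>b\<close> the binomial sum, the
  cost is at most \<open>3 * 15 * p * b\<close>, and \<open>2 * p \<le> m\<close>; 40 leaves room to
  spare.\<close>
proof (rule per_computableI[where c = 40 and 'c = "nat \<times> nat set"])
  fix m n :: nat assume mn: "1 \<le> m" "m \<le> n"
  let ?b = "card (subsets_upto n (m div 2))"
  have b: "binomial_sum n (real m / 2) = ?b" by (rule binomial_sum_half)
  have acc: "accums (ring_prog m n) \<le> n + 7 * (m div 2 * ?b) + 7 * ?b" by (rule accums_ring_prog)
  have "3 * accums (ring_prog m n) \<le> 40 * (if m = 1 then n else m * binomial_sum n (real m / 2))"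
  proof (cases "m = 1")
    case True
    have "?b = 1" using True by (simp add: card_subsets_upto)
    then show ?thesis using acc True mn by simp
  next
    case False
    then have p: "1 \<le> m div 2" using mn by simp
    have "n \<le> (\<Sum>k\<in>{1}. n choose k)" by simp
    also have "\<dots> \<le> ?b"
      unfolding card_subsets_upto using p by (intro sum_mono2) auto
    finally have "n \<le> ?b" .
    moreover have "?b \<le> m div 2 * ?b" using p by simp
    moreover have "2 * (m div 2 * ?b) \<le> m * ?b"
      unfolding mult.assoc[symmetric] by (rule mult_le_mono1) simp
    ultimately have "3 * accums (ring_prog m n) \<le> 40 * (m * ?b)" using acc by linarith
    then show ?thesis using False b by simp
  qed
  moreover have "card (ring_cells m n) + 1 \<le> 40 * binomial_sum n (real m / 2)"
  proof -
    have "(\<Sum>k\<in>{0}. n choose k) \<le> ?b"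
      unfolding card_subsets_upto by (intro sum_mono2) auto
    then have "1 \<le> ?b" by simp
    then show ?thesis using card_ring_cells[of m n] unfolding b by linarith
  qed
  moreover have "(8, {}) \<in> ring_cells m n" by (simp add: ring_cells_def)
  moreover have "exec R A (ring_prog m n) (\<lambda>_. \<zero>\<^bsub>R\<^esub>) (8, {}) = per R m n A"
    if "ring R" "\<forall>i j. A i j \<in> carrier R" for R :: "'a ring" and A
  proof -
    interpret ring R by fact
    interpret ring_matrix R A by unfold_locales (use that in auto)
    show ?thesis by (rule exec_ring_prog)
  qed
  ultimately show "\<exists>(p :: (nat \<times> nat set) instr list) D r. finite D \<and> r \<in> D \<and> prog_ok m n D p \<and>
      (add_only p \<or> (\<lambda>_. True) = (\<lambda>_. True)) \<and>
      3 * accums p \<le> 40 * (if m = 1 then n else m * binomial_sum n (real m / 2)) \<and>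
      card D + 1 \<le> 40 * binomial_sum n (real m / 2) \<and>
      (\<forall>(R :: 'a ring) A. ring R \<and> (\<forall>i j. A i j \<in> carrier R) \<longrightarrow>
        exec R A p (\<lambda>_. \<zero>\<^bsub>R\<^esub>) r = per R m n A)"
    using finite_ring_cells[of m n] prog_ok_ring_prog[of m n]
    by (intro exI[of _ "ring_prog m n"] exI[of _ "ring_cells m n"] exI[of _ "(8, {})"]) blast
next
  show "\<zero>\<^bsub>R\<^esub> \<in> carrier R" if "ring R" for R :: "'a ring"
    using that by (rule ring.ring_simprules)
qed simp

section \<open>Commutative rings\<close>

locale cring_matrix = comm_semiring_matrix R A + cring R
  for R :: "'a ring" (structure) and A
begin

text \<open>\<open>esym s j k\<close> is the elementary symmetric polynomial of degree
  \<open>k\<close> in \<open>s 1, ..., s j\<close>, split by whether the last variable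
  occurs.\<close>

fun esym :: "(nat \<Rightarrow> 'a) \<Rightarrow> nat \<Rightarrow> nat \<Rightarrow> 'a" where
  "esym s j 0 = \<one>"
| "esym s 0 (Suc k) = \<zero>"
| "esym s (Suc j) (Suc k) = esym s j (Suc k) \<oplus> esym s j k \<otimes> s (Suc j)"

lemma esym_closed: "(\<And>j. s j \<in> carrier R) \<Longrightarrow> esym s j k \<in> carrier R"
  by (induction s j k rule: esym.induct) auto

lemma esym_eq_zero: "(\<And>j. s j \<in> carrier R) \<Longrightarrow> j < k \<Longrightarrow> esym s j k = \<zero>"
  by (induction s j k rule: esym.induct) auto

definition add_row :: "nat \<Rightarrow> nat \<Rightarrow> (nat \<Rightarrow> 'a) \<Rightarrow> nat \<Rightarrow> 'a" where
  "add_row n i s = (\<lambda>j. if j \<in> {1..n} then s j \<oplus> A i j else s j)"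

fun diff :: "nat \<Rightarrow> nat list \<Rightarrow> ((nat \<Rightarrow> 'a) \<Rightarrow> 'a) \<Rightarrow> (nat \<Rightarrow> 'a) \<Rightarrow> 'a" where
  "diff n [] h s = h s"
| "diff n (i # is) h s = diff n is h (add_row n i s) \<ominus> diff n is h s"

definition vectors :: "(nat \<Rightarrow> 'a) set" where
  "vectors = {s. \<forall>j. s j \<in> carrier R}"

lemma vectorsI: "(\<And>j. s j \<in> carrier R) \<Longrightarrow> s \<in> vectors"
  by (simp add: vectors_def)

lemma add_row_vectors [simp]: "s \<in> vectors \<Longrightarrow> add_row n i s \<in> vectors"
  by (auto simp: vectors_def add_row_def)

lemma vectors_closed [simp]: "s \<in> vectors \<Longrightarrow> s j \<in> carrier R"
  by (simp add: vectors_def)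

lemma esym_vectors [simp]: "s \<in> vectors \<Longrightarrow> esym s j k \<in> carrier R"
  by (rule esym_closed) simp

lemma diff_closed:
  "h \<in> vectors \<rightarrow> carrier R \<Longrightarrow> s \<in> vectors \<Longrightarrow> diff n is h s \<in> carrier R"
  by (induction "is" arbitrary: s) auto

lemma diff_const: "a \<in> carrier R \<Longrightarrow> is \<noteq> [] \<Longrightarrow> diff n is (\<lambda>_. a) s = \<zero>"
proof (induction "is" arbitrary: s)
  case (Cons i "is")
  then show ?case by (cases "is = []") (auto simp: r_neg minus_eq)
qed simp

lemma diff_add:
  assumes "h \<in> vectors \<rightarrow> carrier R" "h' \<in> vectors \<rightarrow> carrier R" "s \<in> vectors"
  shows "diff n is (\<lambda>s. h s \<oplus> h' s) s = diff n is h s \<oplus> diff n is h' s"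
  using assms(3)
proof (induction "is" arbitrary: s)
  case (Cons i "is")
  have [simp]: "diff n is h t \<in> carrier R" "diff n is h' t \<in> carrier R" if "t \<in> vectors" for t
    using that assms by (auto intro: diff_closed)
  have "(a \<oplus> b) \<ominus> (c \<oplus> d) = (a \<ominus> c) \<oplus> (b \<ominus> d)"
    if "a \<in> carrier R" "b \<in> carrier R" "c \<in> carrier R" "d \<in> carrier R" for a b c d
    using that by algebra
  then show ?case using Cons by simp
qed simp

text \<open>Product rule with a linear second factor. One difference of \<open>h s * s j\<close> in
  direction \<open>i\<close> is the shifted linear factor times the difference of \<open>h\<close>,
  plus \<open>A i j * h s\<close>. At most one row can act on the linear factor; if none does, it
  has been shifted by all rows.\<close>

lemma diff_Leibniz:
  assumes h: "h \<in> vectors \<rightarrow> carrier R" and "s \<in> vectors" "distinct is" "j \<in> {1..n}"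
  shows "diff n is (\<lambda>s. h s \<otimes> s j) s =
    (s j \<oplus> (\<Oplus>i\<in>set is. A i j)) \<otimes> diff n is h s \<oplus> (\<Oplus>i\<in>set is. A i j \<otimes> diff n (remove1 i is) h s)"
  using assms(2,3)
proof (induction "is" arbitrary: s)
  case Nil
  then show ?case using h by (simp add: m_comm Pi_iff)
next
  case (Cons i "is")
  have c [simp]: "diff n js h t \<in> carrier R" if "t \<in> vectors" for t js
    using that h by (auto intro: diff_closed)
  define t where "t = add_row n i s"
  have t1: "t \<in> vectors" using Cons.prems by (simp add: t_def)
  have t2: "t j = s j \<oplus> A i j" using assms(4) by (simp add: t_def add_row_def)
  note t = t1 t2
  define S where "S = (\<Oplus>i\<in>set is. A i j)"
  define U where "U u = (\<Oplus>i\<in>set is. A i j \<otimes> diff n (remove1 i is) h u)" for u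
  define U' where "U' = (\<Oplus>i'\<in>set is. A i' j \<otimes> diff n (remove1 i' (i # is)) h s)"
  have cl: "S \<in> carrier R" "U t \<in> carrier R" "U s \<in> carrier R" "U' \<in> carrier R"
    using t(1) Cons.prems(1) by (auto simp: S_def U_def U'_def intro!: fs_closed simp del: diff.simps)
  \<comment> \<open>\<open>t\<close> is \<open>s\<close> shifted by row \<open>i\<close>, so
    \<open>U t\<close> minus \<open>U s\<close> is the difference of \<open>U\<close> in that
    direction, which restores \<open>i\<close> to each list.\<close>
  have "U t = U' \<oplus> U s"
  proof -
    have eq: "A i' j \<otimes> diff n (remove1 i' is) h t =
        A i' j \<otimes> diff n (remove1 i' (i # is)) h s \<oplus> A i' j \<otimes> diff n (remove1 i' is) h s"
      if "i' \<in> set is" for i'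
    proof -
      have "i' \<noteq> i" using that Cons.prems(2) by auto
      then have "remove1 i' (i # is) = i # remove1 i' is" by simp
      moreover have "a \<otimes> x = a \<otimes> (x \<ominus> y) \<oplus> a \<otimes> y"
        if "a \<in> carrier R" "x \<in> carrier R" "y \<in> carrier R" for a x y
        using that by algebra
      ultimately show ?thesis using t(1) Cons.prems(1) by (simp add: t_def)
    qed
    have "U t = (\<Oplus>i'\<in>set is. A i' j \<otimes> diff n (remove1 i' (i # is)) h s \<oplus> A i' j \<otimes> diff n (remove1 i' is) h s)"
      unfolding U_def by (rule fs_cong[OF refl eq]) (use Cons.prems(1) in \<open>simp_all del: remove1.simps\<close>)
    also have "\<dots> = U' \<oplus> U s"
      unfolding U_def U'_def by (rule fs_add) (use Cons.prems(1) in \<open>simp_all del: remove1.simps\<close>)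
    finally show ?thesis .
  qed
  moreover have "diff n (i # is) (\<lambda>s. h s \<otimes> s j) s =
      ((t j \<oplus> S) \<otimes> diff n is h t \<oplus> U t) \<ominus> ((s j \<oplus> S) \<otimes> diff n is h s \<oplus> U s)"
    using Cons.IH[OF t(1)] Cons.IH[OF Cons.prems(1)] Cons.prems(2)
    by (simp add: t_def[symmetric] S_def U_def)
  moreover have "(\<Oplus>i'\<in>set (i # is). A i' j) = A i j \<oplus> S"
    unfolding S_def list.set by (rule fs_insert) (use Cons.prems(2) in auto)
  moreover have "(\<Oplus>i'\<in>set (i # is). A i' j \<otimes> diff n (remove1 i' (i # is)) h s) = A i j \<otimes> diff n is h s \<oplus> U'"
    unfolding U'_def list.set
    by (subst fs_insert) (use Cons.prems in \<open>auto simp del: diff.simps\<close>)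
  moreover have "((s j \<oplus> a \<oplus> S) \<otimes> x \<oplus> (u' \<oplus> u)) \<ominus> ((s j \<oplus> S) \<otimes> y \<oplus> u) =
      (s j \<oplus> (a \<oplus> S)) \<otimes> (x \<ominus> y) \<oplus> (a \<otimes> y \<oplus> u')"
    if "a \<in> carrier R" "x \<in> carrier R" "y \<in> carrier R" "u \<in> carrier R" "u' \<in> carrier R" for a x y u u'
    using that cl(1) vectors_closed[OF Cons.prems(1), of j] by algebra
  ultimately show ?case
    using cl t Cons.prems(1) by (simp add: t_def[symmetric])
qed

text \<open>Splitting off the last variable and applying \<open>diff_Leibniz\<close> leaves a term
  in which \<open>esym\<close> has degree less than the number of differences, which vanishes, and
  terms with one row removed, which match \<open>V_insert_column\<close>. The two claims feed each
  other. The base point \<open>s\<close> drops out of the result.\<close>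

lemma diff_esym:
  assumes "distinct is" "s \<in> vectors" "j \<le> n"
  shows "k < length is \<longrightarrow> diff n is (\<lambda>s. esym s j k) s = \<zero>"
    and "k = length is \<longrightarrow> diff n is (\<lambda>s. esym s j k) s = V is {1..j}"
proof -
  have cl: "(\<lambda>s. esym s j k) \<in> vectors \<rightarrow> carrier R" for j k
    by (auto intro: esym_closed)
  have "(k < length is \<longrightarrow> diff n is (\<lambda>s. esym s j k) s = \<zero>) \<and>
      (k = length is \<longrightarrow> diff n is (\<lambda>s. esym s j k) s = V is {1..j})"
    using assms
  proof (induction j arbitrary: "is" k)
    case 0
    then show ?case by (cases k; cases "is") (auto simp: diff_const simp del: diff.simps(2))
  next
    case (Suc j)
    show ?case
    proof (cases k)
      case 0
      then show ?thesis by (cases "is") (auto simp: diff_const simp del: diff.simps(2))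
    next
      case (Suc k')
      let ?D = "\<lambda>js k. diff n js (\<lambda>s. esym s j k) s"
      have dcl: "?D js k \<in> carrier R" for js k using cl Suc.prems(2) by (rule diff_closed)
      define S where "S = s (Suc j) \<oplus> (\<Oplus>i\<in>set is. A i (Suc j))"
      have S: "S \<in> carrier R" using Suc.prems(2) by (auto simp: S_def intro!: fs_closed)
      have "diff n is (\<lambda>s. esym s (Suc j) (Suc k')) s =
          ?D is (Suc k') \<oplus> diff n is (\<lambda>s. esym s j k' \<otimes> s (Suc j)) s"
        unfolding esym.simps using cl Suc.prems(2) by (intro diff_add) auto
      also have "diff n is (\<lambda>s. esym s j k' \<otimes> s (Suc j)) s =
          S \<otimes> ?D is k' \<oplus> (\<Oplus>i\<in>set is. A i (Suc j) \<otimes> ?D (remove1 i is) k')"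
        unfolding S_def using Suc.prems by (intro diff_Leibniz[OF cl]) auto
      finally have eq: "diff n is (\<lambda>s. esym s (Suc j) (Suc k')) s =
          ?D is (Suc k') \<oplus> (S \<otimes> ?D is k' \<oplus> (\<Oplus>i\<in>set is. A i (Suc j) \<otimes> ?D (remove1 i is) k'))" .
      have IH: "k < length js \<Longrightarrow> ?D js k = \<zero>" "k = length js \<Longrightarrow> ?D js k = V js {1..j}"
        if "distinct js" for js k
        using Suc.IH[OF that Suc.prems(2)] Suc.prems(3) by auto
      have len: "length (remove1 i is) = length is - 1" if "i \<in> set is" for i
        using that by (simp add: length_remove1)
      show ?thesis
      proof (intro conjI impI)
        assume k: "k < length is"
        have "(\<Oplus>i\<in>set is. A i (Suc j) \<otimes> ?D (remove1 i is) k') = \<zero>"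
          using k Suc \<open>k = Suc k'\<close> Suc.prems(1) len by (intro fs_zero) (simp add: IH)
        moreover have "?D is k = \<zero>" "?D is k' = \<zero>" using k \<open>k = Suc k'\<close> Suc.prems(1) IH by auto
        ultimately show "diff n is (\<lambda>s. esym s (Suc j) k) s = \<zero>"
          using eq S \<open>k = Suc k'\<close> by simp
      next
        assume k: "k = length is"
        have "(\<Oplus>i\<in>set is. A i (Suc j) \<otimes> ?D (remove1 i is) k') =
            (\<Oplus>i\<in>set is. A i (Suc j) \<otimes> V (remove1 i is) {1..j})"
          using k \<open>k = Suc k'\<close> Suc.prems(1) len by (intro fs_cong) (simp_all add: IH)
        moreover have "?D is k = V is {1..j}" "?D is k' = \<zero>"
          using k \<open>k = Suc k'\<close> Suc.prems(1) IH by auto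
        moreover have "V is {1..Suc j} = V is {1..j} \<oplus> (\<Oplus>i\<in>set is. A i (Suc j) \<otimes> V (remove1 i is) {1..j})"
        proof -
          have "{1..Suc j} = insert (Suc j) {1..j}" by auto
          then show ?thesis using V_insert_column[of "{1..j}" "Suc j" "is"] Suc.prems(1) by simp
        qed
        moreover have "(\<Oplus>i\<in>set is. A i (Suc j) \<otimes> V (remove1 i is) {1..j}) \<in> carrier R"
          by (rule fs_closed) simp
        ultimately show "diff n is (\<lambda>s. esym s (Suc j) k) s = V is {1..Suc j}"
          using eq S \<open>k = Suc k'\<close> by simp
      qed
    qed
  qed
  then show "k < length is \<longrightarrow> diff n is (\<lambda>s. esym s j k) s = \<zero>"
    "k = length is \<longrightarrow> diff n is (\<lambda>s. esym s j k) s = V is {1..j}" by auto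
qed

text \<open>As any base point would do, the origin is taken, where zeroed cells start. For
  \<open>m = n\<close> the polynomial is the product of all coordinates, and expanding the
  differences gives Ryser's formula.\<close>

lemma per_eq_diff: "per R m n A = diff n [1..<Suc m] (\<lambda>s. esym s n m) (\<lambda>_. \<zero>)"
proof -
  have "diff n [1..<Suc m] (\<lambda>s. esym s n m) (\<lambda>_. \<zero>) = V [1..<Suc m] {1..n}"
    by (rule diff_esym(2)[rule_format]) (simp_all add: vectorsI del: upt_Suc)
  then show ?thesis by (simp only: per_eq_V)
qed

end

text \<open>Tags of the cells: 0 for the result, 1 for the current sum of rows, 2 for the elementary symmetric
  polynomials in its first \<open>j\<close> coordinates, 3 for a copy of them that makes the updates independent.\<close>

definition esym_layer :: "nat \<Rightarrow> nat \<Rightarrow> nat \<Rightarrow> (nat \<times> nat) instr list" where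
  "esym_layer m n j =
     accum_all (\<lambda>_. False) (\<lambda>k. (3, k)) (\<lambda>k. Var (2, k - 1)) (\<lambda>_. Var (1, j))
       {k. 1 \<le> k \<and> k \<le> m \<and> k \<le> j \<and> j \<le> k + (n - m)} @
     load_all (\<lambda>k. (2, k)) (\<lambda>k. Var (3, k)) {0..m}"

text \<open>The same cells serve all \<open>2 ^ m\<close> evaluations, which keeps the space linear,
  so both tables are reset before each one. Loading constants is not charged.\<close>

definition esym_init :: "nat \<Rightarrow> nat \<Rightarrow> (nat \<times> nat) instr list" where
  "esym_init t m = load_all (\<lambda>k. (t, k)) (\<lambda>k. if k = 0 then One else Zero) {0..m}"

definition esym_prog :: "nat \<Rightarrow> nat \<Rightarrow> (nat \<times> nat) instr list" where
  "esym_prog m n = esym_init 2 m @ esym_init 3 m @ concat (map (esym_layer m n) [1..<Suc n])"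

definition leaf_prog :: "nat \<Rightarrow> nat \<Rightarrow> bool \<Rightarrow> (nat \<times> nat) instr list" where
  "leaf_prog m n b = esym_prog m n @ [Accum b (0, 0) (Var (2, m)) One]"

definition row_prog :: "nat \<Rightarrow> bool \<Rightarrow> nat \<Rightarrow> (nat \<times> nat) instr list" where
  "row_prog n b i = accum_all (\<lambda>_. b) (\<lambda>j. (1, j)) (\<lambda>j. Inp i j) (\<lambda>_. One) {1..n}"

text \<open>The branch without row \<open>i\<close> gets the opposite sign. The row is added in
  place and subtracted again afterwards; saving the sum on every level instead would take up to
  \<open>m * n\<close> cells.\<close>

fun ryser_prog :: "nat \<Rightarrow> nat \<Rightarrow> nat list \<Rightarrow> bool \<Rightarrow> (nat \<times> nat) instr list" where
  "ryser_prog m n [] b = leaf_prog m n b"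
| "ryser_prog m n (i # is) b =
     ryser_prog m n is (\<not> b) @ row_prog n False i @ ryser_prog m n is b @ row_prog n True i"

definition ryser_cells :: "nat \<Rightarrow> nat \<Rightarrow> (nat \<times> nat) set" where
  "ryser_cells m n = {(0, 0)} \<union> {1} \<times> {1..n} \<union> {2, 3} \<times> {0..m}"

lemma finite_ryser_cells [simp]: "finite (ryser_cells m n)"
  by (simp add: ryser_cells_def)

lemma card_ryser_cells: "card (ryser_cells m n) \<le> 1 + n + 2 * (m + 1)"
proof -
  let ?U = "{(0 :: nat, 0 :: nat)} \<union> {1} \<times> {1..n}" and ?W = "{2, 3 :: nat} \<times> {0..m}"
  have "card (ryser_cells m n) \<le> card ?U + card ?W"
    unfolding ryser_cells_def by (rule card_Un_le)
  also have "card ?U \<le> card {(0 :: nat, 0 :: nat)} + card ({1 :: nat} \<times> {1..n})" by (rule card_Un_le)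
  finally show ?thesis by (simp add: card_cartesian_product)
qed

lemma finite_band [simp]: "finite {k. a \<le> k \<and> k \<le> (m :: nat) \<and> P k}"
  by (rule finite_subset[of _ "{..m}"]) auto

lemma prog_ok_ryser_prog:
  assumes "m \<le> n" "set is \<subseteq> {1..m}"
  shows "prog_ok m n (ryser_cells m n) (ryser_prog m n is b)"
proof -
  have "prog_ok m n (ryser_cells m n) (esym_layer m n j)" if "1 \<le> j" "j \<le> n" for j
    using that unfolding esym_layer_def by (auto simp: ryser_cells_def)
  then have "prog_ok m n (ryser_cells m n) (leaf_prog m n b)" for b
    by (auto simp: leaf_prog_def esym_prog_def esym_init_def ryser_cells_def simp del: upt_Suc)
  then show ?thesis using assms(2)
    by (induction "is" arbitrary: b) (auto simp: row_prog_def ryser_cells_def)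
qed

lemma accums_leaf_prog: "accums (leaf_prog m n b) \<le> m * (n - m + 1) + 1"
proof -
  let ?I = "\<lambda>j. {k. 1 \<le> k \<and> k \<le> m \<and> k \<le> j \<and> j \<le> k + (n - m)}"
  have "accums (leaf_prog m n b) = (\<Sum>j\<in>{1..<Suc n}. card (?I j)) + 1"
    by (simp add: leaf_prog_def esym_prog_def esym_init_def esym_layer_def o_def
        interv_sum_list_conv_sum_set_nat del: upt_Suc One_nat_def)
  also have "(\<Sum>j\<in>{1..<Suc n}. card (?I j)) = card (Sigma {1..<Suc n} ?I)"
    by (rule card_SigmaI[symmetric]) simp_all
  also have "\<dots> \<le> card ({1..m} \<times> {..n - m})"
    \<comment> \<open>\<open>k \<le> j\<close> keeps \<open>j - k\<close> from truncating, and the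
      band bounds it by \<open>n - m\<close>.\<close>
    by (rule card_inj_on_le[where f = "\<lambda>(j, k). (k, j - k)"]) (auto simp: inj_on_def)
  finally show ?thesis by (simp add: card_cartesian_product)
qed

text \<open>The recurrence \<open>T' = 2 * T + 2 * n\<close> becomes pure doubling for
  \<open>T + 2 * n\<close>, hence the extra summand on the left.\<close>

lemma accums_ryser_prog:
  "accums (ryser_prog m n is b) + 2 * n \<le> 2 ^ length is * (m * (n - m + 1) + 1 + 2 * n)"
proof (induction "is" arbitrary: b)
  case Nil
  then show ?case using accums_leaf_prog[of m n b] by simp
next
  case (Cons i "is")
  let ?e = "2 ^ length is * (m * (n - m + 1) + 1 + 2 * n)"
  have "2 ^ length (i # is) * (m * (n - m + 1) + 1 + 2 * n) = 2 * ?e" by simp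
  moreover have "accums (row_prog n b i) = n" for b by (simp add: row_prog_def)
  ultimately show ?case using Cons[of b] Cons[of "\<not> b"] by (simp only: ryser_prog.simps accums_simps)
qed

section \<open>Correctness of the recursion over the rows\<close>

context cring_matrix
begin

lemma exec_esym_prog:
  assumes f: "\<And>c. f c \<in> carrier R" and mn: "m \<le> n" "1 \<le> m"
  shows "exec R A (esym_prog m n) f (2, m) = esym (\<lambda>j. f (1, j)) n m"
    and "c \<in> {0, 1} \<times> UNIV \<Longrightarrow> exec R A (esym_prog m n) f c = f c"
proof -
  let ?s = "\<lambda>j. f (1, j)"
  have s: "esym ?s j k \<in> carrier R" for j k using f by (intro esym_closed)
  define g where "g j = exec R A (esym_init 2 m @ esym_init 3 m @ concat (map (esym_layer m n) [1..<Suc j])) f" for j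
  have gc: "g j c \<in> carrier R" for j c
    unfolding g_def by (rule exec_closed[OF f])
      (auto simp: esym_init_def esym_layer_def simp del: upt_Suc)
  \<comment> \<open>Once \<open>j\<close> exceeds \<open>k + (n - m)\<close>, the cells of degree
    \<open>k \<ge> 1\<close> are no longer updated and may be stale; degree \<open>m\<close> no
    longer depends on them. Only degree 0 keeps its value 1 throughout.\<close>
  have inv: "(\<forall>k\<le>m. g j (2, k) = g j (3, k)) \<and>
      (\<forall>k\<le>m. k = 0 \<or> j \<le> k + (n - m) \<longrightarrow> g j (3, k) = esym ?s j k) \<and>
      (\<forall>c\<in>{0, 1} \<times> UNIV. g j c = f c)" if "j \<le> n" for j
    using that
  proof (induction j)
    case 0
    define f1 where "f1 = exec R A (esym_init 2 m) f"
    have f1: "f1 (2, k) = (if k = 0 then \<one> else \<zero>)" if "k \<le> m" for k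
      unfolding f1_def esym_init_def
      using that by (subst exec_load_all(1)) (auto simp: inj_on_def split: if_splits)
    have f1': "f1 c = f c" if "fst c \<noteq> 2" for c
      unfolding f1_def esym_init_def
      using that by (subst exec_load_all(2)) (auto simp: inj_on_def split: if_splits)
    have g0: "g 0 = exec R A (esym_init 3 m) f1" by (simp add: g_def f1_def)
    have g1: "g 0 (3, k) = (if k = 0 then \<one> else \<zero>)" if "k \<le> m" for k
      unfolding g0 esym_init_def
      using that by (subst exec_load_all(1)) (auto simp: inj_on_def split: if_splits)
    have g1': "g 0 c = f1 c" if "fst c \<noteq> 3" for c
      unfolding g0 esym_init_def
      using that by (subst exec_load_all(2)) (auto simp: inj_on_def split: if_splits)
    have "esym ?s 0 k = (if k = 0 then \<one> else \<zero>)" for k by (cases k) auto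
    then show ?case using f1 f1' g1 g1' by auto
  next
    case (Suc j)
    then have IH: "\<And>k. k \<le> m \<Longrightarrow> g j (2, k) = g j (3, k)"
        "\<And>k. k \<le> m \<Longrightarrow> k = 0 \<or> j \<le> k + (n - m) \<Longrightarrow> g j (3, k) = esym ?s j k"
        "\<And>c. c \<in> {0, 1} \<times> UNIV \<Longrightarrow> g j c = f c" by auto
    let ?I = "{k. 1 \<le> k \<and> k \<le> m \<and> k \<le> Suc j \<and> Suc j \<le> k + (n - m)}"
    let ?acc = "accum_all (\<lambda>_. False) (\<lambda>k. (3, k)) (\<lambda>k. Var (2, k - 1)) (\<lambda>_. Var (1, Suc j)) ?I"
    define h where "h = exec R A ?acc (g j)"
    have h_in: "h (3, k) = g j (3, k) \<oplus> g j (2, k - 1) \<otimes> g j (1, Suc j)" if "k \<in> ?I" for k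
      unfolding h_def using exec_accum_all_inj(1)[of ?I "g j" "\<lambda>_. False" "\<lambda>k. Var (2, k - 1)"
          "\<lambda>k. (3, k)" "\<lambda>_. Var (1, Suc j)", OF _ gc _ _ _ that] by (simp add: inj_on_def)
    have h_out: "h c = g j c" if "c \<notin> (\<lambda>k. (3, k)) ` ?I" for c
      unfolding h_def using that by (intro exec_accum_all_inj(2) gc) (auto simp: inj_on_def)
    have gS: "g (Suc j) = exec R A (load_all (\<lambda>k. (2, k)) (\<lambda>k. Var (3, k)) {0..m}) h"
      by (simp add: g_def h_def esym_layer_def)
    have g2: "g (Suc j) (2, k) = h (3, k)" if "k \<le> m" for k
      unfolding gS using that by (subst exec_load_all(1)) (auto simp: inj_on_def)
    have g3: "g (Suc j) c = h c" if "fst c \<noteq> 2" for c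
      unfolding gS using that by (subst exec_load_all(2)) (auto simp: inj_on_def)
    have "h (3, k) = esym ?s (Suc j) k" if k: "k \<le> m" "k = 0 \<or> Suc j \<le> k + (n - m)" for k
    proof (cases k)
      case 0
      then show ?thesis using IH(2)[of 0] h_out[of "(3, 0)"] by auto
    next
      case (Suc k')
      show ?thesis
      proof (cases "k \<le> Suc j")
        case True
        then have "k \<in> ?I" using k Suc by auto
        then show ?thesis
          using h_in[of k] IH(1)[of k'] IH(2)[of k] IH(2)[of k'] IH(3)[of "(1, Suc j)"] k Suc by simp
      next
        case False
        then have "h (3, k) = g j (3, k)" by (intro h_out) auto
        then show ?thesis
          using False k IH(2)[of k] f by (simp add: esym_eq_zero)
      qed
    qed
    moreover have "h c = f c" if "c \<in> {0, 1} \<times> UNIV" for c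
    proof -
      have "c \<notin> (\<lambda>k. (3, k)) ` ?I" using that by auto
      then show ?thesis using h_out[of c] IH(3)[OF that] by simp
    qed
    moreover have "fst c \<noteq> 2" if "c \<in> {0, 1} \<times> UNIV" for c :: "nat \<times> nat" using that by auto
    ultimately show ?case using g2 g3 by simp
  qed
  have "g n (2, m) = esym ?s n m" using inv[of n] mn by auto
  then show "exec R A (esym_prog m n) f (2, m) = esym (\<lambda>j. f (1, j)) n m"
    by (simp add: g_def esym_prog_def)
  show "exec R A (esym_prog m n) f c = f c" if "c \<in> {0, 1} \<times> UNIV"
    using inv[of n] that by (auto simp: g_def esym_prog_def)
qed

text \<open>Each call returns the row cells unchanged, so the second call sees exactly one
  additional row and the last subtraction undoes it; without this second claim the induction would
  not close. The leaves accumulate into the result cell, hence the summand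
  \<open>f (0, 0)\<close>.\<close>

lemma exec_ryser_prog:
  assumes f: "\<And>c. f c \<in> carrier R" and mn: "m \<le> n" "1 \<le> m"
  shows "exec R A (ryser_prog m n is b) f (0, 0) =
      f (0, 0) \<oplus> sg R b (diff n is (\<lambda>s. esym s n m) (\<lambda>j. f (1, j))) \<and>
    (\<forall>j. exec R A (ryser_prog m n is b) f (1, j) = f (1, j))"
  using f
proof (induction "is" arbitrary: f b)
  case Nil
  then show ?case
    using exec_esym_prog[of f m n] mn by (auto simp: leaf_prog_def esym_closed)
next
  case (Cons i "is")
  let ?D = "\<lambda>f. diff n is (\<lambda>s. esym s n m) (\<lambda>j. f (1, j))"
  have D: "?D f \<in> carrier R" if "\<And>c. f c \<in> carrier R" for f :: "nat \<times> nat \<Rightarrow> 'a"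
    using that by (intro diff_closed) (auto intro!: vectorsI)
  have row: "exec R A (row_prog n b i) f c =
      (if fst c = 1 \<and> snd c \<in> {1..n} then f c \<oplus> sg R b (A i (snd c)) else f c)"
    if "\<And>c. f c \<in> carrier R" for f c b
  proof (cases "fst c = 1 \<and> snd c \<in> {1..n}")
    case True
    then have "c = (1, snd c)" by (cases c) simp
    then show ?thesis
      using exec_accum_all_inj(1)[of "{1..n}" f "\<lambda>_. b" "\<lambda>j. Inp i j" "\<lambda>j. (1, j)" "\<lambda>_. One" "snd c", OF _ that]
        True ring_axioms by (simp add: row_prog_def inj_on_def)
  next
    case False
    then show ?thesis unfolding row_prog_def
      by (subst exec_accum_all_inj(2)) (use that ring_axioms in \<open>auto simp: inj_on_def\<close>)
  qed
  define f1 where "f1 = exec R A (ryser_prog m n is (\<not> b)) f"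
  define f2 where "f2 = exec R A (row_prog n False i) f1"
  define f3 where "f3 = exec R A (ryser_prog m n is b) f2"
  define f4 where "f4 = exec R A (row_prog n True i) f3"
  have c1: "f1 c \<in> carrier R" for c unfolding f1_def by (rule exec_closed) (use Cons.prems ring_axioms in auto)
  have c2: "f2 c \<in> carrier R" for c unfolding f2_def by (rule exec_closed) (use c1 ring_axioms in auto)
  have c3: "f3 c \<in> carrier R" for c unfolding f3_def by (rule exec_closed) (use c2 ring_axioms in auto)
  have 1: "f1 (0, 0) = f (0, 0) \<oplus> sg R (\<not> b) (?D f)" "\<And>j. f1 (1, j) = f (1, j)"
    using Cons.IH[OF Cons.prems, of "\<not> b"] by (auto simp: f1_def)
  have 2: "f2 c = (if fst c = 1 \<and> snd c \<in> {1..n} then f1 c \<oplus> A i (snd c) else f1 c)" for c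
    using row[of f1 False c] c1 by (simp add: f2_def)
  have 3: "f3 (0, 0) = f2 (0, 0) \<oplus> sg R b (?D f2)" "\<And>j. f3 (1, j) = f2 (1, j)"
    using Cons.IH[OF c2, of b] by (auto simp: f3_def)
  have 4: "f4 c = (if fst c = 1 \<and> snd c \<in> {1..n} then f3 c \<ominus> A i (snd c) else f3 c)" for c
    using row[of f3 True c] c3 by (simp add: f4_def sg_def minus_eq)
  have f4: "exec R A (ryser_prog m n (i # is) b) f = f4"
    by (simp add: f1_def f2_def f3_def f4_def)
  have "(\<lambda>j. f2 (1, j)) = add_row n i (\<lambda>j. f (1, j))"
    using 1(2) by (simp add: 2 add_row_def fun_eq_iff)
  then have "f4 (0, 0) = (f (0, 0) \<oplus> sg R (\<not> b) (?D f)) \<oplus> sg R b (diff n is (\<lambda>s. esym s n m) (add_row n i (\<lambda>j. f (1, j))))"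
    by (simp add: 4 3 2 1)
  also have "\<dots> = f (0, 0) \<oplus> sg R b (diff n (i # is) (\<lambda>s. esym s n m) (\<lambda>j. f (1, j)))"
  proof -
    have "(u \<oplus> sg R (\<not> b) x) \<oplus> sg R b y = u \<oplus> sg R b (y \<ominus> x)"
      if "u \<in> carrier R" "x \<in> carrier R" "y \<in> carrier R" for u x y
    proof (cases b)
      case True
      have "(u \<oplus> x) \<oplus> \<ominus> y = u \<oplus> \<ominus> (y \<ominus> x)" using that by algebra
      then show ?thesis using True by (simp add: sg_def)
    next
      case False
      have "(u \<oplus> \<ominus> x) \<oplus> y = u \<oplus> (y \<ominus> x)" using that by algebra
      then show ?thesis using False by (simp add: sg_def)
    qed
    moreover have "diff n is (\<lambda>s. esym s n m) (add_row n i (\<lambda>j. f (1, j))) \<in> carrier R"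
      using Cons.prems by (intro diff_closed add_row_vectors) (auto intro!: vectorsI)
    ultimately show ?thesis using Cons.prems D[of f, OF Cons.prems] by simp
  qed
  finally have "f4 (0, 0) = f (0, 0) \<oplus> sg R b (diff n (i # is) (\<lambda>s. esym s n m) (\<lambda>j. f (1, j)))" .
  moreover have "f4 (1, j) = f (1, j)" for j
  proof -
    have "(x \<oplus> a) \<ominus> a = x" if "x \<in> carrier R" "a \<in> carrier R" for x a using that by algebra
    then show ?thesis using Cons.prems 1(2)[of j] 3(2)[of j] by (simp add: 4 2)
  qed
  ultimately show ?case by (simp add: f4 del: ryser_prog.simps diff.simps)
qed

end

lemma per_computable_cring:
  "per_computable (cring :: 'a ring \<Rightarrow> bool) (\<lambda>p. True)
    (\<lambda>m n. (m * n - m ^ 2 + n) * 2 ^ m) (\<lambda>m n. n)"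
\<comment> \<open>The constant 12 is 3 operations times 4: \<open>m * n - m ^ 2\<close> equals
  \<open>m * (n - m)\<close>, and the lower-order part \<open>m + 1 + 2 * n\<close> is at most
  \<open>4 * n\<close>.\<close>
proof (rule per_computableI[where c = 12 and 'c = "nat \<times> nat"])
  fix m n :: nat assume mn: "1 \<le> m" "m \<le> n"
  let ?p = "ryser_prog m n [1..<Suc m] False"
  have len: "length [1..<Suc m] = m" by simp
  have *: "m * n - m ^ 2 = m * (n - m)" by (simp add: power2_eq_square diff_mult_distrib2)
  have "accums ?p \<le> 2 ^ m * (m * (n - m + 1) + 1 + 2 * n)"
    using accums_ryser_prog[of m n "[1..<Suc m]" False] unfolding len by linarith
  also have "\<dots> \<le> 2 ^ m * (4 * (m * (n - m) + n))"
    by (rule mult_left_mono) (use mn in auto)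
  finally have "3 * accums ?p \<le> 12 * ((m * n - m ^ 2 + n) * 2 ^ m)"
    unfolding * by (simp only: ac_simps)
  moreover have "card (ryser_cells m n) + 1 \<le> 12 * n"
  proof -
    have "1 + n + 2 * (m + 1) + 1 \<le> 12 * n" using mn by simp
    then show ?thesis using card_ryser_cells[of m n] by simp
  qed
  moreover have "(0, 0) \<in> ryser_cells m n" by (simp add: ryser_cells_def)
  moreover have "prog_ok m n (ryser_cells m n) ?p"
    by (rule prog_ok_ryser_prog) (use mn in auto)
  moreover have "exec R A ?p (\<lambda>_. \<zero>\<^bsub>R\<^esub>) (0, 0) = per R m n A"
    if "cring R" "\<forall>i j. A i j \<in> carrier R" for R :: "'a ring" and A
  proof -
    interpret cring R by fact
    interpret cring_matrix R A
      by unfold_locales (use that in auto)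
    show ?thesis
      using exec_ryser_prog[of "\<lambda>_. \<zero>\<^bsub>R\<^esub>" m n "[1..<Suc m]" False] mn
        diff_closed[of "\<lambda>s. esym s n m" "\<lambda>_. \<zero>\<^bsub>R\<^esub>" n "[1..<Suc m]"]
      by (simp add: per_eq_diff vectorsI Pi_iff del: upt_Suc)
  qed
  ultimately show "\<exists>(p :: (nat \<times> nat) instr list) D r. finite D \<and> r \<in> D \<and> prog_ok m n D p \<and>
      (add_only p \<or> (\<lambda>_. True) = (\<lambda>_. True)) \<and> 3 * accums p \<le> 12 * ((m * n - m ^ 2 + n) * 2 ^ m) \<and>
      card D + 1 \<le> 12 * n \<and>
      (\<forall>(R :: 'a ring) A. cring R \<and> (\<forall>i j. A i j \<in> carrier R) \<longrightarrow>
        exec R A p (\<lambda>_. \<zero>\<^bsub>R\<^esub>) r = per R m n A)"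
    using finite_ryser_cells[of m n]
    by (intro exI[of _ ?p] exI[of _ "ryser_cells m n"] exI[of _ "(0, 0)"]) blast
next
  show "\<zero>\<^bsub>R\<^esub> \<in> carrier R" if "cring R" for R :: "'a ring"
    using that by (rule cring.cring_simprules)
qed simp

section \<open>The four bounds\<close>

theorem theorem1:
  shows
    "per_computable (semiring :: 'a ring \<Rightarrow> bool) semiring_program
       (\<lambda>m n. m * binomial_sum n (real m)) (\<lambda>m n. binomial_sum n (real m)) \<and>
     per_computable (comm_semiring :: 'a ring \<Rightarrow> bool) semiring_program
       (\<lambda>m n. m * (n - m + 1) * 2 ^ m) (\<lambda>m n. (n - m + 1) * 2 ^ m) \<and>
     per_computable (ring :: 'a ring \<Rightarrow> bool) (\<lambda>p. True)
       (\<lambda>m n. if m = 1 then n else m * binomial_sum n (real m / 2))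
       (\<lambda>m n. binomial_sum n (real m / 2)) \<and>
     per_computable (cring :: 'a ring \<Rightarrow> bool) (\<lambda>p. True)
       (\<lambda>m n. (m * n - m ^ 2 + n) * 2 ^ m) (\<lambda>m n. n)"
  by (intro conjI per_computable_semiring per_computable_comm_semiring
      per_computable_ring per_computable_cring)

end
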